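(* Let $A=[A(i,j)]_{i,j=1}^N$ be an irreducible, non-permutation matrix with entries in $\{0,1\}$. A function $f\in C(X_A,\mathbb{Z})$ is minimal if and only if the $C^*$-algebra $\mathcal{F}_{A,f}$ is simple.
   Context: $\mathcal{O}_A$ is the Cuntz–Krieger algebra: the $C^*$-algebra generated by partial isometries $S_1,\dots,S_N$ with $\sum_{j=1}^N S_jS_j^*=1$ and $S_i^*S_i=\sum_{j=1}^N A(i,j)S_jS_j^*$. $X_A=\{(x_n)_{n\in\mathbb{N}}\in\{1,\dots,N\}^{\mathbb{N}} : A(x_n,x_{n+1})=1\ \forall n\}$ with the relative product topology, $\sigma_A((x_n)_n)=(x_{n+1})_n$. $B_*(X_A)$ is the set of admissible words (finite initial segments of points of $X_A$). For a word $\mu=(\mu_1,\dots,\mu_m)$, $S_\mu=S_{\mu_1}\cdots S_{\mu_m}$ and $U_\mu=\{x\in X_A: x_1=\mu_1,\dots,x_m=\mu_m\}$. $C(X_A)$ is identified with the subalgebra $\mathcal{D}_A\subset\mathcal{O}_A$ generated by the projections $S_\mu S_\mu^*$ via $\chi_{U_\mu}\mapsto S_\mu S_\mu^*$. For $f\in C(X_A,\mathbb{Z})$ (integer-valued continuous functions), $\rho^{A,f}$ is the action of $\mathbb{T}=\mathbb{R}/\mathbb{Z}$ on $\mathcal{O}_A$ with $\rho^{A,f}_t(S_i)=\exp(2\pi\sqrt{-1}\,tf)S_i$, and $\mathcal{F}_{A,f}$ is its fixed point algebra. For $n\ge1$, $f^n(x)=\sum_{i=0}^{n-1}f(\sigma_A^i(x))$,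 and $f^0\equiv0$. A function $f\in C(X_A,\mathbb{Z})$ is called minimal if for every $z\in X_A$ and $\mu\in B_*(X_A)$ there exist $x\in U_\mu$ and nonnegative integers $k,l$ such that $\sigma_A^k(x)=\sigma_A^l(z)$ and $f^k(x)=f^l(z)$. *)

theory Defs
  imports "HOL-Analysis.Analysis"
begin

section \<open>Unital \<open>C\<^sup>*\<close>-algebras\<close>

class scaleC =
  fixes scaleC :: "complex \<Rightarrow> 'a \<Rightarrow> 'a"  (infixr "*\<^sub>C" 75)

class star =
  fixes star :: "'a \<Rightarrow> 'a"

text \<open>The sort \<open>real_normed_algebra_1\<close> includes \<open>0 \<noteq> 1\<close>, so the zero algebra is excluded.\<close>

class unital_cstar_algebra = real_normed_algebra_1 + banach + scaleC + star +
  assumes scaleC_add_right: "c *\<^sub>C (x + y) = c *\<^sub>C x + c *\<^sub>C y"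
    and scaleC_add_left: "(c + d) *\<^sub>C x = c *\<^sub>C x + d *\<^sub>C x"
    and scaleC_scaleC: "c *\<^sub>C (d *\<^sub>C x) = (c * d) *\<^sub>C x"
    and scaleC_of_real: "complex_of_real r *\<^sub>C x = r *\<^sub>R x"
    and mult_scaleC_left: "(c *\<^sub>C x) * y = c *\<^sub>C (x * y)"
    and mult_scaleC_right: "x * (c *\<^sub>C y) = c *\<^sub>C (x * y)"
    and norm_scaleC: "norm (c *\<^sub>C x) = cmod c * norm x"
    and star_add: "star (x + y) = star x + star y"
    and star_scaleC: "star (c *\<^sub>C x) = cnj c *\<^sub>C star x"
    and star_mult: "star (x * y) = star y * star x"
    and star_star: "star (star x) = x"
    and cstar_identity: "norm (star x * x) = (norm x)\<^sup>2"

definition cstar_subalgebra :: "'a::unital_cstar_algebra set \<Rightarrow> bool" where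
  "cstar_subalgebra B \<longleftrightarrow>
     0 \<in> B \<and> closed B \<and>
     (\<forall>x\<in>B. \<forall>y\<in>B. x + y \<in> B \<and> x * y \<in> B) \<and>
     (\<forall>c. \<forall>x\<in>B. c *\<^sub>C x \<in> B) \<and>
     (\<forall>x\<in>B. star x \<in> B)"

definition cstar_generated :: "'a::unital_cstar_algebra set \<Rightarrow> 'a set" where
  "cstar_generated G = cstar_subalgebra hull G"

definition star_hom_on ::
    "'a::unital_cstar_algebra set \<Rightarrow> ('a \<Rightarrow> 'b::unital_cstar_algebra) \<Rightarrow> bool" where
  "star_hom_on B \<phi> \<longleftrightarrow>
     (\<forall>x\<in>B. \<forall>y\<in>B. \<phi> (x + y) = \<phi> x + \<phi> y \<and> \<phi> (x * y) = \<phi> x * \<phi> y) \<and>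
     (\<forall>c. \<forall>x\<in>B. \<phi> (c *\<^sub>C x) = c *\<^sub>C \<phi> x) \<and>
     (\<forall>x\<in>B. \<phi> (star x) = star (\<phi> x))"

definition star_automorphism_on :: "'a::unital_cstar_algebra set \<Rightarrow> ('a \<Rightarrow> 'a) \<Rightarrow> bool" where
  "star_automorphism_on B \<phi> \<longleftrightarrow> star_hom_on B \<phi> \<and> bij_betw \<phi> B B"

definition closed_ideal :: "'a::unital_cstar_algebra set \<Rightarrow> 'a set \<Rightarrow> bool" where
  "closed_ideal J B \<longleftrightarrow>
     J \<subseteq> B \<and> 0 \<in> J \<and> closed J \<and>
     (\<forall>x\<in>J. \<forall>y\<in>J. x + y \<in> J) \<and>
     (\<forall>c. \<forall>x\<in>J. c *\<^sub>C x \<in> J) \<and>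
     (\<forall>b\<in>B. \<forall>x\<in>J. b * x \<in> J \<and> x * b \<in> J)"

definition simple_cstar :: "'a::unital_cstar_algebra set \<Rightarrow> bool" where
  "simple_cstar B \<longleftrightarrow>
     cstar_subalgebra B \<and> B \<noteq> {0} \<and> (\<forall>J. closed_ideal J B \<longrightarrow> J = {0} \<or> J = B)"

definition partial_isometry :: "'a::unital_cstar_algebra \<Rightarrow> bool" where
  "partial_isometry v \<longleftrightarrow> v * star v * v = v"


section \<open>Matrices and the one-sided shift\<close>

text \<open>The index set \<open>{1,\<dots>,N}\<close> is an arbitrary finite type \<open>'n\<close>, with \<open>N = CARD('n)\<close>.
  Sequences are indexed from \<open>0\<close>.\<close>

text \<open>The operations \<open>*\<close> and \<open>^\<close> on vectors are componentwise, hence the explicit power.\<close>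

primrec matrix_power :: "nat^'n::finite^'n \<Rightarrow> nat \<Rightarrow> nat^'n^'n" where
  "matrix_power A 0 = mat 1"
| "matrix_power A (Suc m) = A ** matrix_power A m"

definition zero_one_matrix :: "nat^'n::finite^'n \<Rightarrow> bool" where
  "zero_one_matrix A \<longleftrightarrow> (\<forall>i j. A $ i $ j \<in> {0, 1})"

definition irreducible_matrix :: "nat^'n::finite^'n \<Rightarrow> bool" where
  "irreducible_matrix A \<longleftrightarrow> (\<forall>i j. \<exists>m\<ge>1. matrix_power A m $ i $ j > 0)"

definition permutation_matrix :: "nat^'n::finite^'n \<Rightarrow> bool" where
  "permutation_matrix A \<longleftrightarrow> (\<exists>\<pi>. bij \<pi> \<and> A = (\<chi> i j. if j = \<pi> i then 1 else 0))"

definition shift_space :: "nat^'n::finite^'n \<Rightarrow> (nat \<Rightarrow> 'n) set" where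
  "shift_space A = {x. \<forall>n. A $ x n $ x (Suc n) = 1}"

definition shift_topology :: "nat^'n::finite^'n \<Rightarrow> (nat \<Rightarrow> 'n) topology" where
  "shift_topology A =
     subtopology (product_topology (\<lambda>_. discrete_topology UNIV) UNIV) (shift_space A)"

definition shift :: "(nat \<Rightarrow> 'n) \<Rightarrow> nat \<Rightarrow> 'n" where
  "shift x = (\<lambda>n. x (Suc n))"

definition admissible_words :: "nat^'n::finite^'n \<Rightarrow> 'n list set" where
  "admissible_words A = {map x [0..<m] | x m. x \<in> shift_space A}"

definition cylinder :: "nat^'n::finite^'n \<Rightarrow> 'n list \<Rightarrow> (nat \<Rightarrow> 'n) set" where
  "cylinder A \<mu> = {x \<in> shift_space A. \<forall>i<length \<mu>. x i = \<mu> ! i}"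

text \<open>Elements of \<open>C(X\<^sub>A, \<int>)\<close> and \<open>C(X\<^sub>A)\<close> are represented by total functions on sequences;
  their values outside \<open>X\<^sub>A\<close> are irrelevant.\<close>

definition continuous_int :: "nat^'n::finite^'n \<Rightarrow> ((nat \<Rightarrow> 'n) \<Rightarrow> int) set" where
  "continuous_int A = {f. continuous_map (shift_topology A) (discrete_topology UNIV) f}"

definition continuous_complex :: "nat^'n::finite^'n \<Rightarrow> ((nat \<Rightarrow> 'n) \<Rightarrow> complex) set" where
  "continuous_complex A = {g. continuous_map (shift_topology A) euclidean g}"

definition birkhoff_sum :: "((nat \<Rightarrow> 'n) \<Rightarrow> int) \<Rightarrow> nat \<Rightarrow> (nat \<Rightarrow> 'n) \<Rightarrow> int" where
  "birkhoff_sum f n x = (\<Sum>i<n. f ((shift ^^ i) x))"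

definition minimal_function :: "nat^'n::finite^'n \<Rightarrow> ((nat \<Rightarrow> 'n) \<Rightarrow> int) \<Rightarrow> bool" where
  "minimal_function A f \<longleftrightarrow>
     (\<forall>z\<in>shift_space A. \<forall>\<mu>\<in>admissible_words A. \<exists>x\<in>cylinder A \<mu>. \<exists>k l.
        (shift ^^ k) x = (shift ^^ l) z \<and> birkhoff_sum f k x = birkhoff_sum f l z)"


section \<open>Cuntz--Krieger algebras\<close>

definition cuntz_krieger_family ::
    "nat^'n::finite^'n \<Rightarrow> ('n \<Rightarrow> 'a::unital_cstar_algebra) \<Rightarrow> bool" where
  "cuntz_krieger_family A S \<longleftrightarrow>
     (\<forall>i. partial_isometry (S i)) \<and>
     (\<Sum>j\<in>UNIV. S j * star (S j)) = 1 \<and>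
     (\<forall>i. star (S i) * S i = (\<Sum>j\<in>UNIV. of_nat (A $ i $ j) * (S j * star (S j))))"

definition ck_algebra :: "('n::finite \<Rightarrow> 'a::unital_cstar_algebra) \<Rightarrow> 'a set" where
  "ck_algebra S = cstar_generated (range S)"

text \<open>The algebra \<open>\<O>\<^sub>A\<close> is the universal \<open>C\<^sup>*\<close>-algebra of a Cuntz--Krieger family, realised
  as the \<open>C\<^sup>*\<close>-subalgebra generated by \<open>S\<close> in an arbitrary unital \<open>C\<^sup>*\<close>-algebra \<open>'a\<close>.  As a
  formula cannot quantify over types, universality is only required for families \<open>T\<close> in the
  same type \<open>'a\<close>; this is implied by full universality.  By the Cuntz--Krieger uniqueness
  theorem, for irreducible non-permutation \<open>A\<close> either requirement holds for every
  Cuntz--Krieger family \<open>S\<close>, so the algebras described are exactly the copies of \<open>\<O>\<^sub>A\<close>.\<close>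

definition universal_cuntz_krieger_family ::
    "nat^'n::finite^'n \<Rightarrow> ('n \<Rightarrow> 'a::unital_cstar_algebra) \<Rightarrow> bool" where
  "universal_cuntz_krieger_family A S \<longleftrightarrow>
     cuntz_krieger_family A S \<and>
     (\<forall>T :: 'n \<Rightarrow> 'a. cuntz_krieger_family A T \<longrightarrow>
        (\<exists>\<phi>. star_hom_on (ck_algebra S) \<phi> \<and> (\<forall>i. \<phi> (S i) = T i)))"

definition word_isometry :: "('n \<Rightarrow> 'a::unital_cstar_algebra) \<Rightarrow> 'n list \<Rightarrow> 'a" where
  "word_isometry S \<mu> = prod_list (map S \<mu>)"

definition diagonal_algebra ::
    "nat^'n::finite^'n \<Rightarrow> ('n \<Rightarrow> 'a::unital_cstar_algebra) \<Rightarrow> 'a set" where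
  "diagonal_algebra A S =
     cstar_generated ((\<lambda>\<mu>. word_isometry S \<mu> * star (word_isometry S \<mu>)) ` admissible_words A)"

text \<open>The \<open>*\<close>-isomorphism \<open>C(X\<^sub>A) \<rightarrow> \<D>\<^sub>A\<close>.  The last condition is injectivity, up to the
  irrelevant values outside \<open>X\<^sub>A\<close>.\<close>

definition is_diagonal_isomorphism ::
    "nat^'n::finite^'n \<Rightarrow> ('n \<Rightarrow> 'a::unital_cstar_algebra)
      \<Rightarrow> (((nat \<Rightarrow> 'n) \<Rightarrow> complex) \<Rightarrow> 'a) \<Rightarrow> bool" where
  "is_diagonal_isomorphism A S \<Phi> \<longleftrightarrow>
     (\<forall>g\<in>continuous_complex A. \<forall>h\<in>continuous_complex A.
        \<Phi> (\<lambda>x. g x + h x) = \<Phi> g + \<Phi> h \<and> \<Phi> (\<lambda>x. g x * h x) = \<Phi> g * \<Phi> h) \<and>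
     (\<forall>c. \<forall>g\<in>continuous_complex A. \<Phi> (\<lambda>x. c * g x) = c *\<^sub>C \<Phi> g) \<and>
     (\<forall>g\<in>continuous_complex A. \<Phi> (\<lambda>x. cnj (g x)) = star (\<Phi> g)) \<and>
     (\<forall>\<mu>\<in>admissible_words A.
        \<Phi> (indicator (cylinder A \<mu>)) = word_isometry S \<mu> * star (word_isometry S \<mu>)) \<and>
     \<Phi> ` continuous_complex A = diagonal_algebra A S \<and>
     (\<forall>g\<in>continuous_complex A. \<forall>h\<in>continuous_complex A.
        \<Phi> g = \<Phi> h \<longleftrightarrow> (\<forall>x\<in>shift_space A. g x = h x))"

text \<open>These conditions determine the isomorphism on \<open>C(X\<^sub>A)\<close>, since the indicator functions of
  cylinders span a dense subspace.\<close>

definition diagonal_isomorphism ::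
    "nat^'n::finite^'n \<Rightarrow> ('n \<Rightarrow> 'a::unital_cstar_algebra)
      \<Rightarrow> ((nat \<Rightarrow> 'n) \<Rightarrow> complex) \<Rightarrow> 'a" where
  "diagonal_isomorphism A S = (SOME \<Phi>. is_diagonal_isomorphism A S \<Phi>)"

text \<open>Actions of \<open>\<real>/\<int>\<close> are represented as actions \<open>\<rho>\<close> of \<open>\<real>\<close> for which \<open>\<rho> 1\<close> is the
  identity.\<close>

definition circle_action_on ::
    "'a::unital_cstar_algebra set \<Rightarrow> (real \<Rightarrow> 'a \<Rightarrow> 'a) \<Rightarrow> bool" where
  "circle_action_on B \<rho> \<longleftrightarrow>
     (\<forall>t. star_automorphism_on B (\<rho> t)) \<and>
     (\<forall>a\<in>B. \<rho> 0 a = a \<and> \<rho> 1 a = a) \<and>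
     (\<forall>s t. \<forall>a\<in>B. \<rho> (s + t) a = \<rho> s (\<rho> t a)) \<and>
     (\<forall>a\<in>B. continuous_on UNIV (\<lambda>t. \<rho> t a))"

definition is_gauge_action ::
    "nat^'n::finite^'n \<Rightarrow> ('n \<Rightarrow> 'a::unital_cstar_algebra) \<Rightarrow> ((nat \<Rightarrow> 'n) \<Rightarrow> int)
      \<Rightarrow> (real \<Rightarrow> 'a \<Rightarrow> 'a) \<Rightarrow> bool" where
  "is_gauge_action A S f \<rho> \<longleftrightarrow>
     circle_action_on (ck_algebra S) \<rho> \<and>
     (\<forall>t i. \<rho> t (S i) =
        diagonal_isomorphism A S (\<lambda>x. exp (2 * pi * \<i> * of_real t * of_int (f x))) * S i)"

text \<open>A gauge action is determined on \<open>\<O>\<^sub>A\<close> by its values on the generators.\<close>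

definition gauge_action ::
    "nat^'n::finite^'n \<Rightarrow> ('n \<Rightarrow> 'a::unital_cstar_algebra) \<Rightarrow> ((nat \<Rightarrow> 'n) \<Rightarrow> int)
      \<Rightarrow> real \<Rightarrow> 'a \<Rightarrow> 'a" where
  "gauge_action A S f = (SOME \<rho>. is_gauge_action A S f \<rho>)"

definition fixed_point_algebra ::
    "nat^'n::finite^'n \<Rightarrow> ('n \<Rightarrow> 'a::unital_cstar_algebra) \<Rightarrow> ((nat \<Rightarrow> 'n) \<Rightarrow> int) \<Rightarrow> 'a set" where
  "fixed_point_algebra A S f = {a \<in> ck_algebra S. \<forall>t. gauge_action A S f t a = a}"

end

theory Submission
  imports Defs "HOL-Computational_Algebra.Formal_Power_Series" "HOL-Library.Omega_Words_Fun"
begin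

text \<open>Write \<open>P\<^sub>\<xi>\<close> for the projection \<open>S\<^sub>\<xi> S\<^sub>\<xi>\<^sup>*\<close> onto the cylinder of a word \<open>\<xi>\<close>.  Irreducibility and failure of
  being a permutation make the aperiodic points dense in the shift space, and compressing an element
  \<open>a\<close> of \<open>\<O>\<^sub>A\<close> by \<open>P\<^sub>\<xi>\<close> for ever longer prefixes \<open>\<xi>\<close> of an aperiodic point leaves asymptotically
  a scalar multiple of \<open>P\<^sub>\<xi>\<close>.  The elements \<open>a\<close> with \<open>\<parallel>a P\<^sub>\<xi>\<parallel> \<rightarrow> 0\<close> along all aperiodic points
  form an ideal of \<open>\<O>\<^sub>A\<close>, and this ideal vanishes: its quotient norm is comparable to the given norm on the
  finite-dimensional algebras spanned by \<open>S\<^sub>\<mu> p\<^sub>j S\<^sub>\<nu>\<^sup>*\<close> with \<open>\<bar>\<mu>\<bar> = \<bar>\<nu>\<bar> = n\<close>, hence equal to it there by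
  the spectral radius formula, and for the standard gauge action a trigonometric polynomial of degree
  \<open>L\<close> is a sum of \<open>2L + 1\<close> homogeneous parts, which is again a subexponential loss.

  So a nonzero ideal of \<open>\<F>\<^bsub>A,f\<^esub>\<close> contains some \<open>P\<^sub>\<mu>\<close>.  If \<open>f\<close> is minimal, partial isometries of
  \<open>\<F>\<^bsub>A,f\<^esub>\<close> move \<open>P\<^sub>\<mu>\<close> onto a cylinder around any given point, and compactness puts the unit into the
  ideal.  Conversely, if no point of \<open>U\<^sub>\<mu>\<close> is equivalent to \<open>z\<close>, the elements \<open>b\<close> of \<open>\<F>\<^bsub>A,f\<^esub>\<close> with
  \<open>\<parallel>P\<^sub>\<xi> a b\<parallel> \<rightarrow> 0\<close> along the prefixes \<open>\<xi>\<close> of \<open>z\<close>, for all \<open>a\<close> in \<open>\<F>\<^bsub>A,f\<^esub>\<close>, form a proper ideal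
  containing \<open>P\<^sub>\<mu>\<close>.\<close>

section \<open>Elementary \<open>C\<^sup>*\<close>-algebra theory\<close>

text \<open>The argument stays inside the given algebra, without Hilbert spaces, quotient algebras,
  functional calculus or integrals. Positivity is replaced by square roots of \<open>1 - x\<close>
  from the binomial series; they give the contractivity of homomorphisms and the orthogonality of
  the range projections of the generators. The defining relations do not mention this orthogonality:
  they only say that the projections sum to 1. Fourier integrals are replaced by averages over roots
  of unity. The ideal that vanishes stands for the kernel of the representation on the orbits of
  aperiodic points; if it did not vanish, a nonzero element of an ideal of the fixed point algebra
  could be invisible to every compression. Its vanishing is proved with the standard gauge action
  although the theorem concerns \<open>f\<close>: there degree 0 leaves only words of equal length,
  hence finite-dimensional algebras, whereas for general \<open>f\<close> elements of degree 0 may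
  involve words of different lengths.\<close>

lemma scaleC_one [simp]: "1 *\<^sub>C x = (x::'a::unital_cstar_algebra)"
  using scaleC_of_real[of 1 x] by simp

lemma scaleC_zero_left [simp]: "0 *\<^sub>C x = (0::'a::unital_cstar_algebra)"
  using scaleC_of_real[of 0 x] by simp

lemma scaleC_zero_right [simp]: "c *\<^sub>C (0::'a::unital_cstar_algebra) = 0"
  using scaleC_add_right[of c 0 "0::'a"] by simp

lemma scaleC_minus_left: "(- c) *\<^sub>C x = - (c *\<^sub>C (x::'a::unital_cstar_algebra))"
  using scaleC_add_left[of c "-c" x] by (simp add: eq_neg_iff_add_eq_0 add.commute)

lemma scaleC_diff_left: "(c - d) *\<^sub>C x = c *\<^sub>C x - d *\<^sub>C (x::'a::unital_cstar_algebra)"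
  using scaleC_add_left[of c "-d" x] by (simp add: scaleC_minus_left)

lemma scaleC_scaleR: "c *\<^sub>C (r *\<^sub>R x) = r *\<^sub>R (c *\<^sub>C (x::'a::unital_cstar_algebra))"
  by (simp flip: scaleC_of_real add: scaleC_scaleC mult.commute)

lemma star_scaleR: "star (r *\<^sub>R x) = r *\<^sub>R star (x::'a::unital_cstar_algebra)"
  using star_scaleC[of "complex_of_real r" x] by (simp add: scaleC_of_real)

lemma norm_star [simp]: "norm (star x) = norm (x::'a::unital_cstar_algebra)"
proof -
  have le: "norm y \<le> norm (star y)" for y :: 'a
  proof (cases "y = 0")
    case False
    have "norm y * norm y \<le> norm (star y) * norm y"
      using cstar_identity[of y] norm_mult_ineq[of "star y" y] by (simp add: power2_eq_square)
    then show ?thesis using False by simp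
  qed simp
  from le[of x] le[of "star x"] show ?thesis by (simp add: star_star)
qed

lemma bounded_linear_star: "bounded_linear (star :: 'a::unital_cstar_algebra \<Rightarrow> 'a)"
  by (rule bounded_linear_intro[where K=1]) (simp_all add: star_add star_scaleR)

lemma bounded_linear_scaleC: "bounded_linear (\<lambda>x::'a::unital_cstar_algebra. c *\<^sub>C x)"
  by (rule bounded_linear_intro[where K="cmod c"])
    (simp_all add: scaleC_add_right scaleC_scaleR norm_scaleC mult.commute)

lemma bounded_linear_scaleC_left: "bounded_linear (\<lambda>c. c *\<^sub>C (x::'a::unital_cstar_algebra))"
proof (rule bounded_linear_intro[where K="norm x"])
  fix r c show "(r *\<^sub>R c) *\<^sub>C x = r *\<^sub>R (c *\<^sub>C x)"
    by (simp flip: scaleC_of_real add: scaleC_scaleC scaleR_conv_of_real)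
qed (simp_all add: scaleC_add_left norm_scaleC)

lemmas star_zero [simp] = linear_simps(3)[OF bounded_linear_star]
lemmas star_diff = linear_simps(2)[OF bounded_linear_star]
lemmas star_sum = linear_sum[OF bounded_linear.linear[OF bounded_linear_star]]
lemmas scaleC_diff_right = linear_simps(2)[OF bounded_linear_scaleC]
lemmas scaleC_sum_right = linear_sum[OF bounded_linear.linear[OF bounded_linear_scaleC]]
lemmas scaleC_sum_left = linear_sum[OF bounded_linear.linear[OF bounded_linear_scaleC_left]]
lemmas tendsto_star = bounded_linear.tendsto[OF bounded_linear_star]
lemmas tendsto_scaleC = bounded_linear.tendsto[OF bounded_linear_scaleC]
lemmas continuous_on_scaleC_left =
  bounded_linear.continuous_on[OF bounded_linear_scaleC_left]

lemma star_one [simp]: "star (1::'a::unital_cstar_algebra) = 1"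
  by (metis mult_1_left mult_1_right star_mult star_star)

lemma star_eq_0_iff [simp]: "star x = 0 \<longleftrightarrow> x = (0::'a::unital_cstar_algebra)"
  by (metis norm_star norm_eq_zero)

lemma star_power: "star (x ^ n) = star (x::'a::unital_cstar_algebra) ^ n"
  by (induction n) (simp_all add: star_mult power_commutes)

lemma star_mult_self_eq_0_iff: "star x * x = 0 \<longleftrightarrow> x = (0::'a::unital_cstar_algebra)"
  using cstar_identity[of x] by auto

text \<open>For self-adjoint \<open>h\<close> the C*-identity says that squaring an element squares
  its norm, and powers of \<open>h\<close> are again self-adjoint.\<close>

lemma norm_power_selfadjoint:
  fixes h :: "'a::unital_cstar_algebra"
  assumes "star h = h"
  shows "norm (h ^ (2 ^ n)) = norm h ^ (2 ^ n)"
proof (induction n)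
  case (Suc n)
  have "norm (h ^ (2 ^ Suc n)) = norm (star (h ^ (2 ^ n)) * h ^ (2 ^ n))"
    using assms by (simp add: star_power power_add mult_2)
  also have "\<dots> = (norm h ^ (2 ^ n))\<^sup>2" using Suc by (simp add: cstar_identity)
  finally show ?case by (simp add: power_mult[symmetric] mult.commute)
qed simp

text \<open>The spectral radius formula for self-adjoint elements turns an estimate on powers that is
  sharp up to a factor of subexponential growth into a sharp estimate.\<close>

lemma norm_le_if_power_bound:
  fixes h :: "'a::unital_cstar_algebra"
  assumes h: "star h = h" and K: "0 \<le> K"
    and bound: "\<And>m. norm (h ^ m) \<le> (\<alpha> * real m + \<beta>) * K ^ m"
  shows "norm h \<le> K"
proof (rule ccontr)
  assume "\<not> norm h \<le> K"
  then have lt: "K < norm h" by simp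
  have pos: "0 < norm h" using K lt by linarith
  define q where "q = K / norm h"
  have q: "0 \<le> q" "q < 1" using K lt pos by (auto simp: q_def)
  have lim: "(\<lambda>m. (\<alpha> * real m + \<beta>) * q ^ m) \<longlonglongrightarrow> 0"
  proof -
    have "(\<lambda>m. \<alpha> * (real m * q ^ m) + \<beta> * q ^ m) \<longlonglongrightarrow> \<alpha> * 0 + \<beta> * 0"
      using q by (intro tendsto_intros powser_times_n_limit_0 LIMSEQ_power_zero) auto
    then show ?thesis by (simp add: algebra_simps)
  qed
  \<comment> \<open>Norms of powers are known exactly only for exponents \<open>2 ^ n\<close>, so
    the limit is taken along that subsequence.\<close>
  have "filterlim (\<lambda>n::nat. 2 ^ n :: nat) sequentially sequentially"
    by (rule filterlim_subseq) (simp add: strict_mono_def)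
  from filterlim_compose[OF lim this]
  have lim2: "(\<lambda>n. (\<alpha> * real (2 ^ n) + \<beta>) * q ^ (2 ^ n)) \<longlonglongrightarrow> 0" .
  have "1 \<le> (\<alpha> * real (2 ^ n) + \<beta>) * q ^ (2 ^ n)" for n
  proof -
    have "norm h ^ (2 ^ n) \<le> (\<alpha> * real (2 ^ n) + \<beta>) * K ^ (2 ^ n)"
      using bound[of "2 ^ n"] by (simp add: norm_power_selfadjoint[OF h])
    then show ?thesis using pos by (simp add: q_def power_divide field_simps)
  qed
  then have "1 \<le> (0::real)" by (intro LIMSEQ_le_const[OF lim2]) auto
  then show False by simp
qed

section \<open>Square roots by the binomial series\<close>

lemma abs_half_gbinomial_le_1: "\<bar>(1/2::real) gchoose n\<bar> \<le> 1"
proof (induction n)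
  case (Suc n)
  have "(1/2 gchoose Suc n :: real) = (1/2 gchoose n) * ((1/2 - real n) / real (Suc n))"
    using gbinomial_mult_1[of "1/2::real" n] by (simp add: field_simps)
  moreover have "\<bar>(1/2 - real n) / real (Suc n)\<bar> \<le> 1" by (simp add: abs_if field_simps)
  ultimately show ?case using Suc mult_le_one[of "\<bar>1/2 gchoose n\<bar>" "\<bar>(1/2 - real n) / real (Suc n)\<bar>"]
    by (simp add: abs_mult)
qed simp

lemma gbinomial_1: "(1::real) gchoose k = (if k \<le> 1 then 1 else 0)"
  using binomial_gbinomial[of 1 k, where 'a=real] by (cases "k = 0"; cases "k = 1") (auto simp: not_le binomial_eq_0)

text \<open>The root is the binomial series of exponent 1/2 at \<open>- x\<close>, absolutely
  convergent because its coefficients are bounded by 1. As a limit of polynomials in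
  \<open>x\<close> it commutes with whatever commutes with \<open>x\<close> and stays in every
  closed unital subalgebra containing \<open>x\<close>.\<close>

lemma selfadjoint_sqrt_one_minus:
  fixes x :: "'a::unital_cstar_algebra"
  assumes x: "star x = x" "norm x < 1"
  obtains s where "star s = s" "s * s = 1 - x" "\<And>y. x * y = y * x \<Longrightarrow> s * y = y * s"
    "\<And>B. cstar_subalgebra B \<Longrightarrow> 1 \<in> B \<Longrightarrow> x \<in> B \<Longrightarrow> s \<in> B"
proof -
  define c :: "nat \<Rightarrow> real" where "c n = (1/2 gchoose n) * (- 1) ^ n" for n
  define s where "s = (\<Sum>n. c n *\<^sub>R x ^ n)"
  have c: "\<bar>c n\<bar> \<le> 1" for n using abs_half_gbinomial_le_1[of n] by (simp add: c_def abs_mult power_abs)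
  have sn: "summable (\<lambda>n. norm (c n *\<^sub>R x ^ n))"
  proof (rule summable_comparison_test')
    show "summable (\<lambda>n. norm x ^ n)" using x by (simp add: summable_geometric)
    fix n show "norm (norm (c n *\<^sub>R x ^ n)) \<le> norm x ^ n"
      using mult_mono[OF c[of n] norm_power_ineq[of x n]] by simp
  qed
  then have sums: "(\<lambda>n. c n *\<^sub>R x ^ n) sums s"
    unfolding s_def by (rule summable_sums[OF summable_norm_cancel])
  have lim: "(\<lambda>n. \<Sum>i<n. c i *\<^sub>R x ^ i) \<longlonglongrightarrow> s" using sums by (simp add: sums_def)
  show ?thesis
  proof
    have "(\<lambda>n. c n *\<^sub>R x ^ n) sums star s"
      using bounded_linear.sums[OF bounded_linear_star sums] x by (simp add: star_scaleR star_power)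
    with sums show "star s = s" by (rule sums_unique2[symmetric])
  next
    \<comment> \<open>Vandermonde's convolution turns the Cauchy square of the coefficients for
      exponent 1/2 into those for exponent 1, which vanish beyond \<open>k = 1\<close>.\<close>
    have conv: "(\<Sum>i\<le>k. (c i *\<^sub>R x ^ i) * (c (k - i) *\<^sub>R x ^ (k - i))) =
        (if k = 0 then 1 else if k = 1 then - x else 0)" for k
    proof -
      have "(\<Sum>i\<le>k. (c i *\<^sub>R x ^ i) * (c (k - i) *\<^sub>R x ^ (k - i))) = (\<Sum>i\<le>k. (c i * c (k - i)) *\<^sub>R x ^ k)"
        by (intro sum.cong) (auto simp flip: power_add)
      also have "\<dots> = (\<Sum>i\<le>k. c i * c (k - i)) *\<^sub>R x ^ k" by (simp add: scaleR_left.sum)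
      also have "(\<Sum>i\<le>k. c i * c (k - i)) = (\<Sum>i\<le>k. (1/2 gchoose i) * (1/2 gchoose (k - i))) * (- 1) ^ k"
        unfolding sum_distrib_right c_def by (intro sum.cong) (auto simp: algebra_simps simp flip: power_add)
      also have "(\<Sum>i\<le>k. (1/2 gchoose i) * (1/2 gchoose (k - i))) = (1::real) gchoose k"
        using gbinomial_Vandermonde[of "1/2::real" "1/2" k] by (simp add: atMost_atLeast0)
      finally show ?thesis by (auto simp: gbinomial_1)
    qed
    have "(\<lambda>k. if k = 0 then 1 else if k = 1 then - x else 0) sums (s * s)"
      using Cauchy_product_sums[OF sn sn] unfolding conv s_def[symmetric] .
    moreover have "(\<lambda>k::nat. if k = 0 then 1 else if k = 1 then - x else 0) sums
        (\<Sum>k\<in>{0,1::nat}. if k = 0 then 1 else if k = 1 then - x else 0)"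
      by (rule sums_finite) auto
    ultimately show "s * s = 1 - x" by (simp add: sums_unique2)
  next
    fix y assume y: "x * y = y * x"
    have "x ^ n * y = y * x ^ n" for n
      by (induction n) (simp_all add: y mult.assoc, simp flip: mult.assoc add: y)
    then have "(\<lambda>n. c n *\<^sub>R x ^ n * y) = (\<lambda>n. y * (c n *\<^sub>R x ^ n))" by simp
    then have "(\<lambda>n. y * (c n *\<^sub>R x ^ n)) sums (s * y)" using sums_mult2[OF sums, of y] by simp
    then show "s * y = y * s" using sums_mult[OF sums, of y] sums_unique2 by blast
  next
    fix B assume B: "cstar_subalgebra B" "1 \<in> B" "x \<in> B"
    then have cl: "closed B" and add: "\<And>u v. u \<in> B \<Longrightarrow> v \<in> B \<Longrightarrow> u + v \<in> B \<and> u * v \<in> B"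
      and sc: "\<And>c u. u \<in> B \<Longrightarrow> c *\<^sub>C u \<in> B" "0 \<in> B" by (auto simp: cstar_subalgebra_def)
    have pw: "x ^ n \<in> B" for n using B add by (induction n) auto
    have "(\<Sum>i<n. c i *\<^sub>R x ^ i) \<in> B" for n
      using pw sc add by (induction n) (auto simp flip: scaleC_of_real)
    then show "s \<in> B" using closed_sequentially[OF cl _ lim] by blast
  qed
qed

text \<open>Imaginary part trick: \<open>x + iy\<close> is normal, and \<open>x\<close> is its real part.\<close>

lemma norm_square_le_sum_squares:
  fixes x y :: "'a::unital_cstar_algebra"
  assumes "star x = x" "star y = y" "x * y = y * x"
  shows "(norm x)\<^sup>2 \<le> norm (x * x + y * y)"
proof -
  define z where "z = x + \<i> *\<^sub>C y"
  have sz: "star z = x - \<i> *\<^sub>C y"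
    using assms by (simp add: z_def star_add star_scaleC scaleC_minus_left)
  have "star z * z = x * x + y * y"
    unfolding sz unfolding z_def
    by (simp add: algebra_simps mult_scaleC_left mult_scaleC_right scaleC_scaleC scaleC_minus_left
        scaleC_diff_right scaleC_add_right assms(3))
  then have nz: "(norm z)\<^sup>2 = norm (x * x + y * y)" using cstar_identity[of z] by simp
  have "2 *\<^sub>R x = z + star z" unfolding sz by (simp add: z_def scaleR_2)
  then have "2 * norm x \<le> norm z + norm z"
    using norm_triangle_ineq[of z "star z"] by (metis norm_scaleR norm_star abs_numeral)
  then show ?thesis using nz by (metis mult_2 mult_le_cancel_left_pos norm_ge_zero power_mono zero_less_numeral)
qed

section \<open>Orthogonality of projections with sum 1\<close>

lemma norm_projection_le_1:
  fixes p :: "'a::unital_cstar_algebra"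
  assumes "star p = p" "p * p = p"
  shows "norm p \<le> 1"
proof (cases "p = 0")
  case False
  have "norm p = (norm p)\<^sup>2" using cstar_identity[of p] assms by simp
  then show ?thesis using False by (simp add: power2_eq_square)
qed simp

lemma norm_projection:
  fixes p :: "'a::unital_cstar_algebra"
  assumes "star p = p" "p * p = p" "p \<noteq> 0"
  shows "norm p = 1"
proof -
  have "norm p = (norm p)\<^sup>2" using cstar_identity[of p] assms by simp
  then show ?thesis using assms by (simp add: power2_eq_square)
qed

text \<open>A projection is an extreme point of the unit ball of its corner. Averaging the squares
  of \<open>p + h\<close> and \<open>p - h\<close> shows that \<open>p + h * h\<close> still has
  norm at most 1, which leaves no room for \<open>h * h\<close>.\<close>

lemma projection_extreme:
  fixes p h :: "'a::unital_cstar_algebra"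
  assumes p: "star p = p" "p * p = p" and h: "star h = h" "p * h = h" "h * p = h"
    and plus: "norm (p + h) \<le> 1" and minus: "norm (p - h) \<le> 1"
  shows "h = 0"
proof -
  have "2 *\<^sub>R (p + h * h) = (p + h) * (p + h) + (p - h) * (p - h)"
    using p h by (simp add: algebra_simps scaleR_2)
  also have "norm \<dots> \<le> 1 + 1"
    by (intro norm_triangle_mono order.trans[OF norm_mult_ineq] mult_le_one plus minus norm_ge_zero)
  finally have n1: "norm (p + h * h) \<le> 1" by simp
  \<comment> \<open>With \<open>s\<close> a root of \<open>1 - c (p + h * h)\<close>, the squares of
    \<open>sqrt c *\<^sub>R h\<close> and \<open>s * p\<close> add up to
    \<open>(1 - c) *\<^sub>R p\<close>. The factor \<open>c < 1\<close> makes the root available;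
    letting \<open>c\<close> tend to 1 gives the claim.\<close>
  have key: "c * (norm h)\<^sup>2 \<le> 1 - c" if c: "0 < c" "c < 1" for c
  proof -
    define x where "x = c *\<^sub>R (p + h * h)"
    have "star x = x" using p h by (simp add: x_def star_scaleR star_add star_mult)
    moreover have "norm x < 1"
    proof -
      have "norm x \<le> c * 1" unfolding x_def using n1 c by simp
      then show ?thesis using c by simp
    qed
    ultimately obtain s where s: "star s = s" "s * s = 1 - x" "\<And>y. x * y = y * x \<Longrightarrow> s * y = y * s"
      by (metis selfadjoint_sqrt_one_minus)
    have xp: "x * p = p * x" unfolding x_def using p h
      by (simp add: algebra_simps) (metis h(2,3) mult.assoc)
    have xh: "x * h = h * x" unfolding x_def using p h by (simp add: algebra_simps)
    note sp = s(3)[OF xp] and sh = s(3)[OF xh]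
    define g where "g = sqrt c *\<^sub>R h"
    have "(norm g)\<^sup>2 \<le> norm (g * g + (s * p) * (s * p))"
    proof (rule norm_square_le_sum_squares)
      show "star g = g" using h by (simp add: g_def star_scaleR)
      show "star (s * p) = s * p" unfolding star_mult s(1) p(1) by (rule sp[symmetric])
      have "h * (s * p) = h * s * p" by (simp add: mult.assoc)
      also have "\<dots> = s * p * h" using h by (simp add: sh[symmetric] mult.assoc)
      finally show "g * (s * p) = s * p * g" by (simp add: g_def)
    qed
    also have "(s * p) * (s * p) = s * (p * s) * p" by (simp add: mult.assoc)
    also have "\<dots> = (s * s) * p" unfolding sp[symmetric] using p by (simp add: mult.assoc)
    also have "\<dots> = (1 - c) *\<^sub>R p - c *\<^sub>R (h * h)"
      using p h by (simp add: s x_def algebra_simps)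
    also have "g * g = c *\<^sub>R (h * h)" using c by (simp add: g_def)
    also have "norm (c *\<^sub>R (h * h) + ((1 - c) *\<^sub>R p - c *\<^sub>R (h * h))) \<le> 1 - c"
      using c norm_projection_le_1[OF p] by (simp add: mult_left_le)
    finally show ?thesis using c by (simp add: g_def power_mult_distrib)
  qed
  have "(norm h)\<^sup>2 \<le> 0"
  proof (rule tendsto_le[where F="at_left (1::real)" and f="\<lambda>c. 1 - c" and g="\<lambda>c. c * (norm h)\<^sup>2"])
    show "((\<lambda>c. c * (norm h)\<^sup>2) \<longlongrightarrow> (norm h)\<^sup>2) (at_left 1)"
      using tendsto_mult_right[OF tendsto_ident_at, of "(norm h)\<^sup>2" 1 "{..<1}"] by simp
    show "((\<lambda>c. 1 - c) \<longlongrightarrow> 0) (at_left (1::real))"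
      using tendsto_diff[OF tendsto_const[of "1::real"] tendsto_ident_at[of "1::real" "{..<1}"]] by simp
    show "\<forall>\<^sub>F c in at_left 1. c * (norm h)\<^sup>2 \<le> 1 - c"
      by (rule eventually_mono[OF eventually_at_left_real[of 0 "1::real"]]) (auto intro: key)
  qed simp
  then show "h = 0" by simp
qed

text \<open>Compressing the sum by \<open>e = p i\<close> gives that the \<open>e * p k * e\<close>
  with \<open>k\<close> different from \<open>i\<close> sum to 0. With an order one would conclude
  that each positive term is 0; here norm estimates and the extremality of \<open>e\<close> do
  this.\<close>

lemma orthogonal_projections:
  fixes p :: "'i \<Rightarrow> 'a::unital_cstar_algebra"
  assumes fin: "finite I" and proj: "\<And>i. i \<in> I \<Longrightarrow> star (p i) = p i \<and> p i * p i = p i"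
    and sum1: "(\<Sum>i\<in>I. p i) = 1" and ij: "i \<in> I" "j \<in> I" "i \<noteq> j"
  shows "p i * p j = 0"
proof -
  define e where "e = p i"
  have e: "star e = e" "e * e = e" using proj ij by (auto simp: e_def)
  have ne: "norm e \<le> 1" by (rule norm_projection_le_1[OF e])
  \<comment> \<open>Norm form of \<open>0 \<le> e * p k * e \<le> e\<close>: the reflection
    \<open>1 - 2 *\<^sub>R p k\<close> is unitary, and compressing it by \<open>e\<close> does not
    increase its norm.\<close>
  have half: "norm ((1/2) *\<^sub>R e - e * p k * e) \<le> 1/2" if k: "k \<in> I" for k
  proof -
    let ?u = "1 - 2 *\<^sub>R p k"
    have "star ?u * ?u = 1"
      using proj[OF k] by (simp add: star_diff star_add algebra_simps scaleR_2)
    then have "(norm ?u)\<^sup>2 = 1" using cstar_identity[of ?u] by simp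
    then have "norm ?u = 1" using norm_ge_zero[of ?u] by (auto simp: power2_eq_1_iff)
    have "norm (e * ?u * e) \<le> norm e * norm ?u * norm e"
      by (meson norm_mult_ineq order.trans mult_right_mono norm_ge_zero)
    also have "\<dots> \<le> 1" using ne \<open>norm ?u = 1\<close> by (simp add: mult_le_one)
    also have "e * ?u * e = 2 *\<^sub>R ((1/2) *\<^sub>R e - e * p k * e)" using e by (simp add: algebra_simps)
    finally show ?thesis by simp
  qed
  define y where "y = e * p j * e"
  define R where "R = I - {i, j}"
  have Isplit: "I = insert i (insert j R)" "finite R" "i \<notin> insert j R" "j \<notin> R" using ij fin by (auto simp: R_def)
  have "1 = e + (p j + (\<Sum>k\<in>R. p k))"
    using sum1 Isplit(2-4) by (subst (asm) Isplit(1)) (simp add: e_def)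
  then have "e * 1 * e = e * (e + (p j + (\<Sum>k\<in>R. p k))) * e" by simp
  then have yR: "(\<Sum>k\<in>R. e * p k * e) = - y"
    using e by (simp add: y_def algebra_simps sum_distrib_left sum_distrib_right eq_neg_iff_add_eq_0)
  \<comment> \<open>\<open>T\<close> is half the number of indices other than \<open>i\<close>. The
    estimates for \<open>R\<close> bound \<open>T *\<^sub>R e + y\<close>, the one for
    \<open>j\<close> bounds \<open>T *\<^sub>R e - y\<close>, both by \<open>T\<close>, so
    \<open>y\<close> divided by \<open>T\<close> is an admissible perturbation of
    \<open>e\<close>.\<close>
  define T where "T = (real (card R) + 1) / 2"
  have T: "T > 0" by (simp add: T_def)
  have "norm (\<Sum>k\<in>R. (1/2) *\<^sub>R e - e * p k * e) \<le> (\<Sum>k\<in>R. 1/2)"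
    by (rule sum_norm_le) (use half in \<open>auto simp: R_def\<close>)
  then have m: "norm ((real (card R) / 2) *\<^sub>R e + y) \<le> real (card R) / 2"
    by (simp add: sum_subtractf yR sum_constant_scaleR del: sum_constant)
  have "norm (T *\<^sub>R e + y) \<le> norm ((1/2) *\<^sub>R e) + norm ((real (card R) / 2) *\<^sub>R e + y)"
    by (rule order.trans[OF _ norm_triangle_ineq]) (simp add: T_def algebra_simps add_divide_distrib)
  also have "\<dots> \<le> T" using m ne by (simp add: T_def field_simps)
  finally have n1: "norm (T *\<^sub>R e + y) \<le> T" .
  have "norm (T *\<^sub>R e - y) \<le> norm ((real (card R) / 2) *\<^sub>R e) + norm ((1/2) *\<^sub>R e - y)"
    by (rule order.trans[OF _ norm_triangle_ineq]) (simp add: T_def algebra_simps add_divide_distrib)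
  also have "\<dots> \<le> real (card R) / 2 + 1/2"
    using half[OF ij(2)] ne by (intro add_mono) (auto simp: y_def mult_left_le)
  finally have n2: "norm (T *\<^sub>R e - y) \<le> T" by (simp add: T_def field_simps)
  define h where "h = (1 / T) *\<^sub>R y"
  have sy: "star y = y" "e * y = y" "y * e = y"
    using e proj[OF ij(2)] by (simp_all add: y_def star_mult mult.assoc) (simp flip: mult.assoc)
  have "h = 0"
  proof (rule projection_extreme[OF e])
    show "star h = h" "e * h = h" "h * e = h" using sy by (simp_all add: h_def star_scaleR)
    have "e + h = (1 / T) *\<^sub>R (T *\<^sub>R e + y)" "e - h = (1 / T) *\<^sub>R (T *\<^sub>R e - y)"
      using T by (simp_all add: h_def algebra_simps)
    then show "norm (e + h) \<le> 1" "norm (e - h) \<le> 1" using n1 n2 T by simp_all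
  qed
  then have "y = 0" using T by (simp add: h_def)
  then have "star (p j * e) * (p j * e) = 0"
    using proj[OF ij(2)] e by (simp add: y_def star_mult mult.assoc) (simp flip: mult.assoc)
  then have "p j * e = 0" by (simp add: star_mult_self_eq_0_iff)
  then have "star (p j * e) = 0" by simp
  then show ?thesis using proj[OF ij(2)] e by (simp add: star_mult) (simp add: e_def)
qed

subsection \<open>Subalgebras, homomorphisms and linear spans\<close>

lemma
  assumes "cstar_subalgebra B"
  shows cstar_subalgebra_zero: "0 \<in> B"
    and cstar_subalgebra_closed: "closed B"
    and cstar_subalgebra_add: "x \<in> B \<Longrightarrow> y \<in> B \<Longrightarrow> x + y \<in> B"
    and cstar_subalgebra_mult: "x \<in> B \<Longrightarrow> y \<in> B \<Longrightarrow> x * y \<in> B"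
    and cstar_subalgebra_scaleC: "x \<in> B \<Longrightarrow> c *\<^sub>C x \<in> B"
    and cstar_subalgebra_star: "x \<in> B \<Longrightarrow> star x \<in> B"
  using assms by (auto simp: cstar_subalgebra_def)

lemma cstar_subalgebra_scaleR: "cstar_subalgebra B \<Longrightarrow> x \<in> B \<Longrightarrow> r *\<^sub>R x \<in> B"
  using cstar_subalgebra_scaleC[of B x "complex_of_real r"] by (simp add: scaleC_of_real)

lemma cstar_subalgebra_diff:
  "cstar_subalgebra B \<Longrightarrow> x \<in> B \<Longrightarrow> y \<in> B \<Longrightarrow> x - y \<in> B"
  using cstar_subalgebra_add[of B x "- y"] cstar_subalgebra_scaleR[of B y "-1"] by simp

lemma cstar_subalgebra_sum:
  "cstar_subalgebra B \<Longrightarrow> (\<And>i. i \<in> I \<Longrightarrow> f i \<in> B) \<Longrightarrow> (\<Sum>i\<in>I. f i) \<in> B"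
  by (induction I rule: infinite_finite_induct)
    (auto intro: cstar_subalgebra_zero cstar_subalgebra_add)

lemmas cstar_subalgebra_intros = cstar_subalgebra_zero cstar_subalgebra_add cstar_subalgebra_mult
  cstar_subalgebra_scaleC cstar_subalgebra_star cstar_subalgebra_scaleR cstar_subalgebra_diff
  cstar_subalgebra_sum

lemma
  assumes "star_hom_on B \<phi>"
  shows star_hom_add: "x \<in> B \<Longrightarrow> y \<in> B \<Longrightarrow> \<phi> (x + y) = \<phi> x + \<phi> y"
    and star_hom_mult: "x \<in> B \<Longrightarrow> y \<in> B \<Longrightarrow> \<phi> (x * y) = \<phi> x * \<phi> y"
    and star_hom_scaleC: "x \<in> B \<Longrightarrow> \<phi> (c *\<^sub>C x) = c *\<^sub>C \<phi> x"
    and star_hom_star: "x \<in> B \<Longrightarrow> \<phi> (star x) = star (\<phi> x)"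
  using assms by (auto simp: star_hom_on_def)

lemma star_hom_scaleR: "star_hom_on B \<phi> \<Longrightarrow> x \<in> B \<Longrightarrow> \<phi> (r *\<^sub>R x) = r *\<^sub>R \<phi> x"
  using star_hom_scaleC[of B \<phi> x "complex_of_real r"] by (simp add: scaleC_of_real)

lemma star_hom_diff:
  "cstar_subalgebra B \<Longrightarrow> star_hom_on B \<phi> \<Longrightarrow> x \<in> B \<Longrightarrow> y \<in> B \<Longrightarrow> \<phi> (x - y) = \<phi> x - \<phi> y"
  using star_hom_add[of B \<phi> x "- y"] star_hom_scaleR[of B \<phi> y "-1"] cstar_subalgebra_scaleR[of B y "-1"]
  by simp

lemma star_hom_zero: "cstar_subalgebra B \<Longrightarrow> star_hom_on B \<phi> \<Longrightarrow> \<phi> 0 = 0"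
  using star_hom_diff[of B \<phi> 0 0] cstar_subalgebra_zero[of B] by simp

lemma star_hom_sum:
  assumes "cstar_subalgebra B" "star_hom_on B \<phi>" "\<And>i. i \<in> I \<Longrightarrow> f i \<in> B"
  shows "\<phi> (\<Sum>i\<in>I. f i) = (\<Sum>i\<in>I. \<phi> (f i))"
  using assms(3)
proof (induction I rule: infinite_finite_induct)
  case (insert i I)
  then show ?case using star_hom_add[OF assms(2), of "f i" "sum f I"] cstar_subalgebra_sum[OF assms(1), of I f] by simp
qed (simp_all add: star_hom_zero[OF assms(1,2)])

text \<open>For self-adjoint \<open>b\<close> of norm below 1 the root \<open>s\<close> of
  \<open>1 - b * b\<close> lies in \<open>B\<close>, and the images of \<open>b\<close> and
  \<open>s\<close> are commuting self-adjoint elements whose squares add up to the projection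
  \<open>\<phi> 1\<close>. Scaling gives all self-adjoint elements, the C*-identity the
  rest.\<close>

theorem star_hom_contractive:
  assumes B: "cstar_subalgebra B" "1 \<in> B" and \<phi>: "star_hom_on B \<phi>" and a: "a \<in> B"
  shows "norm (\<phi> a) \<le> norm a"
proof -
  have one: "norm (\<phi> 1) \<le> 1"
    using star_hom_star[OF \<phi> B(2)] star_hom_mult[OF \<phi> B(2) B(2)]
    by (intro norm_projection_le_1) auto
  have unit: "norm (\<phi> b) \<le> 1" if b: "b \<in> B" "star b = b" "norm b < 1" for b
  proof -
    have nbb: "norm (b * b) < 1"
      using norm_mult_ineq[of b b] b(3) mult_left_le[of "norm b" "norm b"]
      by (smt (verit) norm_ge_zero mult_left_le)
    have sbb: "star (b * b) = b * b" using b by (simp add: star_mult)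
    obtain s where s: "star s = s" "s * s = 1 - b * b"
        "\<And>y. b * b * y = y * (b * b) \<Longrightarrow> s * y = y * s"
        "\<And>B. cstar_subalgebra B \<Longrightarrow> 1 \<in> B \<Longrightarrow> b * b \<in> B \<Longrightarrow> s \<in> B"
      by (rule selfadjoint_sqrt_one_minus[OF sbb nbb]) (rule that)
    have sB: "s \<in> B" using s(4)[OF B] b B by (simp add: cstar_subalgebra_mult)
    have comm: "s * b = b * s" by (rule s(3)) (simp add: mult.assoc)
    have "(norm (\<phi> b))\<^sup>2 \<le> norm (\<phi> b * \<phi> b + \<phi> s * \<phi> s)"
    proof (rule norm_square_le_sum_squares)
      show "star (\<phi> b) = \<phi> b" "star (\<phi> s) = \<phi> s"
        using star_hom_star[OF \<phi> b(1)] star_hom_star[OF \<phi> sB] b(2) s(1) by simp_all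
      show "\<phi> b * \<phi> s = \<phi> s * \<phi> b"
        using star_hom_mult[OF \<phi> b(1) sB] star_hom_mult[OF \<phi> sB b(1)] comm by simp
    qed
    also have "\<phi> b * \<phi> b + \<phi> s * \<phi> s = \<phi> (b * b + s * s)"
      using b(1) sB B by (simp add: star_hom_mult[OF \<phi>] star_hom_add[OF \<phi>] cstar_subalgebra_mult)
    also have "b * b + s * s = 1" by (simp add: s(2))
    finally have "(norm (\<phi> b))\<^sup>2 \<le> 1" using one by simp
    then show ?thesis by (simp add: power_le_one_iff abs_square_le_1)
  qed
  have sa: "norm (\<phi> b) \<le> norm b" if b: "b \<in> B" "star b = b" for b
  proof (rule dense_ge)
    fix r assume r: "norm b < r"
    then have r0: "r > 0" using norm_ge_zero[of b] by linarith
    have "norm (\<phi> ((1 / r) *\<^sub>R b)) \<le> 1"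
      using r r0 b B by (intro unit) (simp_all add: cstar_subalgebra_scaleR star_scaleR)
    then show "norm (\<phi> b) \<le> r" using r0 b by (simp add: star_hom_scaleR[OF \<phi>] field_simps)
  qed
  have "(norm (\<phi> a))\<^sup>2 = norm (\<phi> (star a * a))"
    using a B by (simp add: star_hom_mult[OF \<phi>] star_hom_star[OF \<phi>] cstar_subalgebra_star cstar_identity)
  also have "\<dots> \<le> norm (star a * a)"
    using a B by (intro sa) (auto intro: cstar_subalgebra_intros simp: star_mult star_star)
  finally show ?thesis unfolding cstar_identity by (rule power2_le_imp_le) simp
qed

section \<open>Generated subalgebras and complex linear spans\<close>

lemma cstar_subalgebra_generated: "cstar_subalgebra (cstar_generated G)"
  unfolding cstar_generated_def
  by (rule hull_in) (auto simp: cstar_subalgebra_def)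

lemma cstar_generated_superset: "G \<subseteq> cstar_generated G"
  unfolding cstar_generated_def by (rule hull_subset)

lemma cstar_generated_minimal: "G \<subseteq> B \<Longrightarrow> cstar_subalgebra B \<Longrightarrow> cstar_generated G \<subseteq> B"
  unfolding cstar_generated_def by (rule hull_minimal)

text \<open>The complex span, written as the real span of all complex multiples so that the facts
  about \<open>span\<close> apply.\<close>

definition cspan :: "'a::unital_cstar_algebra set \<Rightarrow> 'a set" where
  "cspan G = span {c *\<^sub>C g | c g. g \<in> G}"

lemma cspan_base: "g \<in> G \<Longrightarrow> g \<in> cspan G"
  unfolding cspan_def by (rule span_base) (metis (mono_tags, lifting) mem_Collect_eq scaleC_one)

lemma cspan_zero [simp]: "0 \<in> cspan G"
  unfolding cspan_def by (rule span_zero)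

lemma cspan_add: "x \<in> cspan G \<Longrightarrow> y \<in> cspan G \<Longrightarrow> x + y \<in> cspan G"
  unfolding cspan_def by (rule span_add)

lemma cspan_sum: "(\<And>i. i \<in> I \<Longrightarrow> f i \<in> cspan G) \<Longrightarrow> (\<Sum>i\<in>I. f i) \<in> cspan G"
  unfolding cspan_def by (rule span_sum)

lemma cspan_induct [consumes 1, case_names zero add]:
  assumes "x \<in> cspan G" "Q 0" "\<And>c g y. g \<in> G \<Longrightarrow> y \<in> cspan G \<Longrightarrow> Q y \<Longrightarrow> Q (c *\<^sub>C g + y)"
  shows "Q x"
proof -
  have "x \<in> cspan G \<and> Q x"
    using assms(1)[unfolded cspan_def]
  proof (induction rule: span_induct_alt)
    case base
    then show ?case using assms(2) by simp
  next
    case (step r z y)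
    then obtain c g where g: "z = c *\<^sub>C g" "g \<in> G" by blast
    have e: "r *\<^sub>R z = (complex_of_real r * c) *\<^sub>C g"
      by (simp add: g flip: scaleC_of_real scaleC_scaleC)
    have "r *\<^sub>R z \<in> cspan G" unfolding cspan_def using step(1) by (intro span_scale span_base)
    with step g show ?case unfolding e by (auto intro: assms(3) cspan_add)
  qed
  then show ?thesis by simp
qed

lemma cspan_minimal:
  assumes "x \<in> cspan G" "\<And>g. g \<in> G \<Longrightarrow> g \<in> V" "0 \<in> V"
    "\<And>x y. x \<in> V \<Longrightarrow> y \<in> V \<Longrightarrow> x + y \<in> V" "\<And>c x. x \<in> V \<Longrightarrow> c *\<^sub>C x \<in> V"
  shows "x \<in> V"
  using assms(1) by (induction rule: cspan_induct) (auto intro: assms)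

lemma cspan_scaleC: "x \<in> cspan G \<Longrightarrow> c *\<^sub>C x \<in> cspan G"
proof (induction rule: cspan_induct)
  case (add d g y)
  have "(c * d) *\<^sub>C g \<in> cspan G" unfolding cspan_def using add by (intro span_base) blast
  then show ?case using add by (simp add: scaleC_add_right scaleC_scaleC cspan_add)
qed simp

lemma cspan_subset_cspan: "(\<And>g. g \<in> G \<Longrightarrow> g \<in> cspan H) \<Longrightarrow> x \<in> cspan G \<Longrightarrow> x \<in> cspan H"
  by (erule cspan_minimal) (auto intro: cspan_add cspan_scaleC)

lemma cspan_mono: "G \<subseteq> H \<Longrightarrow> cspan G \<subseteq> cspan H"
  using cspan_subset_cspan[of G H] cspan_base by blast

lemma cspan_mult_left:
  assumes "\<And>g. g \<in> G \<Longrightarrow> a * g \<in> cspan H" "x \<in> cspan G"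
  shows "a * x \<in> cspan H"
  using assms(2) by (induction rule: cspan_induct)
    (auto simp: algebra_simps mult_scaleC_right intro: cspan_add cspan_scaleC assms(1))

lemma cspan_mult:
  assumes "\<And>g h. g \<in> G \<Longrightarrow> h \<in> H \<Longrightarrow> g * h \<in> cspan K" "x \<in> cspan G" "y \<in> cspan H"
  shows "x * y \<in> cspan K"
  using assms(2)
proof (induction rule: cspan_induct)
  case (add c g z)
  have "g * y \<in> cspan K" using assms add by (intro cspan_mult_left[OF _ assms(3)])
  then show ?case using add by (simp add: algebra_simps mult_scaleC_left cspan_add cspan_scaleC)
qed simp

lemma cspan_star:
  assumes "\<And>g. g \<in> G \<Longrightarrow> star g \<in> cspan H" "x \<in> cspan G"
  shows "star x \<in> cspan H"
  using assms(2) by (induction rule: cspan_induct)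
    (auto simp: star_add star_scaleC intro: cspan_add cspan_scaleC assms(1))

lemma cstar_subalgebra_closure_cspan:
  assumes mult: "\<And>g h. g \<in> G \<Longrightarrow> h \<in> G \<Longrightarrow> g * h \<in> cspan G"
    and star: "\<And>g. g \<in> G \<Longrightarrow> star g \<in> cspan G"
  shows "cstar_subalgebra (closure (cspan G))"
  unfolding cstar_subalgebra_def
proof (intro conjI ballI allI)
  show "0 \<in> closure (cspan G)" using closure_subset cspan_zero by blast
  fix x c assume "x \<in> closure (cspan G)"
  then obtain f where f: "\<And>n. f n \<in> cspan G" "f \<longlonglongrightarrow> x" unfolding closure_sequential by blast
  show "c *\<^sub>C x \<in> closure (cspan G)" "star x \<in> closure (cspan G)"
    unfolding closure_sequential
    by (rule exI[of _ "\<lambda>n. c *\<^sub>C f n"], simp add: f cspan_scaleC tendsto_scaleC)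
      (rule exI[of _ "\<lambda>n. star (f n)"], simp add: f cspan_star[OF star] tendsto_star)
  fix y assume "y \<in> closure (cspan G)"
  then obtain g where g: "\<And>n. g n \<in> cspan G" "g \<longlonglongrightarrow> y" unfolding closure_sequential by blast
  show "x + y \<in> closure (cspan G)" "x * y \<in> closure (cspan G)"
    unfolding closure_sequential
    by (rule exI[of _ "\<lambda>n. f n + g n"], simp add: f g cspan_add tendsto_add)
      (rule exI[of _ "\<lambda>n. f n * g n"], simp add: f g cspan_mult[OF mult] tendsto_mult)
qed simp

lemma cspan_subset_subalgebra: "cstar_subalgebra B \<Longrightarrow> G \<subseteq> B \<Longrightarrow> cspan G \<subseteq> B"
  using cspan_minimal[of _ G B] by (auto simp: cstar_subalgebra_def) blast

section \<open>The shift space\<close>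

text \<open>Passage to the vocabulary of omega-words: points are handled from here on through
  \<open>prefix\<close>, \<open>suffix\<close>, \<open>##\<close> and
  \<open>\<frown>\<close>.\<close>

lemma shift_funpow: "(shift ^^ k) x = suffix k x"
  by (induction k) (auto simp: shift_def fun_eq_iff)

lemma all_nat_split: "(\<forall>n. Q n) \<longleftrightarrow> Q 0 \<and> (\<forall>n. Q (Suc n))"
  by (metis not0_implies_Suc)

locale ck_matrix =
  fixes A :: "nat^'n::finite^'n"
  assumes zero_one: "zero_one_matrix A" and irreducible: "irreducible_matrix A"
begin

abbreviation "X \<equiv> shift_space A"

definition adm :: "'n list \<Rightarrow> bool" where
  "adm w \<longleftrightarrow> (\<forall>i. Suc i < length w \<longrightarrow> A $ (w ! i) $ (w ! Suc i) = 1)"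

lemma entry: "A $ i $ j = 0 \<or> A $ i $ j = 1"
  using zero_one by (auto simp: zero_one_matrix_def)

text \<open>Irreducibility in the form that is used, reachability in the transition graph, which
  admits induction over \<open>trancl\<close>. A positive entry of a matrix product has a positive
  summand.\<close>

lemma path: "(i, j) \<in> {(i, j). A $ i $ j = 1}\<^sup>+"
proof -
  let ?E = "{(i, j). A $ i $ j = 1}"
  have "(i, j) \<in> ?E\<^sup>+" if "matrix_power A (Suc m) $ i $ j > 0" for m i j
    using that
  proof (induction m arbitrary: i)
    case 0
    then show ?case using entry[of i j] by (auto simp: matrix_mul_rid simp del: One_nat_def)
  next
    case (Suc m)
    have "matrix_power A (Suc (Suc m)) $ i $ j = (\<Sum>k\<in>UNIV. A $ i $ k * matrix_power A (Suc m) $ k $ j)"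
      by (simp add: matrix_matrix_mult_def)
    with Suc(2) obtain k where "A $ i $ k * matrix_power A (Suc m) $ k $ j > 0"
      by (metis (no_types, lifting) gr0I less_irrefl sum.neutral)
    then have "A $ i $ k = 1" "(k, j) \<in> ?E\<^sup>+" using Suc(1)[of k] entry[of i k] by auto
    then show ?case by (auto intro: trancl_into_trancl2)
  qed
  moreover obtain m where "m \<ge> 1" "matrix_power A m $ i $ j > 0"
    using irreducible by (auto simp: irreducible_matrix_def)
  ultimately show ?thesis by (cases m) auto
qed

lemma ex_successor: "\<exists>j. A $ i $ j = 1"
  using path[of i i] by (auto elim: converse_tranclE)

lemma adm_Nil [simp]: "adm []" and adm_single [simp]: "adm [i]"
  by (auto simp: adm_def)

lemma adm_Cons: "adm (i # w) \<longleftrightarrow> w = [] \<or> A $ i $ hd w = 1 \<and> adm w"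
  unfolding adm_def by (subst all_nat_split) (cases w; simp)

lemma suffix_in: "x \<in> X \<Longrightarrow> suffix k x \<in> X"
  by (auto simp: shift_space_def)

lemma Cons_in: "(i ## x) \<in> X \<longleftrightarrow> A $ i $ x 0 = 1 \<and> x \<in> X"
  unfolding shift_space_def mem_Collect_eq by (subst all_nat_split) simp

lemma adm_prefix: "x \<in> X \<Longrightarrow> adm (prefix n x)"
  by (auto simp: adm_def shift_space_def)

lemma conc_in: "x \<in> X \<Longrightarrow> w \<frown> x \<in> X \<longleftrightarrow> adm (w @ [x 0])"
  by (induction w) (auto simp: Cons_in adm_Cons hd_append hd_conv_nth)

lemma adm_append: "adm (u @ v) \<Longrightarrow> adm u \<and> adm v"
  by (induction u) (auto simp: adm_Cons)

lemma ex_point: obtains x where "x \<in> X" "x 0 = i"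
proof
  define nxt where "nxt i = (SOME j. A $ i $ j = 1)" for i
  define x where "x n = (nxt ^^ n) i" for n
  have "A $ i $ nxt i = 1" for i unfolding nxt_def by (rule someI_ex[OF ex_successor])
  then show "x \<in> X" by (simp add: x_def shift_space_def)
  show "x 0 = i" by (simp add: x_def)
qed

text \<open>Every letter has a successor, so a word can be continued from its last letter. The point
  found starts with that letter, hence the detour through \<open>suffix 1 x\<close>.\<close>

lemma adm_extend: assumes "adm w" obtains x where "x \<in> X" "w \<frown> x \<in> X"
proof (cases w rule: rev_cases)
  case Nil
  then show ?thesis using that ex_point by (metis conc_empty)
next
  case (snoc u i)
  obtain x where x: "x \<in> X" "x 0 = i" using ex_point by blast
  have "u \<frown> x \<in> X" using assms x snoc by (simp add: conc_in)
  moreover have "u \<frown> x = w \<frown> suffix 1 x" using x snoc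
    by (metis One_nat_def build_first conc_empty build_cons conc_conc)
  ultimately show ?thesis using that suffix_in[OF x(1)] by metis
qed

lemma admissible_words_eq: "admissible_words A = {w. adm w}"
proof (intro equalityI subsetI)
  fix w assume "w \<in> {w. adm w}"
  then obtain x where "w \<frown> x \<in> X" using adm_extend by blast
  moreover have "w = map (w \<frown> x) [0..<length w]" by (rule nth_equalityI) auto
  ultimately show "w \<in> admissible_words A" unfolding admissible_words_def by blast
next
  fix w assume "w \<in> admissible_words A"
  then obtain x m where "w = map x [0..<m]" "x \<in> X" by (auto simp: admissible_words_def)
  then show "w \<in> {w. adm w}" by (simp add: adm_def shift_space_def)
qed

lemma cylinder_iff: "x \<in> cylinder A w \<longleftrightarrow> x \<in> X \<and> prefix (length w) x = w"
  by (auto simp: cylinder_def intro: nth_equalityI) (metis add_0 minus_nat.diff_0 subsequence_nth)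

lemma prefix_eq_iff: "prefix n x = prefix n y \<longleftrightarrow> (\<forall>i<n. x i = y i)"
  by (auto simp: list_eq_iff_nth_eq)

lemma prefix_eq_mono: "prefix n x = prefix n y \<Longrightarrow> m \<le> n \<Longrightarrow> prefix m x = prefix m y"
  by (auto simp: prefix_eq_iff)

section \<open>Topology of the shift space\<close>

lemma topspace_shift [simp]: "topspace (shift_topology A) = X"
  by (simp add: shift_topology_def)

lemma openin_cylinder: "openin (shift_topology A) {y \<in> X. prefix n y = w}"
proof -
  have "openin (product_topology (\<lambda>_::nat. discrete_topology (UNIV::'n set)) UNIV) {y. y i = a}" for i a
    using openin_continuous_map_preimage[OF continuous_map_product_projection[of i UNIV "\<lambda>_. discrete_topology UNIV"], of "{a}"]
    by simp
  then have "openin (product_topology (\<lambda>_::nat. discrete_topology (UNIV::'n set)) UNIV) ((\<Inter>i<n. {y. y i = w ! i}) \<inter> UNIV)"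
    using openin_topspace[of "product_topology (\<lambda>_::nat. discrete_topology (UNIV::'n set)) UNIV"]
    by (cases "n = 0") (auto intro!: openin_Inter simp: PiE_UNIV_domain)
  moreover have "{y \<in> X. prefix n y = w} = (if length w = n then ((\<Inter>i<n. {y. y i = w ! i}) \<inter> UNIV) \<inter> X else {})"
    by (auto simp: list_eq_iff_nth_eq)
  ultimately show ?thesis by (auto simp: shift_topology_def openin_subtopology)
qed

lemma compact_shift: "compact_space (shift_topology A)"
proof -
  let ?T = "product_topology (\<lambda>_::nat. discrete_topology (UNIV::'n set)) UNIV"
  have "compact_space ?T"
    by (simp add: compact_space_product_topology compact_space_discrete_topology)
  moreover have "closedin ?T X"
  proof -
    have "closedin ?T {x. A $ x n $ x (Suc n) = 1}" for n
    proof -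
      have "closedin ?T {x. x i = a}" for i a
        using closedin_continuous_map_preimage[OF continuous_map_product_projection[of i UNIV "\<lambda>_. discrete_topology UNIV"], of "{a}"]
        by simp
      then have "closedin ?T (\<Union>(a, b)\<in>{(a, b). A $ a $ b = 1}. {x. x n = a} \<inter> {x. x (Suc n) = b})"
        by (intro closedin_Union) (auto intro: closedin_Int)
      moreover have "(\<Union>(a, b)\<in>{(a, b). A $ a $ b = 1}. {x. x n = a} \<inter> {x. x (Suc n) = b}) =
          {x. A $ x n $ x (Suc n) = 1}" by auto
      ultimately show ?thesis by simp
    qed
    then have "closedin ?T (\<Inter>n. {x. A $ x n $ x (Suc n) = 1})" by (intro closedin_Inter) auto
    moreover have "(\<Inter>n. {x. A $ x n $ x (Suc n) = 1}) = X" by (auto simp: shift_space_def)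
    ultimately show ?thesis by simp
  qed
  ultimately show ?thesis unfolding shift_topology_def
    by (meson closedin_compact_space compact_space_subtopology)
qed

text \<open>The form in which compactness enters: the sets of points whose \<open>n\<close>-prefix
  satisfies \<open>Q\<close> are open, increase with \<open>n\<close> and cover
  \<open>X\<close>.\<close>

lemma uniform_prefix:
  assumes ex: "\<And>x. x \<in> X \<Longrightarrow> \<exists>n. Q (prefix n x)"
    and mono: "\<And>x n m. x \<in> X \<Longrightarrow> n \<le> m \<Longrightarrow> Q (prefix n x) \<Longrightarrow> Q (prefix m x)"
  shows "\<exists>n. \<forall>x\<in>X. Q (prefix n x)"
proof -
  define U where "U n = {x \<in> X. Q (prefix n x)}" for n
  have "openin (shift_topology A) (U n)" for n
  proof -
    have "U n = (\<Union>w\<in>{w. Q w}. {y \<in> X. prefix n y = w})" by (auto simp: U_def)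
    then show ?thesis by (auto intro!: openin_Union simp: openin_cylinder)
  qed
  moreover have "X \<subseteq> \<Union> (range U)" using ex by (auto simp: U_def)
  ultimately obtain F where F: "finite F" "F \<subseteq> range U" "X \<subseteq> \<Union> F"
    using compact_shift unfolding compact_space_alt topspace_shift by (metis (no_types, lifting) imageE)
  then obtain I where I: "finite I" "F = U ` I" by (metis finite_subset_image)
  have "Q (prefix (Max (insert 0 I)) x)" if x: "x \<in> X" for x
  proof -
    obtain n where "n \<in> I" "Q (prefix n x)" using F(3) I(2) x by (auto simp: U_def)
    then show ?thesis using mono[OF x, of n] I(1) by simp
  qed
  then show ?thesis by blast
qed

text \<open>Compactness makes the choice of \<open>n\<close> uniform.\<close>

lemma continuous_map_shift_iff:
  "continuous_map (shift_topology A) euclidean (g :: _ \<Rightarrow> 'm::metric_space) \<longleftrightarrow>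
     (\<forall>e>0. \<exists>n. \<forall>x\<in>X. \<forall>y\<in>X. prefix n x = prefix n y \<longrightarrow> dist (g x) (g y) < e)"
proof (intro iffI allI impI)
  fix e :: real assume e: "e > 0" and cont: "continuous_map (shift_topology A) euclidean g"
  define Q where "Q w \<longleftrightarrow> (\<forall>x\<in>X. \<forall>y\<in>X. prefix (length w) x = w \<longrightarrow> prefix (length w) y = w \<longrightarrow> dist (g x) (g y) < e)" for w
  have "\<exists>n. Q (prefix n x)" if x: "x \<in> X" for x
  proof -
    let ?O = "{y \<in> X. g y \<in> ball (g x) (e/2)}"
    have "openin (shift_topology A) ?O"
      using openin_continuous_map_preimage[OF cont, of "ball (g x) (e/2)"] by simp
    then obtain O' where O': "openin (product_topology (\<lambda>_::nat. discrete_topology (UNIV::'n set)) UNIV) O'" "?O = O' \<inter> X"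
      by (auto simp: shift_topology_def openin_subtopology)
    have "x \<in> ?O" using x e by simp
    then have xO: "x \<in> O'" unfolding O'(2) by simp
    obtain V where V: "finite {i. V i \<noteq> UNIV}" "x \<in> Pi\<^sub>E UNIV V" "Pi\<^sub>E UNIV V \<subseteq> O'"
      using product_topology_open_contains_basis[OF O'(1) xO] by auto
    define n where "n = Suc (Max (insert 0 {i. V i \<noteq> UNIV}))"
    have n: "i < n" if "V i \<noteq> UNIV" for i
      unfolding n_def using V(1) that by (simp add: less_Suc_eq_le)
    have near: "y \<in> O'" if "prefix n y = prefix n x" for y
    proof -
      have "y i \<in> V i" for i
        using n[of i] that V(2) by (cases "V i = UNIV") (auto simp: prefix_eq_iff PiE_iff)
      then show ?thesis using V(3) by auto
    qed
    have close: "dist (g x) (g y) < e/2" if y: "prefix n y = prefix n x" "y \<in> X" for y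
    proof -
      have "y \<in> ?O" unfolding O'(2) using y near by simp
      then show ?thesis by simp
    qed
    have "Q (prefix n x)" unfolding Q_def
      by (simp add: dist_triangle_half_r[OF close close])
    then show ?thesis ..
  qed
  then have "\<exists>n. \<forall>x\<in>X. Q (prefix n x)"
  proof (rule uniform_prefix)
    fix x n m assume "x \<in> X" "n \<le> m" "Q (prefix n x)"
    then show "Q (prefix m x)" unfolding Q_def by (simp, meson prefix_eq_mono)
  qed
  then show "\<exists>n. \<forall>x\<in>X. \<forall>y\<in>X. prefix n x = prefix n y \<longrightarrow> dist (g x) (g y) < e"
    unfolding Q_def by (simp, metis)
next
  assume uc: "\<forall>e>0. \<exists>n. \<forall>x\<in>X. \<forall>y\<in>X. prefix n x = prefix n y \<longrightarrow> dist (g x) (g y) < e"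
  have "openin (shift_topology A) {x \<in> X. g x \<in> U}" if U: "open U" for U
  proof (subst openin_subopen, intro ballI)
    fix x assume x: "x \<in> {x \<in> X. g x \<in> U}"
    then have "g x \<in> U" by simp
    with U obtain e where e: "e > 0" "ball (g x) e \<subseteq> U" by (rule openE)
    from uc e(1) obtain n where "\<forall>x\<in>X. \<forall>y\<in>X. prefix n x = prefix n y \<longrightarrow> dist (g x) (g y) < e"
      by blast
    then have n: "dist (g x) (g y) < e" if "y \<in> X" "prefix n y = prefix n x" for y using x that by simp
    show "\<exists>T. openin (shift_topology A) T \<and> x \<in> T \<and> T \<subseteq> {x \<in> X. g x \<in> U}"
    proof (intro exI conjI)
      show "openin (shift_topology A) {y \<in> X. prefix n y = prefix n x}" by (rule openin_cylinder)
      show "x \<in> {y \<in> X. prefix n y = prefix n x}" using x by simp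
      show "{y \<in> X. prefix n y = prefix n x} \<subseteq> {x \<in> X. g x \<in> U}"
        using n e(2) by (auto simp: subset_eq)
    qed
  qed
  then show "continuous_map (shift_topology A) euclidean g"
    by (auto simp: continuous_map_def)
qed

text \<open>Uniform continuity with tolerance 1, since distinct integers are at distance at least
  1.\<close>

lemma continuous_int_locally_constant:
  assumes "f \<in> continuous_int A"
  obtains n where "\<And>x y. x \<in> X \<Longrightarrow> y \<in> X \<Longrightarrow> prefix n x = prefix n y \<Longrightarrow> f x = f y"
proof -
  have "continuous_map (shift_topology A) euclidean (real_of_int \<circ> f)"
    using assms unfolding continuous_int_def mem_Collect_eq
    by (rule continuous_map_compose) simp
  then obtain n where n: "\<forall>x\<in>X. \<forall>y\<in>X. prefix n x = prefix n y \<longrightarrow> dist (real_of_int (f x)) (real_of_int (f y)) < 1"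
    unfolding continuous_map_shift_iff by (force dest: spec[of _ "1::real"])
  show ?thesis
  proof (rule that[of n])
    fix x y assume "x \<in> X" "y \<in> X" "prefix n x = prefix n y"
    then have "dist (real_of_int (f x)) (real_of_int (f y)) < 1" using n by blast
    then show "f x = f y" by (simp add: dist_of_int)
  qed
qed

end

section \<open>Relations in a Cuntz--Krieger family\<close>

locale ck_family = ck_matrix A for A :: "nat^'n::finite^'n" +
  fixes S :: "'n \<Rightarrow> 'a::unital_cstar_algebra"
  assumes family: "cuntz_krieger_family A S"
begin

definition p :: "'n \<Rightarrow> 'a" where "p i = S i * star (S i)"
definition q :: "'n \<Rightarrow> 'a" where "q i = star (S i) * S i"

abbreviation iso :: "'n list \<Rightarrow> 'a" where "iso \<equiv> word_isometry S"

text \<open>The cylinder projection of the overview. It is 0 for inadmissible words, so sums may run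
  over all words of a given length.\<close>

definition rng :: "'n list \<Rightarrow> 'a" where "rng w = iso w * star (iso w)"

lemma S_star_S: "S i * star (S i) * S i = S i"
  using family by (auto simp: cuntz_krieger_family_def partial_isometry_def)

lemma p_S_same: "p i * S i = S i" and S_q: "S i * q i = S i"
  using S_star_S[of i] by (simp_all add: p_def q_def mult.assoc)

lemma p_star [simp]: "star (p i) = p i" and q_star [simp]: "star (q i) = q i"
  by (simp_all add: p_def q_def star_mult star_star)

lemma p_idem [simp]: "p i * p i = p i"
  using S_star_S[of i] by (simp add: p_def flip: mult.assoc)

lemma sum_p: "(\<Sum>i\<in>UNIV. p i) = 1"
  using family by (simp add: cuntz_krieger_family_def p_def)

text \<open>Orthogonality of the ranges is not a defining relation; it follows from the range
  projections summing to 1.\<close>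

lemma p_p: "p i * p j = (if i = j then p i else 0)"
  using orthogonal_projections[of UNIV p i j] sum_p by auto

lemma q_eq: "q i = (\<Sum>j\<in>UNIV. if A $ i $ j = 1 then p j else 0)"
proof -
  have "q i = (\<Sum>j\<in>UNIV. of_nat (A $ i $ j) * p j)"
    using family by (simp add: cuntz_krieger_family_def p_def q_def)
  also have "\<dots> = (\<Sum>j\<in>UNIV. if A $ i $ j = 1 then p j else 0)"
    by (rule sum.cong) (use entry[of i] in \<open>force+\<close>)
  finally show ?thesis .
qed

lemma q_p: "q i * p j = (if A $ i $ j = 1 then p j else 0)"
proof -
  have "q i * p j = (\<Sum>k\<in>UNIV. if k = j then (if A $ i $ j = 1 then p j else 0) else 0)"
    unfolding q_eq sum_distrib_right by (rule sum.cong) (auto simp: p_p)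
  then show ?thesis by simp
qed

lemma p_S: "p i * S j = (if i = j then S j else 0)"
proof -
  have "p i * S j = (p i * p j) * S j" by (simp add: mult.assoc p_S_same)
  then show ?thesis by (simp add: p_p p_S_same)
qed

lemma star_S_S: "star (S i) * S j = (if i = j then q i else 0)"
proof -
  have "star (S i) * S j = star (p i * S i) * S j" by (simp add: p_S)
  also have "\<dots> = star (S i) * (p i * S j)" by (simp add: star_mult mult.assoc)
  finally show ?thesis by (auto simp: p_S q_def)
qed

lemma q_S: "q i * S j = (if A $ i $ j = 1 then S j else 0)"
proof -
  have "q i * S j = (q i * p j) * S j" by (simp add: mult.assoc p_S_same)
  then show ?thesis by (simp add: q_p p_S_same)
qed

lemma p_eq_0_iff: "p i = 0 \<longleftrightarrow> S i = 0"
  using p_S_same[of i] by (auto simp: p_def)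

text \<open>If \<open>p i\<close> vanishes, so do \<open>S i\<close> and \<open>q i\<close>, hence
  \<open>p j\<close> for every successor \<open>j\<close> of \<open>i\<close>. By irreducibility all
  range projections vanish, although they sum to 1.\<close>

lemma p_nonzero: "p i \<noteq> 0"
proof
  assume i: "p i = 0"
  have "p j = 0" for j
    using path[of i j]
  proof (induction rule: trancl_induct)
    case (base j)
    then show ?case using q_p[of i j] i by (auto simp: p_eq_0_iff q_def)
  next
    case (step j k)
    then show ?case using q_p[of j k] by (auto simp: p_eq_0_iff q_def)
  qed
  then show False using sum_p by simp
qed

lemma S_nonzero: "S i \<noteq> 0"
  using p_nonzero p_eq_0_iff by blast

lemma q_nonzero: "q i \<noteq> 0"
  using S_q[of i] S_nonzero by auto

lemma iso_Nil [simp]: "iso [] = 1" and iso_Cons [simp]: "iso (i # w) = S i * iso w"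
  and iso_append: "iso (u @ v) = iso u * iso v"
  by (simp_all add: word_isometry_def)

lemma q_iso: "w \<noteq> [] \<Longrightarrow> q i * iso w = (if A $ i $ hd w = 1 then iso w else 0)"
  by (cases w) (auto simp: q_S mult.assoc[symmetric])

lemma star_iso_iso:
  "star (iso w) * iso w = (if w = [] then 1 else if adm w then q (last w) else 0)"
proof (induction w)
  case (Cons i w)
  have "star (iso (i # w)) * iso (i # w) = star (iso w) * (q i * iso w)"
    by (simp add: star_mult q_def mult.assoc)
  then show ?case using Cons by (cases "w = []") (auto simp: q_iso adm_Cons)
qed simp

lemma iso_eq_0_iff: "iso w = 0 \<longleftrightarrow> \<not> adm w"
  using star_iso_iso[of w] star_mult_self_eq_0_iff[of "iso w"] q_nonzero by (auto split: if_splits)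

lemma iso_star_iso: "iso w * star (iso w) * iso w = iso w"
proof (cases "w = [] \<or> \<not> adm w")
  case False
  then have "iso w * (star (iso w) * iso w) = iso (butlast w @ [last w]) * q (last w)"
    by (simp add: star_iso_iso)
  also have "\<dots> = iso (butlast w @ [last w])" by (simp add: iso_append mult.assoc S_q)
  finally show ?thesis using False by (simp add: mult.assoc)
qed (auto simp: iso_eq_0_iff[symmetric])

lemma rng_Nil [simp]: "rng [] = 1" and rng_single [simp]: "rng [i] = p i"
  by (simp_all add: rng_def p_def)

lemma rng_star [simp]: "star (rng w) = rng w"
  by (simp add: rng_def star_mult star_star)

lemma rng_idem [simp]: "rng w * rng w = rng w"
  using iso_star_iso[of w] by (simp add: rng_def flip: mult.assoc)

lemma rng_eq_0_iff: "rng w = 0 \<longleftrightarrow> \<not> adm w"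
proof -
  have "rng w = 0 \<longleftrightarrow> iso w = 0"
    using star_mult_self_eq_0_iff[of "star (iso w)"] by (simp add: rng_def star_star)
  then show ?thesis by (simp add: iso_eq_0_iff)
qed

lemma norm_rng: "adm w \<Longrightarrow> norm (rng w) = 1"
  by (rule norm_projection) (auto simp: rng_eq_0_iff)

lemma norm_rng_le: "norm (rng w) \<le> 1"
  by (rule norm_projection_le_1) auto

lemma norm_iso_le: "norm (iso w) \<le> 1"
proof -
  have "norm (rng w) = (norm (iso w))\<^sup>2"
    using cstar_identity[of "star (iso w)"] by (simp add: rng_def star_star)
  then show ?thesis using norm_rng_le[of w] by (simp add: power_le_one_iff abs_square_le_1)
qed

lemma star_iso_orth: "length u = length v \<Longrightarrow> u \<noteq> v \<Longrightarrow> star (iso u) * iso v = 0"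
proof (induction u v rule: list_induct2)
  case (Cons i u j v)
  have e: "star (iso (i # u)) * iso (j # v) = star (iso u) * (star (S i) * S j) * iso v"
    by (simp add: star_mult mult.assoc)
  show ?case
  proof (cases "i = j")
    case True
    with Cons have "u \<noteq> v" "v \<noteq> []" by auto
    with Cons True show ?thesis unfolding e star_S_S by (simp add: mult.assoc q_iso)
  next
    case False
    then show ?thesis unfolding e star_S_S by simp
  qed
qed simp

lemma rng_iso_append: "rng u * iso (u @ v) = iso (u @ v)"
  using iso_star_iso[of u] by (simp add: rng_def iso_append flip: mult.assoc)

lemma rng_iso_orth: "length u \<le> length v \<Longrightarrow> take (length u) v \<noteq> u \<Longrightarrow> rng u * iso v = 0"
proof -
  assume a: "length u \<le> length v" "take (length u) v \<noteq> u"
  have "star (iso u) * iso (take (length u) v @ drop (length u) v) =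
      star (iso u) * iso (take (length u) v) * iso (drop (length u) v)"
    by (simp only: iso_append mult.assoc)
  also have "star (iso u) * iso (take (length u) v) = 0"
    using a by (intro star_iso_orth) auto
  finally show ?thesis by (simp add: rng_def mult.assoc)
qed

lemma rng_iso: "length u \<le> length v \<Longrightarrow>
    rng u * iso v = (if take (length u) v = u then iso v else 0)"
proof (cases "take (length u) v = u")
  case True
  then have "v = u @ drop (length u) v" by (metis append_take_drop_id)
  then show ?thesis using rng_iso_append[of u "drop (length u) v"] True by simp
qed (simp add: rng_iso_orth)

lemma rng_rng: "length u \<le> length v \<Longrightarrow>
    rng u * rng v = (if take (length u) v = u then rng v else 0)"
  using rng_iso[of u v] by (simp add: rng_def[of v] mult.assoc[symmetric])

lemma rng_rng': "length u \<le> length v \<Longrightarrow>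
    rng v * rng u = (if take (length u) v = u then rng v else 0)"
proof -
  assume "length u \<le> length v"
  from rng_rng[OF this] have "star (rng u * rng v) = star (if take (length u) v = u then rng v else 0)"
    by simp
  then show ?thesis by (simp add: star_mult split: if_splits)
qed

section \<open>Words of fixed length, and projections along the prefixes of a point\<close>

definition words :: "nat \<Rightarrow> 'n list set" where "words n = {w. length w = n}"

lemma in_words [simp]: "w \<in> words n \<longleftrightarrow> length w = n"
  by (simp add: words_def)

lemma finite_words [simp]: "finite (words n)"
  using finite_lists_length_eq[of "UNIV :: 'n set" n] by (simp add: words_def)

lemma words_0 [simp]: "words 0 = {[]}"
  by (auto simp: words_def)

lemma sum_words_Suc: "(\<Sum>w\<in>words (Suc n). g w) = (\<Sum>i\<in>UNIV. \<Sum>w\<in>words n. g (i # w))"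
proof -
  have "words (Suc n) = (\<lambda>(i, w). i # w) ` (UNIV \<times> words n)"
    by (auto simp: words_def length_Suc_conv image_iff)
  moreover have "inj_on (\<lambda>(i, w). i # w) (UNIV \<times> words n)" by (auto simp: inj_on_def)
  ultimately show ?thesis
    by (simp add: sum.reindex sum.cartesian_product case_prod_unfold comp_def)
qed

lemma rng_Cons: "rng (i # w) = S i * rng w * star (S i)"
  by (simp add: rng_def star_mult mult.assoc)

lemma sum_rng: "(\<Sum>w\<in>words n. rng w) = 1"
proof (induction n)
  case (Suc n)
  have "(\<Sum>w\<in>words (Suc n). rng w) = (\<Sum>i\<in>UNIV. S i * (\<Sum>w\<in>words n. rng w) * star (S i))"
    by (simp add: sum_words_Suc rng_Cons sum_distrib_left sum_distrib_right)
  then show ?case using Suc sum_p by (simp add: p_def)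
qed simp

definition P :: "(nat \<Rightarrow> 'n) \<Rightarrow> nat \<Rightarrow> 'a" where "P x n = rng (prefix n x)"

lemma P_star [simp]: "star (P x n) = P x n" and P_idem [simp]: "P x n * P x n = P x n"
  and P_0 [simp]: "P x 0 = 1" and norm_P_le: "norm (P x n) \<le> 1"
  by (simp_all add: P_def norm_rng_le)

lemma norm_P: "x \<in> X \<Longrightarrow> norm (P x n) = 1"
  by (simp add: P_def norm_rng adm_prefix)

lemma P_P: "P x n * P y m = (if prefix (min n m) x = prefix (min n m) y
    then (if n \<le> m then P y m else P x n) else 0)"
  using rng_rng[of "prefix n x" "prefix m y"] rng_rng'[of "prefix m y" "prefix n x"]
  by (auto simp: P_def min_def)

lemma P_mono: "n \<le> m \<Longrightarrow> P x n * P x m = P x m" "n \<le> m \<Longrightarrow> P x m * P x n = P x m"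
  by (auto simp: P_P min_def)

lemma P_rng: "length w \<le> n \<Longrightarrow> P x n * rng w = (if prefix (length w) x = w then P x n else 0)"
  "length w \<le> n \<Longrightarrow> rng w * P x n = (if prefix (length w) x = w then P x n else 0)"
  using rng_rng[of w "prefix n x"] rng_rng'[of w "prefix n x"] by (auto simp: P_def min_def)

lemma P_iso_other: "length w \<le> n \<Longrightarrow> prefix (length w) x \<noteq> w \<Longrightarrow> P x n * iso w = 0"
proof -
  assume a: "length w \<le> n" "prefix (length w) x \<noteq> w"
  have "P x n * iso w = P x n * rng w * iso w"
    using rng_iso_append[of w "[]"] by (simp add: mult.assoc)
  then show ?thesis using a by (simp add: P_rng)
qed

text \<open>The partial isometry of \<open>w\<close> carries cylinders around \<open>x\<close> to
  cylinders around \<open>w \<frown> x\<close>. The source projection of \<open>w\<close> absorbs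
  the prefix of \<open>x\<close>, because the transition into \<open>x 0\<close> is allowed; for
  \<open>n = 0\<close> there is no prefix and \<open>iso_star_iso\<close> takes over.\<close>

lemma iso_P:
  assumes "w \<frown> x \<in> X"
  shows "iso w * P x n = P (w \<frown> x) (length w + n) * iso w"
proof -
  let ?v = "prefix n x"
  have w: "adm w" using adm_prefix[OF assms, of "length w"] by simp
  have "P (w \<frown> x) (length w + n) * iso w = iso w * (iso ?v * star (iso ?v)) * (star (iso w) * iso w)"
    by (simp add: P_def rng_def iso_append star_mult mult.assoc)
  also have "\<dots> = iso w * (iso ?v * star ((star (iso w) * iso w) * iso ?v))"
    by (simp add: star_mult star_star mult.assoc)
  also have "(star (iso w) * iso w) * iso ?v = (if n = 0 then star (iso w) * iso w else iso ?v)"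
  proof (cases "w = [] \<or> n = 0")
    case False
    have "A $ (w \<frown> x) (length w - 1) $ (w \<frown> x) (Suc (length w - 1)) = 1"
      using assms unfolding shift_space_def by blast
    then have "A $ last w $ hd ?v = 1" using False by (simp add: last_conv_nth hd_conv_nth)
    then show ?thesis using w False by (simp add: star_iso_iso q_iso)
  qed auto
  finally show ?thesis
    using iso_star_iso[of w] by (simp add: P_def rng_def mult.assoc star_mult star_star split: if_splits)
qed

lemma P_iso:
  assumes "w \<frown> x \<in> X" "length w \<le> n"
  shows "P (w \<frown> x) n * iso w = iso w * P x (n - length w)"
  using iso_P[OF assms(1), of "n - length w"] assms(2) by simp

lemma star_iso_P:
  assumes "w \<frown> x \<in> X" "length w \<le> n"
  shows "star (iso w) * P (w \<frown> x) n = P x (n - length w) * star (iso w)"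
  using arg_cong[OF P_iso[OF assms], of star] by (simp add: star_mult)

text \<open>A forbidden transition occurs at the latest between \<open>w\<close> and
  \<open>x 0\<close>, and that one is visible to \<open>P x n\<close> only if
  \<open>n > 0\<close>.\<close>

lemma iso_P_not_in: "x \<in> X \<Longrightarrow> w \<frown> x \<notin> X \<Longrightarrow> n > 0 \<Longrightarrow> iso w * P x n = 0"
proof -
  assume a: "x \<in> X" "w \<frown> x \<notin> X" "n > 0"
  then have "\<not> adm (w @ [x 0])" by (simp add: conc_in)
  moreover have "w @ prefix n x = (w @ [x 0]) @ x [1 \<rightarrow> n]"
    using a(3) by (auto simp: subsequence_def upt_conv_Cons)
  ultimately have "\<not> adm (w @ prefix n x)" using adm_append by metis
  then have "iso (w @ prefix n x) = 0" by (simp add: iso_eq_0_iff)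
  then show ?thesis by (simp add: P_def rng_def iso_append mult.assoc[symmetric])
qed


subsection \<open>The dense linear span of the monomials\<close>

definition mon :: "'n list \<Rightarrow> 'n list \<Rightarrow> 'a" where "mon u v = iso u * star (iso v)"

abbreviation "OA \<equiv> ck_algebra S"
abbreviation "M \<equiv> cspan (range (\<lambda>(u, v). mon u v))"

lemma mon_in_M: "mon u v \<in> M"
  by (rule cspan_base) auto

text \<open>Cancelling all of \<open>u\<close> leaves the source projection \<open>q i\<close>,
  which is not a monomial; the Cuntz-Krieger relation rewrites it as a sum of the monomials
  \<open>p k\<close>.\<close>

lemma star_S_mon: "star (S i) * mon u v \<in> M"
proof (cases u)
  case Nil
  then have "star (S i) * mon u v = mon [] (v @ [i])"
    by (simp add: mon_def iso_append star_mult)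
  then show ?thesis by (simp add: mon_in_M)
next
  case (Cons j u')
  then have e: "star (S i) * mon u v = (star (S i) * S j) * iso u' * star (iso v)"
    by (simp add: mon_def mult.assoc)
  show ?thesis
  proof (cases "i = j \<and> u' = []")
    case True
    then have "star (S i) * mon u v = (\<Sum>k\<in>UNIV. if A $ i $ k = 1 then p k else 0) * star (iso v)"
      unfolding e star_S_S by (simp add: q_eq)
    also have "\<dots> = (\<Sum>k\<in>UNIV. if A $ i $ k = 1 then mon [k] (v @ [k]) else 0)"
      unfolding sum_distrib_right
      by (rule sum.cong) (auto simp: mon_def p_def iso_append star_mult mult.assoc)
    also have "\<dots> \<in> M" by (rule cspan_sum) (auto simp: mon_in_M)
    finally show ?thesis .
  next
    case False
    then have "star (S i) * mon u v = mon u' v \<or> star (S i) * mon u v = 0"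
      unfolding e star_S_S by (auto simp: mon_def q_iso)
    then show ?thesis using mon_in_M by auto
  qed
qed

lemma mon_mult_M: "x \<in> M \<Longrightarrow> mon u v * x \<in> M"
proof -
  assume x: "x \<in> M"
  have "star (iso v) * x \<in> M" if "x \<in> M" for x
    using that
  proof (induction v arbitrary: x)
    case (Cons i v)
    have "star (S i) * x \<in> M"
      by (rule cspan_mult_left[OF _ Cons(2)]) (auto simp: star_S_mon)
    then have "star (iso v) * (star (S i) * x) \<in> M" by (rule Cons(1))
    then show ?case by (simp add: star_mult mult.assoc)
  qed simp
  moreover have "iso u * x \<in> M" if "x \<in> M" for x
    using that
  proof (induction u)
    case (Cons i u)
    have "S i * (iso u * x) \<in> M"
    proof (rule cspan_mult_left[OF _ Cons(1)[OF Cons(2)]])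
      fix g assume "g \<in> range (\<lambda>(u, v). mon u v)"
      then obtain a b where "g = mon a b" by auto
      then have "S i * g = mon (i # a) b" by (simp add: mon_def mult.assoc)
      then show "S i * g \<in> M" by (simp add: mon_in_M)
    qed
    then show ?case by (simp add: mult.assoc)
  qed simp
  ultimately show ?thesis using x by (simp add: mon_def mult.assoc)
qed

lemma star_mon: "star (mon u v) = mon v u"
  by (simp add: mon_def star_mult star_star)

lemma iso_in_M: "iso w \<in> M" and one_in_M: "1 \<in> M"
  using mon_in_M[of w "[]"] mon_in_M[of "[]" "[]"] by (simp_all add: mon_def)

lemma subalgebra_OA: "cstar_subalgebra OA"
  unfolding ck_algebra_def by (rule cstar_subalgebra_generated)

lemma OA_eq: "OA = closure M"
proof
  have "cstar_subalgebra (closure M)"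
    by (rule cstar_subalgebra_closure_cspan) (auto simp: star_mon mon_in_M mon_mult_M)
  moreover have "range S \<subseteq> closure M"
    using iso_in_M[of "[i]" for i] closure_subset[of M] by auto
  ultimately show "OA \<subseteq> closure M" unfolding ck_algebra_def by (rule cstar_generated_minimal[rotated])
next
  have S: "S i \<in> OA" for i unfolding ck_algebra_def using cstar_generated_superset[of "range S"] by auto
  \<comment> \<open>A C*-subalgebra need not contain 1; this one does, since 1 is the sum of the
    \<open>p i\<close>.\<close>
  have "(\<Sum>i\<in>UNIV. p i) \<in> OA" unfolding p_def
    by (intro cstar_subalgebra_intros[OF subalgebra_OA] S)
  then have 1: "1 \<in> OA" by (simp add: sum_p)
  have "iso w \<in> OA" for w
    by (induction w) (auto intro: 1 S cstar_subalgebra_intros[OF subalgebra_OA])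
  then have "range (\<lambda>(u, v). mon u v) \<subseteq> OA"
    by (auto simp: mon_def intro: cstar_subalgebra_intros[OF subalgebra_OA])
  then have "M \<subseteq> OA" by (rule cspan_subset_subalgebra[OF subalgebra_OA])
  then show "closure M \<subseteq> OA"
    using cstar_subalgebra_closed[OF subalgebra_OA] by (rule closure_minimal)
qed

lemma M_OA: "x \<in> M \<Longrightarrow> x \<in> OA"
  using closure_subset[of M] by (auto simp: OA_eq)

lemma S_OA: "S i \<in> OA" and iso_OA: "iso w \<in> OA" and one_OA: "1 \<in> OA"
  using iso_in_M[of "[i]"] iso_in_M[of w] one_in_M by (auto intro: M_OA)

lemmas OA_intros = cstar_subalgebra_intros[OF subalgebra_OA] S_OA iso_OA one_OA

lemma rng_OA: "rng w \<in> OA" and P_OA: "P x n \<in> OA"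
  by (auto simp: P_def rng_def intro: OA_intros)

lemma approx_M:
  assumes "a \<in> OA" "e > 0"
  obtains b where "b \<in> M" "norm (a - b) < e"
  using assms by (auto simp: OA_eq closure_approachable dist_norm norm_minus_commute)


subsection \<open>The diagonal subalgebra\<close>

text \<open>Locally constant functions of level \<open>n\<close> inside the diagonal: the algebra
  operations act pointwise on the coefficients, and coefficients at inadmissible words do not
  count.\<close>

definition comb :: "nat \<Rightarrow> ('n list \<Rightarrow> complex) \<Rightarrow> 'a" where
  "comb n c = (\<Sum>w\<in>words n. c w *\<^sub>C rng w)"

lemma comb_add: "comb n c + comb n d = comb n (\<lambda>w. c w + d w)"
  by (simp add: comb_def scaleC_add_left sum.distrib)

lemma comb_diff: "comb n c - comb n d = comb n (\<lambda>w. c w - d w)"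
  by (simp add: comb_def scaleC_diff_left sum_subtractf)

lemma comb_scaleC: "a *\<^sub>C comb n c = comb n (\<lambda>w. a * c w)"
  by (simp add: comb_def scaleC_sum_right scaleC_scaleC)

lemma comb_star: "star (comb n c) = comb n (\<lambda>w. cnj (c w))"
  by (simp add: comb_def star_sum star_scaleC)

lemma comb_cong: "(\<And>w. w \<in> words n \<Longrightarrow> adm w \<Longrightarrow> c w = d w) \<Longrightarrow> comb n c = comb n d"
  unfolding comb_def by (rule sum.cong) (metis rng_eq_0_iff scaleC_zero_right)+

lemma comb_rng: "n \<le> length v \<Longrightarrow> comb n c * rng v = c (take n v) *\<^sub>C rng v"
  "n \<le> length v \<Longrightarrow> rng v * comb n c = c (take n v) *\<^sub>C rng v"
proof -
  assume a: "n \<le> length v"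
  have "comb n c * rng v = (\<Sum>w\<in>words n. if w = take n v then c w *\<^sub>C rng v else 0)"
    unfolding comb_def sum_distrib_right
    by (rule sum.cong) (auto simp: in_words mult_scaleC_left rng_rng a)
  then show "comb n c * rng v = c (take n v) *\<^sub>C rng v" using a by (simp add: in_words)
  have "rng v * comb n c = (\<Sum>w\<in>words n. if w = take n v then c w *\<^sub>C rng v else 0)"
    unfolding comb_def sum_distrib_left
    by (rule sum.cong) (auto simp: in_words mult_scaleC_right rng_rng' a)
  then show "rng v * comb n c = c (take n v) *\<^sub>C rng v" using a by (simp add: in_words)
qed

lemma comb_mult: "comb n c * comb n d = comb n (\<lambda>w. c w * d w)"
proof -
  have "comb n c * comb n d = (\<Sum>w\<in>words n. comb n c * (d w *\<^sub>C rng w))"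
    by (simp add: comb_def[of n d] sum_distrib_left)
  also have "\<dots> = comb n (\<lambda>w. c w * d w)" unfolding comb_def[of n "\<lambda>w. c w * d w"]
    by (rule sum.cong) (auto simp: in_words mult_scaleC_right comb_rng scaleC_scaleC mult.commute)
  finally show ?thesis .
qed

lemma comb_1: "comb n (\<lambda>_. 1) = 1"
  by (simp add: comb_def sum_rng)

lemma comb_refine: "n \<le> m \<Longrightarrow> comb n c = comb m (\<lambda>w. c (take n w))"
proof -
  assume "n \<le> m"
  have "comb n c = (\<Sum>w\<in>words m. comb n c * rng w)"
    by (simp add: sum_distrib_left[symmetric] sum_rng)
  also have "\<dots> = comb m (\<lambda>w. c (take n w))"
    unfolding comb_def[of m] using \<open>n \<le> m\<close> by (intro sum.cong) (auto simp: in_words comb_rng)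
  finally show ?thesis .
qed

lemma comb_P: "n \<le> m \<Longrightarrow> comb n c * P x m = c (prefix n x) *\<^sub>C P x m"
  "n \<le> m \<Longrightarrow> P x m * comb n c = c (prefix n x) *\<^sub>C P x m"
  by (simp_all add: P_def comb_rng min_def)

lemma comb_P_norm: "x \<in> X \<Longrightarrow> norm (c (prefix n x)) \<le> norm (comb n c)"
  using norm_mult_ineq[of "comb n c" "P x n"] by (simp add: comb_P norm_scaleC norm_P)

text \<open>The triangle inequality loses the factor \<open>card (words n)\<close>. It loses the
  same factor on every power of the combination of the squared moduli, so
  \<open>norm_le_if_power_bound\<close> removes the loss.\<close>

lemma comb_norm_le:
  assumes "\<And>w. w \<in> words n \<Longrightarrow> adm w \<Longrightarrow> norm (c w) \<le> K" "0 \<le> K"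
  shows "norm (comb n c) \<le> K"
proof -
  define d where "d w = (cmod (c w))\<^sup>2" for w
  let ?h = "comb n (\<lambda>w. of_real (d w))"
  have pow: "?h ^ m = comb n (\<lambda>w. of_real (d w ^ m))" for m
    by (induction m) (simp_all add: comb_1 comb_mult)
  have "norm ?h \<le> K\<^sup>2"
  proof (rule norm_le_if_power_bound)
    show "star ?h = ?h" by (simp add: comb_star)
    fix m
    have "norm (comb n (\<lambda>w. of_real (d w ^ m))) \<le> (\<Sum>w\<in>words n. (K\<^sup>2) ^ m)"
      unfolding comb_def
    proof (rule sum_norm_le)
      fix w assume w: "w \<in> words n"
      show "norm (complex_of_real (d w ^ m) *\<^sub>C rng w) \<le> (K\<^sup>2) ^ m"
      proof (cases "adm w")
        case True
        have "d w ^ m \<le> (K\<^sup>2) ^ m"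
          unfolding d_def using assms(1)[OF w True] by (intro power_mono) auto
        then show ?thesis using norm_rng[OF True] by (simp add: norm_scaleC d_def norm_power)
      next
        case False
        then have "rng w = 0" by (simp add: rng_eq_0_iff)
        then show ?thesis by simp
      qed
    qed
    then show "norm (?h ^ m) \<le> (0 * real m + real (card (words n))) * (K\<^sup>2) ^ m"
      by (simp add: pow)
  qed simp
  moreover have "(norm (comb n c))\<^sup>2 = norm ?h"
    unfolding cstar_identity[symmetric] comb_star comb_mult d_def complex_norm_square
    by (simp add: mult.commute)
  ultimately have "(norm (comb n c))\<^sup>2 \<le> K\<^sup>2" by simp
  then show ?thesis using assms(2) by (rule power2_le_imp_le)
qed

section \<open>Construction of the isomorphism from the continuous functions onto the
  diagonal\<close>

abbreviation "CC \<equiv> continuous_complex A"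

lemma CC_iff: "g \<in> CC \<longleftrightarrow>
    (\<forall>e>0. \<exists>n. \<forall>x\<in>X. \<forall>y\<in>X. prefix n x = prefix n y \<longrightarrow> dist (g x) (g y) < e)"
  unfolding continuous_complex_def mem_Collect_eq by (rule continuous_map_shift_iff)

lemma locally_constant_CC:
  "(\<And>x y. x \<in> X \<Longrightarrow> y \<in> X \<Longrightarrow> prefix n x = prefix n y \<Longrightarrow> g x = g y) \<Longrightarrow> g \<in> CC"
  unfolding CC_iff by (metis dist_self)

definition pt :: "'n list \<Rightarrow> (nat \<Rightarrow> 'n)" where
  "pt w = (SOME x. x \<in> X \<and> prefix (length w) x = w)"

lemma pt: assumes "adm w" shows "pt w \<in> X" "prefix (length w) (pt w) = w"
proof -
  obtain x where "w \<frown> x \<in> X" using adm_extend[OF assms] by blast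
  then have "\<exists>x. x \<in> X \<and> prefix (length w) x = w" by (metis prefix_conc_length)
  from someI_ex[OF this] show "pt w \<in> X" "prefix (length w) (pt w) = w" by (auto simp: pt_def)
qed

text \<open>Step approximation of \<open>g\<close> at level \<open>n\<close>, whose value on each
  cylinder is read off at the chosen point \<open>pt w\<close>.\<close>

definition sample :: "nat \<Rightarrow> ((nat \<Rightarrow> 'n) \<Rightarrow> complex) \<Rightarrow> 'a" where
  "sample n g = comb n (\<lambda>w. g (pt w))"

lemma sample_locally_constant:
  assumes g: "\<And>x. x \<in> X \<Longrightarrow> g x = c (prefix n x)" and nm: "n \<le> m"
  shows "sample m g = comb n c"
  unfolding sample_def comb_refine[OF nm]
proof (rule comb_cong)
  fix w assume w: "w \<in> words m" "adm w"
  have "prefix n (pt w) = take n (prefix (length w) (pt w))"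
    using w nm by (simp add: in_words min_def)
  then show "g (pt w) = c (take n w)" using pt[OF w(2)] g by simp
qed

lemma sample_close:
  assumes close: "\<And>x. x \<in> X \<Longrightarrow> dist (g x) (c (prefix n x)) \<le> e" and nm: "n \<le> m" and e: "0 \<le> e"
  shows "norm (sample m g - comb n c) \<le> e"
  unfolding sample_def comb_refine[OF nm] comb_diff
proof (rule comb_norm_le)
  fix w assume w: "w \<in> words m" "adm w"
  have "prefix n (pt w) = take n (prefix (length w) (pt w))"
    using w nm by (simp add: in_words min_def)
  then show "norm (g (pt w) - c (take n w)) \<le> e"
    using pt[OF w(2)] close[of "pt w"] by (simp add: dist_norm)
qed (rule e)

lemma sample_convergent: "g \<in> CC \<Longrightarrow> convergent (\<lambda>n. sample n g)"
proof -
  assume g: "g \<in> CC"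
  have "Cauchy (\<lambda>n. sample n g)"
  proof (rule CauchyI)
    fix e :: real assume e: "0 < e"
    then obtain n where n: "\<forall>x\<in>X. \<forall>y\<in>X. prefix n x = prefix n y \<longrightarrow> dist (g x) (g y) < e/3"
      using g unfolding CC_iff by (metis divide_pos_pos zero_less_numeral)
    have close: "norm (sample m g - comb n (\<lambda>w. g (pt w))) \<le> e/3" if "n \<le> m" for m
    proof (rule sample_close[OF _ that])
      fix x assume x: "x \<in> X"
      have "prefix n (pt (prefix n x)) = prefix n x" "pt (prefix n x) \<in> X"
        using pt[OF adm_prefix[OF x, of n]] by simp_all
      with n x show "dist (g x) (g (pt (prefix n x))) \<le> e/3" by (simp add: less_imp_le)
    qed (use e in simp)
    show "\<exists>N. \<forall>m\<ge>N. \<forall>k\<ge>N. norm (sample m g - sample k g) < e"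
    proof (intro exI[of _ n] allI impI)
      fix m k assume "n \<le> m" "n \<le> k"
      then have "norm ((sample m g - comb n (\<lambda>w. g (pt w))) - (sample k g - comb n (\<lambda>w. g (pt w)))) \<le> e/3 + e/3"
        using norm_triangle_ineq4 order.trans add_mono close by meson
      then show "norm (sample m g - sample k g) < e" using e by simp
    qed
  qed
  then show ?thesis by (simp add: Cauchy_convergent_iff)
qed

definition \<Phi>\<^sub>0 :: "((nat \<Rightarrow> 'n) \<Rightarrow> complex) \<Rightarrow> 'a" where "\<Phi>\<^sub>0 g = lim (\<lambda>n. sample n g)"

lemma sample_tendsto: "g \<in> CC \<Longrightarrow> (\<lambda>n. sample n g) \<longlonglongrightarrow> \<Phi>\<^sub>0 g"
  unfolding \<Phi>\<^sub>0_def using sample_convergent by (simp add: convergent_LIMSEQ_iff)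

lemma \<Phi>\<^sub>0_eqI: "(\<lambda>n. sample n g) \<longlonglongrightarrow> a \<Longrightarrow> \<Phi>\<^sub>0 g = a"
  unfolding \<Phi>\<^sub>0_def by (rule limI)

lemma \<Phi>\<^sub>0_indicator: "adm \<mu> \<Longrightarrow> \<Phi>\<^sub>0 (indicator (cylinder A \<mu>)) = rng \<mu>"
proof (rule \<Phi>\<^sub>0_eqI, rule tendsto_eventually, rule eventually_sequentiallyI)
  fix m assume m: "length \<mu> \<le> m"
  have "sample m (indicator (cylinder A \<mu>)) = comb (length \<mu>) (\<lambda>w. if w = \<mu> then 1 else 0)"
    by (rule sample_locally_constant[OF _ m]) (auto simp: indicator_def cylinder_iff)
  also have "\<dots> = (\<Sum>w\<in>words (length \<mu>). if w = \<mu> then rng w else 0)"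
    unfolding comb_def by (rule sum.cong) auto
  also have "\<dots> = rng \<mu>" by (simp add: in_words)
  finally show "sample m (indicator (cylinder A \<mu>)) = rng \<mu>" .
qed

lemma \<Phi>\<^sub>0_eq_iff:
  assumes g: "g \<in> CC" and h: "h \<in> CC"
  shows "\<Phi>\<^sub>0 g = \<Phi>\<^sub>0 h \<longleftrightarrow> (\<forall>x\<in>X. g x = h x)"
proof
  assume eq: "\<forall>x\<in>X. g x = h x"
  have "sample n g = sample n h" for n
    unfolding sample_def by (rule comb_cong) (use eq pt in auto)
  then show "\<Phi>\<^sub>0 g = \<Phi>\<^sub>0 h" by (simp add: \<Phi>\<^sub>0_def)
next
  assume eq: "\<Phi>\<^sub>0 g = \<Phi>\<^sub>0 h"
  have lim: "(\<lambda>n. g (pt (prefix n x))) \<longlonglongrightarrow> g x" if x: "x \<in> X" and g: "g \<in> CC" for x g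
  proof (rule metric_LIMSEQ_I)
    fix e :: real assume "0 < e"
    then obtain n where n: "\<forall>x\<in>X. \<forall>y\<in>X. prefix n x = prefix n y \<longrightarrow> dist (g x) (g y) < e"
      using g unfolding CC_iff by metis
    have "dist (g (pt (prefix m x))) (g x) < e" if m: "n \<le> m" for m
    proof -
      have "prefix m (pt (prefix m x)) = prefix m x" "pt (prefix m x) \<in> X"
        using pt[OF adm_prefix[OF x, of m]] by simp_all
      with n x m show ?thesis using prefix_eq_mono[of "pt (prefix m x)" m x n] by simp
    qed
    then show "\<exists>N. \<forall>m\<ge>N. dist (g (pt (prefix m x))) (g x) < e" by blast
  qed
  have lim0: "(\<lambda>n. norm (sample n g - sample n h)) \<longlonglongrightarrow> 0"
    using tendsto_norm[OF tendsto_diff[OF sample_tendsto[OF g] sample_tendsto[OF h]]] eq by simp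
  show "\<forall>x\<in>X. g x = h x"
  proof
    fix x assume x: "x \<in> X"
    \<comment> \<open>Compression by \<open>P x n\<close> isolates the coefficient at the prefix of
      \<open>x\<close>, so norms dominate pointwise differences. This gives injectivity.\<close>
    have "(\<lambda>n. g (pt (prefix n x)) - h (pt (prefix n x))) \<longlonglongrightarrow> 0"
    proof (rule Lim_null_comparison[OF _ lim0], rule always_eventually, rule allI)
      fix n
      show "norm (g (pt (prefix n x)) - h (pt (prefix n x))) \<le> norm (sample n g - sample n h)"
        unfolding sample_def comb_diff
        using comb_P_norm[OF x, of "\<lambda>w. g (pt w) - h (pt w)" n] by simp
    qed
    with tendsto_diff[OF lim[OF x g] lim[OF x h]] have "g x - h x = 0"
      by (rule LIMSEQ_unique)
    then show "g x = h x" by simp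
  qed
qed

lemma cspan_rng_eq_comb:
  assumes "d \<in> cspan (rng ` {w. adm w})"
  shows "\<exists>n c. d = comb n c"
  using assms
proof (induction rule: cspan_induct)
  case zero
  have "(0::'a) = comb 0 (\<lambda>_. 0)" by (simp add: comb_def)
  then show ?case by blast
next
  case (add a g y)
  then obtain w n c where w: "g = rng w" "y = comb n c" by auto
  let ?l = "length w" let ?m = "max n ?l"
  have "g = comb ?l (\<lambda>v. if v = w then 1 else 0)"
  proof -
    have "comb ?l (\<lambda>v. if v = w then 1 else 0) = (\<Sum>v\<in>words ?l. if v = w then rng v else 0)"
      unfolding comb_def by (rule sum.cong) auto
    then show ?thesis by (simp add: in_words w)
  qed
  then have "a *\<^sub>C g + y = comb ?m (\<lambda>v. a * (if take ?l v = w then 1 else 0) + c (take n v))"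
    by (simp add: w(2) comb_refine[of ?l ?m] comb_refine[of n ?m] comb_scaleC comb_add)
  then show ?case by blast
qed

lemma diagonal_algebra_eq: "diagonal_algebra A S = closure (cspan (rng ` {w. adm w}))"
proof -
  have e: "diagonal_algebra A S = cstar_generated (rng ` {w. adm w})"
    unfolding diagonal_algebra_def admissible_words_eq rng_def ..
  have "cstar_subalgebra (closure (cspan (rng ` {w. adm w})))"
  proof (rule cstar_subalgebra_closure_cspan)
    fix g h assume "g \<in> rng ` {w. adm w}" "h \<in> rng ` {w. adm w}"
    then obtain u v where uv: "g = rng u" "h = rng v" "adm u" "adm v" by auto
    then have "g * h \<in> {rng u, rng v, 0}"
      using rng_rng[of u v] rng_rng'[of v u] by (cases "length u \<le> length v") auto
    then show "g * h \<in> cspan (rng ` {w. adm w})" using uv by (auto intro: cspan_base)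
  qed (auto intro: cspan_base)
  then have "diagonal_algebra A S \<subseteq> closure (cspan (rng ` {w. adm w}))" unfolding e
    by (intro cstar_generated_minimal order.trans[OF _ closure_subset]) (auto intro: cspan_base)
  moreover have "closure (cspan (rng ` {w. adm w})) \<subseteq> diagonal_algebra A S" unfolding e
    by (intro closure_minimal cspan_subset_subalgebra cstar_subalgebra_generated
        cstar_generated_superset cstar_subalgebra_closed)
  ultimately show ?thesis by simp
qed

lemma range_\<Phi>\<^sub>0: "\<Phi>\<^sub>0 ` CC = diagonal_algebra A S"
proof
  have "sample n g \<in> diagonal_algebra A S" for n g
  proof -
    have "c *\<^sub>C rng w \<in> cspan (rng ` {w. adm w})" for c w
    proof (cases "adm w")
      case True
      then show ?thesis by (intro cspan_scaleC cspan_base) simp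
    next
      case False
      then have "rng w = 0" by (simp add: rng_eq_0_iff)
      then show ?thesis by simp
    qed
    then have "sample n g \<in> cspan (rng ` {w. adm w})"
      unfolding sample_def comb_def by (intro cspan_sum)
    then show ?thesis unfolding diagonal_algebra_eq using closure_subset by blast
  qed
  then show "\<Phi>\<^sub>0 ` CC \<subseteq> diagonal_algebra A S"
    using closed_sequentially[OF closed_closure _ sample_tendsto] unfolding diagonal_algebra_eq
    by (metis image_subsetI)
next
  show "diagonal_algebra A S \<subseteq> \<Phi>\<^sub>0 ` CC"
  proof
    fix d assume "d \<in> diagonal_algebra A S"
    then obtain f where f: "\<And>k. f k \<in> cspan (rng ` {w. adm w})" and fd: "f \<longlonglongrightarrow> d"
      unfolding diagonal_algebra_eq closure_sequential by blast
    from f cspan_rng_eq_comb have "\<forall>k. \<exists>n c. f k = comb n c" by blast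
    then obtain N C where NC: "\<And>k. f k = comb (N k) (C k)" by metis
    \<comment> \<open>\<open>G k\<close> is the step function whose coefficients give
      \<open>f k\<close>. Coefficients along points of \<open>X\<close> are bounded by norms, so
      norm convergence of \<open>f\<close> makes \<open>G\<close> converge uniformly on
      \<open>X\<close>, and the limit function is the preimage of \<open>d\<close>.\<close>
    define G where "G k x = C k (prefix (N k) x)" for k x
    have dist_G: "norm (G k x - G l x) \<le> norm (f k - f l)" if x: "x \<in> X" for k l x
    proof -
      let ?m = "max (N k) (N l)"
      have "f k - f l = comb ?m (\<lambda>w. C k (take (N k) w) - C l (take (N l) w))"
        by (simp add: NC comb_refine[of "N k" ?m] comb_refine[of "N l" ?m] comb_diff)
      then show ?thesis
        using comb_P_norm[OF x, of "\<lambda>w. C k (take (N k) w) - C l (take (N l) w)" ?m]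
        by (simp add: G_def min_def)
    qed
    define g where "g x = lim (\<lambda>k. G k x)" for x
    have Glim: "(\<lambda>k. G k x) \<longlonglongrightarrow> g x" if x: "x \<in> X" for x
    proof -
      have "Cauchy (\<lambda>k. G k x)"
      proof (rule CauchyI)
        fix e :: real assume "0 < e"
        then obtain K where "\<forall>m\<ge>K. \<forall>n\<ge>K. norm (f m - f n) < e"
          using CauchyD[OF LIMSEQ_imp_Cauchy[OF fd]] by blast
        then show "\<exists>K. \<forall>m\<ge>K. \<forall>n\<ge>K. norm (G m x - G n x) < e"
          using dist_G[OF x] by (meson le_less_trans)
      qed
      then show ?thesis unfolding g_def by (simp add: Cauchy_convergent_iff convergent_LIMSEQ_iff)
    qed
    have gG: "dist (g x) (G k x) \<le> norm (d - f k)" if x: "x \<in> X" for x k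
    proof (rule LIMSEQ_le)
      show "(\<lambda>l. dist (G l x) (G k x)) \<longlonglongrightarrow> dist (g x) (G k x)" by (intro tendsto_intros Glim x)
      show "(\<lambda>l. norm (f l - f k)) \<longlonglongrightarrow> norm (d - f k)" by (intro tendsto_intros fd)
    qed (use dist_G[OF x] in \<open>auto simp: dist_norm\<close>)
    have small: "\<exists>k. norm (d - f k) < e" if "e > 0" for e
      using LIMSEQ_D[OF fd that] by (metis norm_minus_commute order_refl)
    have gCC: "g \<in> CC"
      unfolding CC_iff
    proof (intro allI impI)
      fix e :: real assume "e > 0"
      then obtain k where k: "norm (d - f k) < e/2" using small[of "e/2"] by auto
      have "dist (g x) (g y) < e" if "x \<in> X" "y \<in> X" "prefix (N k) x = prefix (N k) y" for x y
      proof -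
        have "G k x = G k y" by (simp add: G_def that(3))
        then have "dist (g x) (G k x) < e/2" "dist (g y) (G k x) < e/2"
          using gG[OF that(1), of k] gG[OF that(2), of k] k by simp_all
        then show ?thesis by (rule dist_triangle_half_l)
      qed
      then show "\<exists>n. \<forall>x\<in>X. \<forall>y\<in>X. prefix n x = prefix n y \<longrightarrow> dist (g x) (g y) < e" by blast
    qed
    have le: "norm (\<Phi>\<^sub>0 g - f k) \<le> norm (d - f k)" for k
    proof (rule LIMSEQ_le_const2)
      show "(\<lambda>m. norm (sample m g - f k)) \<longlonglongrightarrow> norm (\<Phi>\<^sub>0 g - f k)"
        by (intro tendsto_intros sample_tendsto gCC)
      show "\<exists>K. \<forall>m\<ge>K. norm (sample m g - f k) \<le> norm (d - f k)"
        unfolding NC[of k] using sample_close[of g "C k" "N k" "norm (d - f k)"] gG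
        by (auto simp: G_def NC)
    qed
    have "(\<lambda>k. norm (d - f k)) \<longlonglongrightarrow> norm (d - d)" by (intro tendsto_intros fd)
    then have lim0: "(\<lambda>k. norm (d - f k)) \<longlonglongrightarrow> 0" by simp
    have "(\<lambda>k. \<Phi>\<^sub>0 g - f k) \<longlonglongrightarrow> 0"
      by (rule Lim_null_comparison[OF always_eventually lim0]) (use le in blast)
    moreover have "(\<lambda>k. \<Phi>\<^sub>0 g - f k) \<longlonglongrightarrow> \<Phi>\<^sub>0 g - d" by (intro tendsto_intros fd)
    ultimately have "\<Phi>\<^sub>0 g - d = 0" using LIMSEQ_unique by blast
    then show "d \<in> \<Phi>\<^sub>0 ` CC" using gCC by (metis eq_iff_diff_eq_0 image_eqI)
  qed
qed

text \<open>Existence gives meaning to the choice in \<open>diagonal_isomorphism\<close>. Afterwards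
  only the specified properties of the chosen map are used.\<close>

lemma ex_diagonal_isomorphism: "is_diagonal_isomorphism A S \<Phi>\<^sub>0"
  unfolding is_diagonal_isomorphism_def
proof (intro conjI ballI allI)
  fix g h assume gh: "g \<in> CC" "h \<in> CC"
  note lim = sample_tendsto[OF gh(1)] sample_tendsto[OF gh(2)]
  show "\<Phi>\<^sub>0 (\<lambda>x. g x + h x) = \<Phi>\<^sub>0 g + \<Phi>\<^sub>0 h"
    using tendsto_add[OF lim] by (intro \<Phi>\<^sub>0_eqI) (simp add: sample_def comb_add)
  show "\<Phi>\<^sub>0 (\<lambda>x. g x * h x) = \<Phi>\<^sub>0 g * \<Phi>\<^sub>0 h"
    using tendsto_mult[OF lim] by (intro \<Phi>\<^sub>0_eqI) (simp add: sample_def comb_mult)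
  show "\<Phi>\<^sub>0 g = \<Phi>\<^sub>0 h \<longleftrightarrow> (\<forall>x\<in>X. g x = h x)" by (rule \<Phi>\<^sub>0_eq_iff[OF gh])
next
  fix c g assume g: "g \<in> CC"
  show "\<Phi>\<^sub>0 (\<lambda>x. c * g x) = c *\<^sub>C \<Phi>\<^sub>0 g"
    using tendsto_scaleC[OF sample_tendsto[OF g], of c]
    by (intro \<Phi>\<^sub>0_eqI) (simp add: sample_def comb_scaleC)
next
  fix g assume g: "g \<in> CC"
  show "\<Phi>\<^sub>0 (\<lambda>x. cnj (g x)) = star (\<Phi>\<^sub>0 g)"
    using tendsto_star[OF sample_tendsto[OF g]]
    by (intro \<Phi>\<^sub>0_eqI) (simp add: sample_def comb_star)
next
  fix \<mu> assume "\<mu> \<in> admissible_words A"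
  then show "\<Phi>\<^sub>0 (indicator (cylinder A \<mu>)) = iso \<mu> * star (iso \<mu>)"
    using \<Phi>\<^sub>0_indicator[of \<mu>] by (simp add: admissible_words_eq rng_def)
qed (rule range_\<Phi>\<^sub>0)

abbreviation "\<Phi> \<equiv> diagonal_isomorphism A S"

lemma is_diagonal_isomorphism: "is_diagonal_isomorphism A S \<Phi>"
  unfolding diagonal_isomorphism_def by (rule someI[of _ \<Phi>\<^sub>0]) (rule ex_diagonal_isomorphism)

lemma \<Phi>_locally_constant:
  assumes g: "\<And>x. x \<in> X \<Longrightarrow> g x = c (prefix n x)"
  shows "\<Phi> g = comb n c"
proof -
  note iso = is_diagonal_isomorphism[unfolded is_diagonal_isomorphism_def]
  have add: "\<Phi> (\<lambda>x. g x + h x) = \<Phi> g + \<Phi> h" if "g \<in> CC" "h \<in> CC" for g h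
    using iso[THEN conjunct1] that by blast
  have scale: "\<Phi> (\<lambda>x. c * g x) = c *\<^sub>C \<Phi> g" if "g \<in> CC" for c g
    using iso[THEN conjunct2, THEN conjunct1] that by blast
  have eq: "\<Phi> g = \<Phi> h" if "g \<in> CC" "h \<in> CC" "\<forall>x\<in>X. g x = h x" for g h
    using iso[THEN conjunct2, THEN conjunct2, THEN conjunct2, THEN conjunct2, THEN conjunct2] that by blast
  let ?i = "\<lambda>w x. indicator (cylinder A w) x :: complex"
  have iCC: "(\<lambda>x. a * ?i w x) \<in> CC" for a w
    by (rule locally_constant_CC[of "length w"]) (simp add: indicator_def cylinder_iff)
  have ind: "\<Phi> (?i w) = rng w" for w
  proof (cases "adm w")
    case True
    then show ?thesis
      using iso[THEN conjunct2, THEN conjunct2, THEN conjunct2, THEN conjunct1]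
      by (simp add: admissible_words_eq rng_def)
  next
    \<comment> \<open>The specification gives images of indicators for admissible words only. For
      the others the indicator vanishes on \<open>X\<close>, and functions equal on \<open>X\<close>
      have equal images.\<close>
    case False
    then have "?i w x = 0" for x using adm_prefix[of x "length w"] by (auto simp: indicator_def cylinder_iff)
    then have "\<Phi> (?i w) = \<Phi> (\<lambda>x. 0 * ?i w x)" using iCC[of 1 w] iCC[of 0 w] by (intro eq) simp_all
    also have "\<dots> = 0" using scale[of "?i w" 0] iCC[of 1 w] by simp
    finally show ?thesis using False by (simp add: rng_eq_0_iff)
  qed
  have sumCC: "(\<lambda>x. \<Sum>w\<in>W. c w * ?i w x) \<in> CC" if "W \<subseteq> words n" for W
    by (rule locally_constant_CC[of n], rule sum.cong)
      (use that in \<open>auto simp: indicator_def cylinder_iff in_words\<close>)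
  have "\<Phi> (\<lambda>x. \<Sum>w\<in>W. c w * ?i w x) = (\<Sum>w\<in>W. c w *\<^sub>C rng w)" if "W \<subseteq> words n" for W
    using finite_subset[OF that finite_words] that
  proof (induction W rule: finite_induct)
    case empty
    show ?case using scale[of "\<lambda>x. 0" 0] locally_constant_CC[of 0 "\<lambda>x. 0"] by simp
  next
    case (insert w W)
    have "\<Phi> (\<lambda>x. c w * ?i w x + (\<Sum>w\<in>W. c w * ?i w x)) =
        \<Phi> (\<lambda>x. c w * ?i w x) + \<Phi> (\<lambda>x. \<Sum>w\<in>W. c w * ?i w x)"
      using insert by (intro add iCC sumCC) simp
    moreover have "\<Phi> (\<lambda>x. c w * ?i w x) = c w *\<^sub>C rng w"
      using scale[of "?i w" "c w"] iCC[of 1 w] by (simp add: ind)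
    moreover have "\<Phi> (\<lambda>x. \<Sum>w\<in>W. c w * ?i w x) = (\<Sum>w\<in>W. c w *\<^sub>C rng w)"
      using insert by simp
    ultimately show ?case unfolding sum.insert[OF insert(1,2)] by simp
  qed
  from this[of "words n"] have "\<Phi> (\<lambda>x. \<Sum>w\<in>words n. c w * ?i w x) = comb n c"
    by (simp add: comb_def)
  moreover have "\<Phi> g = \<Phi> (\<lambda>x. \<Sum>w\<in>words n. c w * ?i w x)"
  proof (rule eq[OF locally_constant_CC[of n] sumCC])
    show "\<forall>x\<in>X. g x = (\<Sum>w\<in>words n. c w * ?i w x)"
    proof
      fix x assume x: "x \<in> X"
      have "(\<Sum>w\<in>words n. c w * ?i w x) = (\<Sum>w\<in>words n. if w = prefix n x then c w else 0)"
        using x by (intro sum.cong) (auto simp: indicator_def cylinder_iff in_words)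
      then show "g x = (\<Sum>w\<in>words n. c w * ?i w x)" using x by (simp add: g in_words)
    qed
  qed (simp_all add: g)
  ultimately show ?thesis by simp
qed

end

section \<open>Gauge actions\<close>

definition character :: "real \<Rightarrow> int \<Rightarrow> complex" where
  "character t k = exp (2 * pi * \<i> * of_real t * of_int k)"

lemma character_add: "character (s + t) k = character s k * character t k"
  by (simp add: character_def exp_add[symmetric] algebra_simps)

lemma character_add_int: "character t (k + l) = character t k * character t l"
  by (simp add: character_def exp_add[symmetric] algebra_simps)

lemma character_0 [simp]: "character 0 k = 1" "character t 0 = 1"
  by (simp_all add: character_def)

lemma character_1 [simp]: "character 1 k = 1"
  using exp_integer_2pi[of "of_int k"] by (simp add: character_def mult_ac)

lemma character_eq_cis: "character t k = cis (2 * pi * t * of_int k)"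
  by (simp add: character_def cis_conv_exp mult_ac)

lemma norm_character [simp]: "cmod (character t k) = 1"
  by (simp add: character_eq_cis)

lemma character_cnj: "cnj (character t k) = character t (- k)"
  by (simp add: character_eq_cis cis_cnj)

lemma character_mult_cnj: "character t k * cnj (character t k) = 1" "cnj (character t k) * character t k = 1"
  using character_add_int[of t k "- k"] by (simp_all add: character_cnj mult.commute)

lemma continuous_character: "continuous_on UNIV (\<lambda>t. character t k)"
  unfolding character_def by (intro continuous_intros)

text \<open>A geometric sum over powers of an \<open>N\<close>-th root of unity, which differs from
  1 because \<open>N\<close> does not divide \<open>k\<close>.\<close>

lemma sum_character_eq_0:
  assumes "0 < \<bar>k\<bar>" "\<bar>k\<bar> < int N"
  shows "(\<Sum>j<N. character (real j / real N) k) = 0"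
proof -
  define z where "z = character (1 / real N) k"
  have N: "N > 0" using assms by auto
  have pw: "character (real j / real N) k = z ^ j" for j
    by (induction j) (simp_all add: z_def add_divide_distrib character_add)
  have "z ^ N = 1" using pw[of N] N by simp
  moreover have "z \<noteq> 1"
  proof
    assume "z = 1"
    then obtain m :: int where "2 * pi * \<i> * of_real (1 / real N) * of_int k = of_int (2 * m) * pi * \<i>"
      unfolding z_def character_def exp_eq_1 by (auto simp: complex_eq_iff)
    then have "pi * (2 * (real_of_int k / real N)) = pi * (2 * real_of_int m)"
      by (simp add: complex_eq_iff algebra_simps)
    then have "2 * (real_of_int k / real N) = 2 * real_of_int m" by (simp only: mult_cancel_left pi_neq_zero simp_thms)
    then have "real_of_int k / real N = real_of_int m" by simp
    then have "real_of_int k = real_of_int (m * int N)" using N by (simp add: field_simps)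
    then have "k = m * int N" by (simp only: of_int_eq_iff)
    then show False using assms zdvd_imp_le[of "int N" "\<bar>k\<bar>"] by auto
  qed
  moreover have "(1 - z) * (\<Sum>j<N. z ^ j) = 1 - z ^ N" by (rule one_diff_power_eq[symmetric])
  ultimately show ?thesis by (simp add: pw)
qed

section \<open>Universality and homomorphisms determined on the generators\<close>

locale universal_ck = ck_matrix A for A :: "nat^'n::finite^'n" +
  fixes S :: "'n \<Rightarrow> 'a::unital_cstar_algebra"
  assumes universal: "universal_cuntz_krieger_family A S"

sublocale universal_ck \<subseteq> ck_family
  using universal by unfold_locales (simp add: universal_cuntz_krieger_family_def)

text \<open>The elements of \<open>OA\<close> satisfying \<open>Q\<close> form a C*-subalgebra
  containing the generators.\<close>

lemma (in ck_family) OA_induct [consumes 1, case_names S zero add mult scaleC star limit]: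
  assumes "a \<in> OA"
    and "\<And>i. Q (S i)" and "Q 0"
    and "\<And>x y. x \<in> OA \<Longrightarrow> y \<in> OA \<Longrightarrow> Q x \<Longrightarrow> Q y \<Longrightarrow> Q (x + y)"
    and "\<And>x y. x \<in> OA \<Longrightarrow> y \<in> OA \<Longrightarrow> Q x \<Longrightarrow> Q y \<Longrightarrow> Q (x * y)"
    and "\<And>c x. x \<in> OA \<Longrightarrow> Q x \<Longrightarrow> Q (c *\<^sub>C x)"
    and "\<And>x. x \<in> OA \<Longrightarrow> Q x \<Longrightarrow> Q (star x)"
    and lim: "\<And>g x. (\<And>n. g n \<in> OA) \<Longrightarrow> (\<And>n. Q (g n)) \<Longrightarrow> g \<longlonglongrightarrow> x \<Longrightarrow> x \<in> OA \<Longrightarrow> Q x"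
  shows "Q a"
proof -
  have "cstar_subalgebra {x \<in> OA. Q x}"
    unfolding cstar_subalgebra_def
  proof (intro conjI)
    show "closed {x \<in> OA. Q x}"
      unfolding closed_sequential_limits
    proof (intro allI impI, elim conjE)
      fix g x assume g: "\<forall>n. g n \<in> {x \<in> OA. Q x}" and gx: "g \<longlonglongrightarrow> x"
      have "x \<in> OA"
        by (rule closed_sequentially[OF cstar_subalgebra_closed[OF subalgebra_OA] _ gx]) (use g in blast)
      then show "x \<in> {x \<in> OA. Q x}" using lim[of g x] g gx by simp
    qed
  qed (use assms(3-7) in \<open>simp_all add: OA_intros\<close>)
  moreover have "range S \<subseteq> {x \<in> OA. Q x}" using assms(2) S_OA by blast
  ultimately have "cstar_generated (range S) \<subseteq> {x \<in> OA. Q x}" by (rule cstar_generated_minimal[rotated])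
  then show ?thesis using assms(1) unfolding ck_algebra_def[of S] by blast
qed

context ck_family
begin

lemma hom_contractive: "star_hom_on OA \<phi> \<Longrightarrow> a \<in> OA \<Longrightarrow> norm (\<phi> a) \<le> norm a"
  by (rule star_hom_contractive[OF subalgebra_OA one_OA])

lemma hom_lipschitz:
  "star_hom_on OA \<phi> \<Longrightarrow> a \<in> OA \<Longrightarrow> b \<in> OA \<Longrightarrow> norm (\<phi> a - \<phi> b) \<le> norm (a - b)"
  using hom_contractive[of \<phi> "a - b"] by (simp add: star_hom_diff[OF subalgebra_OA] OA_intros)

lemma hom_tendsto:
  assumes "star_hom_on OA \<phi>" "\<And>n. g n \<in> OA" "g \<longlonglongrightarrow> x" "x \<in> OA"
  shows "(\<lambda>n. \<phi> (g n)) \<longlonglongrightarrow> \<phi> x"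
proof (rule metric_LIMSEQ_I)
  fix e :: real assume "0 < e"
  then obtain N where "\<forall>n\<ge>N. dist (g n) x < e" using metric_LIMSEQ_D[OF assms(3)] by blast
  then show "\<exists>N. \<forall>n\<ge>N. dist (\<phi> (g n)) (\<phi> x) < e"
    using hom_lipschitz[OF assms(1,2,4)] by (metis dist_norm le_less_trans)
qed

lemma hom_eqI:
  assumes \<phi>: "star_hom_on OA \<phi>" and \<psi>: "star_hom_on OA \<psi>" and eq: "\<And>i. \<phi> (S i) = \<psi> (S i)"
    and a: "a \<in> OA"
  shows "\<phi> a = \<psi> a"
  using a
proof (induction rule: OA_induct)
  case zero
  then show ?case using star_hom_zero[OF subalgebra_OA] \<phi> \<psi> by metis
next
  case (limit g x)
  have "(\<lambda>n. \<phi> (g n)) \<longlonglongrightarrow> \<psi> x" using hom_tendsto[OF \<psi> limit(1,2,3)] limit(4) by simp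
  with hom_tendsto[OF \<phi> limit(1,2,3)] show ?case by (rule LIMSEQ_unique)
qed (simp_all add: eq star_hom_add[OF \<phi>] star_hom_add[OF \<psi>] star_hom_mult[OF \<phi>] star_hom_mult[OF \<psi>]
    star_hom_scaleC[OF \<phi>] star_hom_scaleC[OF \<psi>] star_hom_star[OF \<phi>] star_hom_star[OF \<psi>])

lemma hom_range:
  assumes \<phi>: "star_hom_on OA \<phi>" and S: "\<And>i. \<phi> (S i) \<in> OA" and a: "a \<in> OA"
  shows "\<phi> a \<in> OA"
  using a
proof (induction rule: OA_induct)
  case zero
  then show ?case using star_hom_zero[OF subalgebra_OA \<phi>] by (simp add: OA_intros)
next
  case (limit g x)
  then show ?case
    using closed_sequentially[OF cstar_subalgebra_closed[OF subalgebra_OA] _ hom_tendsto[OF \<phi> limit(1,2,3)]]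
    by blast
qed (simp_all add: S star_hom_add[OF \<phi>] star_hom_mult[OF \<phi>]
    star_hom_scaleC[OF \<phi>] star_hom_star[OF \<phi>] OA_intros)

lemma comb_OA: "comb n c \<in> OA"
  unfolding comb_def by (intro OA_intros rng_OA)

lemma comb_commute: "comb n c * comb m d = comb m d * comb n c"
  by (simp add: comb_refine[of n "max n m"] comb_refine[of m "max n m"] comb_mult mult.commute)

lemma rng_eq_comb: "rng w = comb (length w) (\<lambda>v. if v = w then 1 else 0)"
proof -
  have "comb (length w) (\<lambda>v. if v = w then 1 else 0) = (\<Sum>v\<in>words (length w). if v = w then rng v else 0)"
    unfolding comb_def by (rule sum.cong) auto
  then show ?thesis by simp
qed

lemma comb_rng_commute: "comb n c * rng w = rng w * comb n c"
  unfolding rng_eq_comb by (rule comb_commute)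

end

lemma birkhoff_sum_Suc: "birkhoff_sum f (Suc k) (i ## y) = f (i ## y) + birkhoff_sum f k y"
proof -
  have "shift (suffix j (i ## y)) = suffix j y" for j by (simp add: shift_def fun_eq_iff)
  then show ?thesis unfolding birkhoff_sum_def sum.lessThan_Suc_shift by (simp add: shift_funpow)
qed

locale gauge = universal_ck A S for A :: "nat^'n::finite^'n" and S :: "'n \<Rightarrow> 'a::unital_cstar_algebra" +
  fixes f :: "(nat \<Rightarrow> 'n) \<Rightarrow> int" and n0 :: nat
  assumes level: "\<And>x y. x \<in> X \<Longrightarrow> y \<in> X \<Longrightarrow> prefix n0 x = prefix n0 y \<Longrightarrow> f x = f y"
begin

text \<open>The diagonal unitary \<open>exp (2 pi i t f)\<close>, explicit as a finite combination
  because \<open>f\<close> depends on \<open>n0\<close> letters only.\<close>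

definition U :: "real \<Rightarrow> 'a" where "U t = comb n0 (\<lambda>w. character t (f (pt w)))"

lemma f_pt: "x \<in> X \<Longrightarrow> f (pt (prefix n0 x)) = f x"
  using pt[OF adm_prefix[of x n0]] by (intro level) auto

lemma \<Phi>_U: "\<Phi> (\<lambda>x. exp (2 * pi * \<i> * of_real t * of_int (f x))) = U t"
  unfolding U_def by (rule \<Phi>_locally_constant) (simp add: character_def f_pt)

lemma U_U: "U s * U t = U (s + t)"
  by (simp add: U_def comb_mult character_add)

lemma U_0 [simp]: "U 0 = 1" and U_1 [simp]: "U 1 = 1"
  by (simp_all add: U_def comb_1)

lemma star_U: "star (U t) * U t = 1" "U t * star (U t) = 1"
  by (simp_all add: U_def comb_star comb_mult character_mult_cnj comb_1)

lemma U_OA: "U t \<in> OA"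
  unfolding U_def by (rule comb_OA)

lemma U_rng: "U t * rng w = rng w * U t"
  unfolding U_def by (rule comb_rng_commute)

lemma U_rng_U: "U t * rng w * star (U t) = rng w"
proof -
  have "U t * rng w * star (U t) = rng w * (U t * star (U t))" by (simp add: U_rng mult.assoc)
  then show ?thesis by (simp add: star_U)
qed

lemma U_P: "x \<in> X \<Longrightarrow> n0 \<le> m \<Longrightarrow> U t * P x m = character t (f x) *\<^sub>C P x m"
  unfolding U_def by (simp add: comb_P f_pt)

text \<open>\<open>U t\<close> is unitary, so the source projections are unchanged, and it commutes
  with every \<open>rng w\<close>, so the range projections are unchanged as well.\<close>

lemma cuntz_krieger_family_twisted: "cuntz_krieger_family A (\<lambda>i. U t * S i)"
proof -
  have pp: "U t * S i * star (U t * S i) = p i" for i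
    using U_rng_U[of t "[i]"] by (simp add: star_mult p_def mult.assoc)
  have "star (U t * S i) * (U t * S i) = star (S i) * (star (U t) * U t) * S i" for i
    by (simp only: star_mult mult.assoc)
  then have qq: "star (U t * S i) * (U t * S i) = q i" for i by (simp add: star_U q_def)
  have "p i * (U t * S i) = U t * S i" for i
  proof -
    have "p i * (U t * S i) = U t * (p i * S i)"
      using U_rng[of t "[i]"] by (simp add: mult.assoc[symmetric])
    then show ?thesis by (simp add: p_S)
  qed
  with family show ?thesis
    unfolding cuntz_krieger_family_def partial_isometry_def pp qq
    by (simp add: p_def q_def)
qed

lemma ex_hom: "\<exists>\<phi>. star_hom_on OA \<phi> \<and> (\<forall>i. \<phi> (S i) = U t * S i)"
  using universal cuntz_krieger_family_twisted unfolding universal_cuntz_krieger_family_def by blast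

context
  fixes \<phi> t
  assumes \<phi>: "star_hom_on OA \<phi>" and \<phi>S: "\<And>i. \<phi> (S i) = U t * S i"
begin

lemma hom_one: "\<phi> 1 = 1"
proof -
  have "\<phi> (\<Sum>i\<in>UNIV. p i) = (\<Sum>i\<in>UNIV. U t * rng [i] * star (U t))"
    by (simp add: star_hom_sum[OF subalgebra_OA \<phi>] p_def OA_intros star_hom_mult[OF \<phi>]
        star_hom_star[OF \<phi>] \<phi>S star_mult mult.assoc)
  then show ?thesis unfolding U_rng_U by (simp add: sum_p)
qed

text \<open>Conjugation by \<open>U t\<close> fixes the cylinder projections. As a consequence the
  homomorphism fixes each \<open>U s\<close>, on which the group law of the action rests.\<close>

lemma hom_rng: "\<phi> (rng w) = rng w"
proof (induction w)
  case (Cons i w)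
  have "\<phi> (rng (i # w)) = U t * (S i * rng w * star (S i)) * star (U t)"
    by (simp add: rng_Cons star_hom_mult[OF \<phi>] star_hom_star[OF \<phi>] OA_intros rng_OA Cons \<phi>S star_mult mult.assoc)
  then show ?case using U_rng_U[of t "i # w"] by (simp add: rng_Cons)
qed (simp add: hom_one)

lemma hom_comb: "\<phi> (comb n c) = comb n c"
  by (simp add: comb_def star_hom_sum[OF subalgebra_OA \<phi>] OA_intros rng_OA
      star_hom_scaleC[OF \<phi>] hom_rng)

text \<open>This is where Birkhoff sums come from: each letter contributes the value of
  \<open>f\<close> at the point starting with it, and the phases multiply. For
  \<open>n0 \<le> m\<close> the projection is fine enough to make every \<open>U t\<close> met on
  the way a scalar.\<close>

lemma hom_iso:
  assumes "w \<frown> x \<in> X" "n0 \<le> m"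
  shows "\<phi> (iso w) * P x m = character t (birkhoff_sum f (length w) (w \<frown> x)) *\<^sub>C (iso w * P x m)"
  using assms(1)
proof (induction w)
  case Nil
  then show ?case by (simp add: hom_one birkhoff_sum_def)
next
  case (Cons i w)
  let ?y = "i ## (w \<frown> x)"
  have y: "?y \<in> X" "w \<frown> x \<in> X" using Cons(2) by (simp_all add: Cons_in)
  let ?b = "birkhoff_sum f (length w) (w \<frown> x)"
  have "\<phi> (iso (i # w)) * P x m = U t * S i * (\<phi> (iso w) * P x m)"
    by (simp add: star_hom_mult[OF \<phi>] OA_intros \<phi>S mult.assoc)
  also have "\<dots> = character t ?b *\<^sub>C (U t * (iso (i # w) * P x m))"
    unfolding Cons(1)[OF y(2)] by (simp add: mult_scaleC_right mult.assoc)
  also have "iso (i # w) * P x m = P ?y (Suc (length w) + m) * iso (i # w)"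
    using iso_P[OF Cons(2), of m] by simp
  also have "U t * (P ?y (Suc (length w) + m) * iso (i # w)) =
      character t (f ?y) *\<^sub>C (P ?y (Suc (length w) + m) * iso (i # w))"
    using U_P[OF y(1), of "Suc (length w) + m" t] assms(2) by (simp add: mult.assoc[symmetric] mult_scaleC_left)
  also have "P ?y (Suc (length w) + m) * iso (i # w) = iso (i # w) * P x m"
    using iso_P[OF Cons(2), of m] by simp
  finally show ?case
    by (simp add: scaleC_scaleC birkhoff_sum_Suc character_add_int mult.commute)
qed

lemma hom_OA: "a \<in> OA \<Longrightarrow> \<phi> a \<in> OA"
  by (rule hom_range[OF \<phi>]) (simp_all add: \<phi>S OA_intros U_OA)

end

text \<open>Universality provides a homomorphism for each \<open>t\<close> separately; they fit
  together because homomorphisms agreeing on the generators are equal. Existence gives meaning to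
  the choice in \<open>gauge_action\<close>.\<close>

lemma ex_gauge_action: "\<exists>\<rho>. is_gauge_action A S f \<rho>"
proof -
  obtain \<rho> where hom: "\<And>t. star_hom_on OA (\<rho> t)" and S: "\<And>t i. \<rho> t (S i) = U t * S i"
    using ex_hom by metis
  note OA = hom_OA[OF hom S]
  have comp: "star_hom_on OA (\<lambda>a. \<rho> s (\<rho> t a))" for s t
    using OA by (simp add: star_hom_on_def star_hom_add[OF hom] star_hom_mult[OF hom]
        star_hom_scaleC[OF hom] star_hom_star[OF hom])
  have add: "\<rho> (s + t) a = \<rho> s (\<rho> t a)" if "a \<in> OA" for s t a
  proof (rule hom_eqI[OF hom comp _ that])
    fix i
    have "\<rho> s (U t) = U t" unfolding U_def by (rule hom_comb[OF hom S])
    then show "\<rho> (s + t) (S i) = \<rho> s (\<rho> t (S i))"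
      using U_U[of t s] by (simp add: S star_hom_mult[OF hom] OA_intros U_OA mult.assoc[symmetric] add.commute)
  qed
  have id: "star_hom_on OA (\<lambda>a. a)" by (simp add: star_hom_on_def)
  have zero: "\<rho> 0 a = a" and one: "\<rho> 1 a = a" if "a \<in> OA" for a
    by (rule hom_eqI[OF hom id _ that], simp add: S)+
  have bij: "bij_betw (\<rho> t) OA OA" for t
    by (rule bij_betw_byWitness[of _ "\<rho> (- t)"])
      (use OA add[of _ t "- t"] add[of _ "- t" t] zero in auto)
  have cont: "continuous_on UNIV (\<lambda>t. \<rho> t a)" if "a \<in> OA" for a
    using that
  proof (induction rule: OA_induct)
    case (S i)
    show ?case unfolding \<open>\<And>t i. \<rho> t (S i) = U t * S i\<close> U_def comb_def
      by (intro continuous_intros continuous_on_scaleC_left continuous_character)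
  next
    case zero
    then show ?case by (simp add: star_hom_zero[OF subalgebra_OA hom])
  next
    case (scaleC c x)
    then show ?case
      by (simp add: star_hom_scaleC[OF hom] bounded_linear.continuous_on[OF bounded_linear_scaleC])
  next
    case (star x)
    then show ?case
      by (simp add: star_hom_star[OF hom] bounded_linear.continuous_on[OF bounded_linear_star])
  next
    case (limit g x)
    show ?case
    \<comment> \<open>All \<open>\<rho> t\<close> are contractive, so convergence of
      \<open>g\<close> to \<open>x\<close> carries over to the orbits uniformly in
      \<open>t\<close>.\<close>
    proof (rule uniform_limit_theorem[where f="\<lambda>n t. \<rho> t (g n)" and F=sequentially])
      show "uniform_limit UNIV (\<lambda>n t. \<rho> t (g n)) (\<lambda>t. \<rho> t x) sequentially"
      proof (rule uniform_limitI)
        fix e :: real assume "0 < e"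
        with limit(2) have "\<forall>\<^sub>F n in sequentially. dist (g n) x < e" by (rule tendstoD)
        then show "\<forall>\<^sub>F n in sequentially. \<forall>t\<in>UNIV. dist (\<rho> t (g n)) (\<rho> t x) < e"
          by (rule eventually_mono)
            (use hom_lipschitz[OF hom limit(1) limit(3)] in \<open>auto simp: dist_norm intro: le_less_trans\<close>)
      qed
    qed (use limit(4) in auto)
  qed (simp_all add: star_hom_add[OF hom] star_hom_mult[OF hom] continuous_intros)
  have "is_gauge_action A S f \<rho>"
    unfolding is_gauge_action_def circle_action_on_def star_automorphism_on_def \<Phi>_U
    by (simp add: hom bij zero one cont add S)
  then show ?thesis by blast
qed

abbreviation "\<rho> \<equiv> gauge_action A S f"

lemma is_gauge_action: "is_gauge_action A S f \<rho>"
  unfolding gauge_action_def by (rule someI_ex[OF ex_gauge_action])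

lemma hom_\<rho>: "star_hom_on OA (\<rho> t)" and \<rho>_S: "\<rho> t (S i) = U t * S i"
  and \<rho>_0: "a \<in> OA \<Longrightarrow> \<rho> 0 a = a"
  and \<rho>_add: "a \<in> OA \<Longrightarrow> \<rho> (s + t) a = \<rho> s (\<rho> t a)"
  using is_gauge_action[unfolded is_gauge_action_def \<Phi>_U]
  by (auto simp: circle_action_on_def star_automorphism_on_def)

lemmas \<rho>_OA = hom_OA[OF hom_\<rho> \<rho>_S]
lemmas \<rho>_rng = hom_rng[OF hom_\<rho> \<rho>_S]
lemmas \<rho>_iso = hom_iso[OF hom_\<rho> \<rho>_S]

lemma \<rho>_P: "\<rho> t (P x n) = P x n"
  unfolding P_def by (rule \<rho>_rng)

lemma norm_\<rho>: "a \<in> OA \<Longrightarrow> norm (\<rho> t a) = norm a"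
proof (rule antisym)
  assume a: "a \<in> OA"
  show "norm (\<rho> t a) \<le> norm a" using hom_contractive[OF hom_\<rho> a] .
  show "norm a \<le> norm (\<rho> t a)"
    using hom_contractive[OF hom_\<rho> \<rho>_OA[OF a], of "- t" t] \<rho>_add[OF a, of "- t" t] \<rho>_0[OF a] by simp
qed

section \<open>Spectral subspaces and their generators\<close>

definition V :: "int \<Rightarrow> 'a set" where
  "V k = {a \<in> OA. \<forall>t. \<rho> t a = character t k *\<^sub>C a}"

lemma V_OA: "a \<in> V k \<Longrightarrow> a \<in> OA" and V_\<rho>: "a \<in> V k \<Longrightarrow> \<rho> t a = character t k *\<^sub>C a"
  by (auto simp: V_def)

lemma fixed_point_algebra_eq: "fixed_point_algebra A S f = V 0"
  by (simp add: fixed_point_algebra_def V_def)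

lemma V_mult: "a \<in> V k \<Longrightarrow> b \<in> V l \<Longrightarrow> a * b \<in> V (k + l)"
  by (simp add: V_def OA_intros star_hom_mult[OF hom_\<rho>] mult_scaleC_left mult_scaleC_right
      scaleC_scaleC character_add_int mult.commute)

lemma V_star: "a \<in> V k \<Longrightarrow> star a \<in> V (- k)"
  by (simp add: V_def OA_intros star_hom_star[OF hom_\<rho>] star_scaleC character_cnj)

lemma V_add: "a \<in> V k \<Longrightarrow> b \<in> V k \<Longrightarrow> a + b \<in> V k"
  by (simp add: V_def OA_intros star_hom_add[OF hom_\<rho>] scaleC_add_right)

lemma V_scaleC: "a \<in> V k \<Longrightarrow> c *\<^sub>C a \<in> V k"
  by (simp add: V_def OA_intros star_hom_scaleC[OF hom_\<rho>] scaleC_scaleC mult.commute)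

lemma V_zero: "0 \<in> V k"
  by (simp add: V_def OA_intros star_hom_zero[OF subalgebra_OA hom_\<rho>])

lemma subalgebra_V0: "cstar_subalgebra (V 0)"
  unfolding cstar_subalgebra_def
proof (intro conjI ballI allI)
  show "closed (V 0)"
    unfolding closed_sequential_limits
  proof (intro allI impI, elim conjE)
    fix g x assume g: "\<forall>n. g n \<in> V 0" and lim: "g \<longlonglongrightarrow> x"
    have gOA: "g n \<in> OA" for n using g V_OA by blast
    have x: "x \<in> OA" by (rule closed_sequentially[OF cstar_subalgebra_closed[OF subalgebra_OA] gOA lim])
    have "\<rho> t x = x" for t
    proof -
      have "\<rho> t (g n) = g n" for n using g by (simp add: V_def)
      then have "g \<longlonglongrightarrow> \<rho> t x" using hom_tendsto[OF hom_\<rho> gOA lim x, of t] by simp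
      then show ?thesis using LIMSEQ_unique lim by blast
    qed
    then show "x \<in> V 0" using x by (simp add: V_def)
  qed
qed (use V_mult[of _ 0 _ 0] V_star[of _ 0] in \<open>auto intro: V_zero V_add V_scaleC\<close>)

lemma rng_V0: "rng w \<in> V 0" and P_V0: "P x n \<in> V 0"
  by (simp_all add: V_def \<rho>_rng \<rho>_P rng_OA P_OA)

lemma one_V0: "1 \<in> V 0"
  using rng_V0[of "[]"] by simp

text \<open>Such an element moves the cylinder around \<open>v \<frown> x\<close> to the one around
  \<open>u \<frown> x\<close>. Since \<open>n0 \<le> m\<close>, both Birkhoff sums are constant
  there, so the monomial, cut down by \<open>P x m\<close>, is homogeneous of degree
  \<open>d\<close>.\<close>

definition gens :: "int \<Rightarrow> 'a set" where
  "gens d = {iso u * P x m * star (iso v) | u v x m. n0 \<le> m \<and> u \<frown> x \<in> X \<and> v \<frown> x \<in> X \<and>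
     birkhoff_sum f (length u) (u \<frown> x) - birkhoff_sum f (length v) (v \<frown> x) = d}"

lemma gens_V: "gens d \<subseteq> V d"
proof
  fix g assume "g \<in> gens d"
  then obtain u v x m where g: "g = iso u * P x m * star (iso v)" and m: "n0 \<le> m"
    and uv: "u \<frown> x \<in> X" "v \<frown> x \<in> X"
    and d: "birkhoff_sum f (length u) (u \<frown> x) - birkhoff_sum f (length v) (v \<frown> x) = d"
    by (auto simp: gens_def)
  let ?b = "\<lambda>u. birkhoff_sum f (length u) (u \<frown> x)"
  \<comment> \<open>One copy of the idempotent \<open>P x m\<close> goes to each side, so that
    \<open>\<rho>_iso\<close> applies to both factors.\<close>
  define h where "h w = iso w * P x m" for w
  have g': "g = h u * star (h v)"
  proof -
    have "h u * star (h v) = iso u * (P x m * P x m) * star (iso v)"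
      by (simp only: h_def star_mult P_star mult.assoc)
    then show ?thesis by (simp add: g)
  qed
  have h: "h w \<in> OA" for w unfolding h_def by (intro OA_intros P_OA)
  have ph: "\<rho> t (h w) = character t (?b w) *\<^sub>C h w" if "w \<frown> x \<in> X" for w t
    using \<rho>_iso[OF that m, of t] by (simp add: h_def star_hom_mult[OF hom_\<rho>] OA_intros P_OA \<rho>_P)
  have "\<rho> t g = character t d *\<^sub>C g" for t
    using character_add_int[of t "?b u" "- ?b v"]
    by (simp add: g' d[symmetric] star_hom_mult[OF hom_\<rho>] star_hom_star[OF hom_\<rho>] OA_intros h ph uv
        star_scaleC mult_scaleC_left mult_scaleC_right scaleC_scaleC character_cnj mult.commute)
  moreover have "g \<in> OA" unfolding g by (intro OA_intros P_OA)
  ultimately show "g \<in> V d" by (simp add: V_def)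
qed

lemma M_gens: "b \<in> M \<Longrightarrow> \<exists>L::nat. b \<in> cspan (\<Union>d\<in>{- int L..int L}. gens d)"
proof (induction rule: cspan_induct)
  case (add c g y)
  then obtain u v where g: "g = mon u v" by auto
  \<comment> \<open>\<open>n0\<close> letters settle the Birkhoff sums; one more makes the prefix
    nonempty, as \<open>iso_P_not_in\<close> requires.\<close>
  let ?m = "Suc n0"
  let ?G = "\<lambda>L::nat. \<Union>d\<in>{- int L..int L}. gens d"
  have "\<exists>L::nat. iso u * rng w * star (iso v) \<in> cspan (?G L)" if w: "w \<in> words ?m" for w
  proof (cases "adm w \<and> u \<frown> pt w \<in> X \<and> v \<frown> pt w \<in> X")
    case True
    then have P: "rng w = P (pt w) ?m" using pt[of w] w by (simp add: P_def)
    let ?d = "birkhoff_sum f (length u) (u \<frown> pt w) - birkhoff_sum f (length v) (v \<frown> pt w)"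
    have "iso u * rng w * star (iso v) \<in> gens ?d"
      unfolding P gens_def using True le_SucI[OF order_refl, of n0] by blast
    then have "iso u * rng w * star (iso v) \<in> ?G (nat \<bar>?d\<bar>)" by force
    then show ?thesis using cspan_base by blast
  next
    case False
    have "iso u * rng w * star (iso v) = 0"
    proof (cases "adm w")
      case True
      then have P: "rng w = P (pt w) ?m" using pt[of w] w by (simp add: P_def)
      have x: "pt w \<in> X" using pt True by blast
      show ?thesis
      proof (cases "u \<frown> pt w \<in> X")
        case True
        then have "v \<frown> pt w \<notin> X" using \<open>adm w\<close> False by blast
        then have "star (iso v * P (pt w) ?m) = 0" using iso_P_not_in[OF x, of v ?m] by simp
        then have "P (pt w) ?m * star (iso v) = 0" by (simp only: star_mult P_star)
        then show ?thesis unfolding P by (simp add: mult.assoc)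
      next
        case False
        then show ?thesis unfolding P using iso_P_not_in[OF x, of u ?m] by simp
      qed
    next
      case False
      then have "rng w = 0" by (simp add: rng_eq_0_iff)
      then show ?thesis by simp
    qed
    then show ?thesis using cspan_zero by metis
  qed
  then obtain L where L: "\<And>w. w \<in> words ?m \<Longrightarrow> iso u * rng w * star (iso v) \<in> cspan (?G (L w))"
    by metis
  obtain L' where L': "y \<in> cspan (?G L')" using add by blast
  define K where "K = Max (insert L' (L ` words ?m))"
  have K: "L w \<le> K" if "w \<in> words ?m" for w unfolding K_def using that by (intro Max_ge) auto
  have K': "L' \<le> K" unfolding K_def by (intro Max_ge) auto
  have mono: "cspan (?G l) \<subseteq> cspan (?G K)" if "l \<le> K" for l
    using that by (intro cspan_mono UN_mono) auto
  have "g = (\<Sum>w\<in>words ?m. iso u * rng w * star (iso v))"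
    by (simp add: g mon_def sum_distrib_left[symmetric] sum_distrib_right[symmetric] sum_rng)
  also have "\<dots> \<in> cspan (?G K)"
    by (rule cspan_sum) (use L K mono in blast)
  finally have "c *\<^sub>C g + y \<in> cspan (?G K)" using L' K' mono by (blast intro: cspan_add cspan_scaleC)
  then show ?case by blast
qed auto

text \<open>A Riemann sum of the \<open>k\<close>-th Fourier coefficient of \<open>t \<mapsto> \<rho> t a\<close>, which is exact on
  trigonometric polynomials of small degree.\<close>

definition fourier :: "nat \<Rightarrow> int \<Rightarrow> 'a \<Rightarrow> 'a" where
  "fourier N k a = (1 / real N) *\<^sub>R (\<Sum>j<N. character (real j / real N) (- k) *\<^sub>C \<rho> (real j / real N) a)"

lemma fourier_add: "a \<in> OA \<Longrightarrow> b \<in> OA \<Longrightarrow> fourier N k (a + b) = fourier N k a + fourier N k b"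
  by (simp add: fourier_def star_hom_add[OF hom_\<rho>] scaleC_add_right sum.distrib scaleR_add_right)

lemma fourier_diff: "a \<in> OA \<Longrightarrow> b \<in> OA \<Longrightarrow> fourier N k (a - b) = fourier N k a - fourier N k b"
  by (simp add: fourier_def star_hom_diff[OF subalgebra_OA hom_\<rho>] scaleC_diff_right sum_subtractf scaleR_diff_right)

lemma fourier_scaleC: "a \<in> OA \<Longrightarrow> fourier N k (c *\<^sub>C a) = c *\<^sub>C fourier N k a"
  by (simp add: fourier_def star_hom_scaleC[OF hom_\<rho>] scaleC_scaleR scaleC_sum_right scaleC_scaleC mult.commute)

lemma fourier_zero: "fourier N k 0 = 0"
  by (simp add: fourier_def star_hom_zero[OF subalgebra_OA hom_\<rho>])

lemma norm_fourier_le: "a \<in> OA \<Longrightarrow> norm (fourier N k a) \<le> norm a"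
proof -
  assume a: "a \<in> OA"
  have "norm (\<Sum>j<N. character (real j / real N) (- k) *\<^sub>C \<rho> (real j / real N) a) \<le> (\<Sum>j<N. norm a)"
    by (rule sum_norm_le) (simp add: norm_scaleC norm_\<rho> a)
  then show ?thesis by (cases "N = 0") (simp_all add: fourier_def field_simps)
qed

lemma fourier_V:
  assumes a: "a \<in> V d" and d: "\<bar>d - k\<bar> < int N"
  shows "fourier N k a = (if d = k then a else 0)"
proof -
  have "fourier N k a = (1 / real N) *\<^sub>R ((\<Sum>j<N. character (real j / real N) (d - k)) *\<^sub>C a)"
    unfolding fourier_def scaleC_sum_left
    by (simp add: V_\<rho>[OF a] scaleC_scaleC character_add_int[symmetric])
  also have "\<dots> = (if d = k then a else 0)"
  proof (cases "d = k")
    case True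
    then show ?thesis using d scaleC_of_real[of "real N" a] by simp
  next
    case False
    then show ?thesis using sum_character_eq_0[of "d - k" N] d by simp
  qed
  finally show ?thesis .
qed

text \<open>An approximant from \<open>M\<close> may have parts of other degrees.
  \<open>fourier N k\<close> removes them, fixes \<open>a\<close> and does not increase norms, so
  nothing is lost.\<close>

lemma approx_gens:
  assumes a: "a \<in> V k" and e: "e > 0"
  obtains b where "b \<in> cspan (gens k)" "norm (a - b) < e"
proof -
  obtain b where b: "b \<in> M" "norm (a - b) < e" using approx_M[OF V_OA[OF a] e] by blast
  obtain L :: nat where L: "b \<in> cspan (\<Union>d\<in>{- int L..int L}. gens d)" using M_gens[OF b(1)] by blast
  \<comment> \<open>\<open>N\<close> exceeds the distance from \<open>k\<close> to every degree
    between \<open>-L\<close> and \<open>L\<close>, which makes the average exact on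
    \<open>b\<close>.\<close>
  define N where "N = Suc (L + nat \<bar>k\<bar>)"
  have "y \<in> OA \<and> fourier N k y \<in> cspan (gens k)" if "y \<in> cspan (\<Union>d\<in>{- int L..int L}. gens d)" for y
    using that
  proof (induction rule: cspan_induct)
    case zero
    show ?case by (simp add: fourier_zero OA_intros)
  next
    case (add c g y)
    then obtain d where "d \<in> {- int L..int L}" and dg: "g \<in> gens d" by blast
    then have d: "\<bar>d\<bar> \<le> int L" "g \<in> gens d" by auto
    have "g \<in> V d" using gens_V d by blast
    then have g: "g \<in> OA" "fourier N k g = (if d = k then g else 0)"
      using V_OA fourier_V[of g d k N] d by (auto simp: N_def)
    then show ?case using add d
      by (auto simp: fourier_add fourier_scaleC OA_intros intro: cspan_add cspan_scaleC cspan_base)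
  qed
  then have "fourier N k b \<in> cspan (gens k)" using L by blast
  moreover have "norm (a - fourier N k b) < e"
  proof -
    have "a - fourier N k b = fourier N k (a - b)"
      using fourier_V[OF a, of k N] V_OA[OF a] M_OA[OF b(1)] by (simp add: fourier_diff N_def)
    also have "norm \<dots> \<le> norm (a - b)"
      by (intro norm_fourier_le OA_intros V_OA[OF a] M_OA b)
    finally show ?thesis using b(2) by simp
  qed
  ultimately show ?thesis by (rule that)
qed

end

section \<open>Aperiodic points\<close>

text \<open>Eventual periodicity is excluded too, so the notion passes to tails and survives
  prepending a word.\<close>

definition aperiodic :: "(nat \<Rightarrow> 'b) \<Rightarrow> bool" where
  "aperiodic x \<longleftrightarrow> (\<forall>k l. suffix k x = suffix l x \<longrightarrow> k = l)"

lemma aperiodic_suffix: "aperiodic x \<Longrightarrow> aperiodic (suffix k x)"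
  unfolding aperiodic_def suffix_suffix by (metis add_left_cancel)

lemma aperiodic_conc: "aperiodic x \<Longrightarrow> aperiodic (w \<frown> x)"
  unfolding aperiodic_def
proof (intro allI impI)
  fix k l assume x: "\<forall>k l. suffix k x = suffix l x \<longrightarrow> k = l" and eq: "suffix k (w \<frown> x) = suffix l (w \<frown> x)"
  have "suffix k x = suffix l x"
    using arg_cong[OF eq, of "suffix (length w)"] suffix_suffix[of k "length w" "w \<frown> x"]
      suffix_suffix[of l "length w" "w \<frown> x"] by (simp add: add.commute)
  then show "k = l" using x by blast
qed

text \<open>Two coinciding tails, at positions \<open>k < l\<close>, determine the sequence from its
  first \<open>l\<close> letters.\<close>

lemma countable_not_aperiodic: "countable {x :: nat \<Rightarrow> 'n::finite. \<not> aperiodic x}"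
proof -
  let ?B = "\<lambda>(k, l, w). {x :: nat \<Rightarrow> 'n. k < l \<and> suffix k x = suffix l x \<and> prefix l x = w}"
  have uniq: "x = y" if x: "x \<in> ?B (k, l, w)" and y: "y \<in> ?B (k, l, w)" for x y k l w
  proof
    fix n
    show "x n = y n"
    proof (induction n rule: less_induct)
      case (less n)
      show ?case
      proof (cases "n < l")
        case True
        have "prefix l x = prefix l y" using x y by simp
        then show ?thesis using True by (metis add_0 minus_nat.diff_0 subsequence_nth)
      next
        case False
        have step: "u n = u (k + (n - l))" if "u \<in> ?B (k, l, w)" for u
        proof -
          have "suffix k u (n - l) = suffix l u (n - l)" using that by auto
          then show ?thesis using False by simp
        qed
        have "x (k + (n - l)) = y (k + (n - l))" using x False by (intro less) auto
        then show ?thesis unfolding step[OF x] step[OF y] .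
      qed
    qed
  qed
  have "countable (?B a)" for a
  proof (cases "?B a = {}")
    case False
    then obtain x where x: "x \<in> ?B a" by blast
    obtain k l w where a: "a = (k, l, w)" by (rule prod_cases3)
    have "?B a \<subseteq> {x}" using uniq[OF _ x[unfolded a]] unfolding a by blast
    then show ?thesis by (rule countable_subset) simp
  qed simp
  moreover have "countable (UNIV :: (nat \<times> nat \<times> 'n list) set)"
  proof -
    have "countable (UNIV :: 'n list set)"
      using countable_lists[OF countable_finite[OF finite_class.finite_UNIV]] by simp
    then have "countable (UNIV \<times> UNIV \<times> UNIV :: (nat \<times> nat \<times> 'n list) set)" by (intro countable_SIGMA) auto
    then show ?thesis by simp
  qed
  ultimately have "countable (\<Union>a. ?B a)" by (intro countable_UN)
  moreover have "{x :: nat \<Rightarrow> 'n. \<not> aperiodic x} \<subseteq> (\<Union>a. ?B a)"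
  proof
    fix x :: "nat \<Rightarrow> 'n" assume "x \<in> {x. \<not> aperiodic x}"
    then obtain k l where "k \<noteq> l" "suffix k x = suffix l x" by (auto simp: aperiodic_def)
    then have "\<exists>k l. k < l \<and> suffix k x = suffix l x" by (metis linorder_neqE_nat)
    then show "x \<in> (\<Union>a. ?B a)" by auto
  qed
  ultimately show ?thesis by (rule countable_subset[rotated])
qed

section \<open>Density of the aperiodic points\<close>

context ck_matrix
begin

lemma adm_append_iff:
  "adm (u @ v) \<longleftrightarrow> adm u \<and> adm v \<and> (u \<noteq> [] \<longrightarrow> v \<noteq> [] \<longrightarrow> A $ last u $ hd v = 1)"
  by (induction u) (auto simp: adm_Cons hd_append)

lemma connecting_word: "\<exists>u. u \<noteq> [] \<and> last u = j \<and> adm (i # u)"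
  using path[of i j]
proof (induction rule: trancl_induct)
  case (base j)
  then show ?case by (intro exI[of _ "[j]"]) (simp add: adm_Cons)
next
  case (step j k)
  then obtain u where "u \<noteq> []" "last u = j" "adm (i # u)" by blast
  with step show ?case
    by (intro exI[of _ "u @ [k]"]) (simp flip: append_Cons add: adm_append_iff)
qed

text \<open>Without branching \<open>A\<close> is the graph of a map. Irreducibility makes the map
  surjective, and finiteness makes it a permutation.\<close>

lemma branching:
  assumes "\<not> permutation_matrix A"
  shows "\<exists>i j k. A $ i $ j = 1 \<and> A $ i $ k = 1 \<and> j \<noteq> k"
proof (rule ccontr)
  assume "\<not> (\<exists>i j k. A $ i $ j = 1 \<and> A $ i $ k = 1 \<and> j \<noteq> k)"
  then have uniq: "j = k" if "A $ i $ j = 1" "A $ i $ k = 1" for i j k using that by blast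
  obtain \<pi> where \<pi>: "\<And>i. A $ i $ \<pi> i = 1" using ex_successor by metis
  have eq: "A $ i $ j = (if j = \<pi> i then 1 else 0)" for i j
  proof (cases "j = \<pi> i")
    case False
    then have "A $ i $ j \<noteq> 1" using uniq[OF \<pi>[of i]] by blast
    then show ?thesis using entry[of i j] False by simp
  qed (simp add: \<pi>)
  have "surj \<pi>"
  proof -
    have "\<exists>i. j = \<pi> i" for j
    proof -
      have "\<exists>i. A $ i $ j = 1" using tranclD2[OF path[of j j]] by auto
      then show ?thesis using uniq[OF _ \<pi>] by blast
    qed
    then show ?thesis unfolding surj_def by blast
  qed
  then have "bij \<pi>" using finite_UNIV_surj_inj[of \<pi>] by (simp add: bij_def)
  moreover have "A = (\<chi> i j. if j = \<pi> i then 1 else 0)" by (simp add: vec_eq_iff eq)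
  ultimately show False using assms unfolding permutation_matrix_def by blast
qed

text \<open>Walk from \<open>w\<close> to a letter with two successors: of the two continuations at
  most one agrees with \<open>e\<close>.\<close>

lemma cylinder_avoids:
  assumes np: "\<not> permutation_matrix A" and w: "adm w"
  shows "\<exists>v. adm v \<and> length w < length v \<and> take (length w) v = w \<and> prefix (length v) e \<noteq> v"
proof -
  obtain i j k where b: "A $ i $ j = 1" "A $ i $ k = 1" "j \<noteq> k" using branching[OF np] by blast
  obtain u where u: "adm (w @ u)" "w @ u \<noteq> []" "last (w @ u) = i"
  proof (cases "w = []")
    case True
    then show ?thesis using that[of "[i]"] by simp
  next
    case False
    obtain u where "u \<noteq> []" "last u = i" "adm (last w # u)" using connecting_word by blast
    then show ?thesis using that[of u] w False by (auto simp: adm_append_iff adm_Cons)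
  qed
  have adm: "adm (w @ u @ [j])" "adm (w @ u @ [k])"
    using u b by (simp_all add: adm_append_iff flip: append_assoc)
  have "prefix (length (w @ u @ [j])) e \<noteq> w @ u @ [j] \<or> prefix (length (w @ u @ [k])) e \<noteq> w @ u @ [k]"
    using b(3) by auto
  then show ?thesis
  proof
    assume "prefix (length (w @ u @ [j])) e \<noteq> w @ u @ [j]"
    then show ?thesis using adm(1) by (intro exI[of _ "w @ u @ [j]"]) simp
  next
    assume "prefix (length (w @ u @ [k])) e \<noteq> w @ u @ [k]"
    then show ?thesis using adm(2) by (intro exI[of _ "w @ u @ [k]"]) simp
  qed
qed

text \<open>Diagonalisation against the countably many eventually periodic sequences.\<close>

lemma ex_aperiodic:
  assumes np: "\<not> permutation_matrix A" and w: "adm w"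
  obtains y where "y \<in> X" "aperiodic y" "prefix (length w) y = w"
proof -
  \<comment> \<open>The inserted sequence makes \<open>?B\<close> visibly nonempty, so that
    \<open>from_nat_into\<close> enumerates it.\<close>
  let ?B = "insert (\<lambda>_. undefined) {x :: nat \<Rightarrow> 'n. \<not> aperiodic x}"
  have "countable ?B" using countable_not_aperiodic by simp
  moreover define e where "e = from_nat_into ?B"
  ultimately have e: "range e = ?B" by (simp only: e_def range_from_nat_into insert_not_empty not_False_eq_True)
  have "\<exists>W. \<forall>n. (adm (W n) \<and> (n = 0 \<longrightarrow> W n = w)) \<and>
      (length (W n) < length (W (Suc n)) \<and> take (length (W n)) (W (Suc n)) = W n \<and>
       prefix (length (W (Suc n))) (e n) \<noteq> W (Suc n))"
  proof (rule dependent_nat_choice)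
    show "\<exists>v. adm v \<and> ((0::nat) = 0 \<longrightarrow> v = w)" using w by blast
    fix v and n :: nat assume "adm v \<and> (n = 0 \<longrightarrow> v = w)"
    then show "\<exists>v'. (adm v' \<and> (Suc n = 0 \<longrightarrow> v' = w)) \<and>
      (length v < length v' \<and> take (length v) v' = v \<and> prefix (length v') (e n) \<noteq> v')"
      using cylinder_avoids[OF np, of v "e n"] by auto
  qed
  then obtain W where W': "\<forall>n. (adm (W n) \<and> (n = 0 \<longrightarrow> W n = w)) \<and>
      (length (W n) < length (W (Suc n)) \<and> take (length (W n)) (W (Suc n)) = W n \<and>
       prefix (length (W (Suc n))) (e n) \<noteq> W (Suc n))" ..
  have W: "adm (W n)" "W 0 = w" "length (W n) < length (W (Suc n))"
    "take (length (W n)) (W (Suc n)) = W n"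
    "prefix (length (W (Suc n))) (e n) \<noteq> W (Suc n)" for n
    using W' by blast+
  have len: "n \<le> length (W n)" for n
  proof (induction n)
    case (Suc n)
    then show ?case using W(3)[of n] by linarith
  qed simp
  have tk: "length (W n) \<le> length (W (n + m)) \<and> take (length (W n)) (W (n + m)) = W n" for n m
  proof (induction m)
    case (Suc m)
    have "take (length (W n)) (W (n + Suc m)) = take (length (W n)) (take (length (W (n + m))) (W (Suc (n + m))))"
      using Suc by (simp add: min_def)
    then show ?case using Suc W(3)[of "n + m"] W(4)[of "n + m"] by simp
  qed simp
  have nth: "W m ! i = W n ! i" if "i < length (W n)" "n \<le> m" for i n m
    using tk[of n "m - n"] that nth_take[of i "length (W n)" "W m"] by simp
  \<comment> \<open>\<open>W n\<close> has at least \<open>n\<close> letters, so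
    \<open>W (Suc i)\<close> is certain to have an \<open>i\<close>-th one.\<close>
  define y where "y i = W (Suc i) ! i" for i
  have y: "y i = W n ! i" if "i < length (W n)" for i n
    using nth[OF that, of "max n (Suc i)"] nth[of i "Suc i" "max n (Suc i)"] len[of "Suc i"]
    by (simp add: y_def)
  have pre: "prefix (length (W n)) y = W n" for n
    by (rule nth_equalityI) (simp_all add: y)
  have "y \<in> X"
    unfolding shift_space_def
  proof (intro CollectI allI)
    fix n
    have l: "Suc n < length (W (Suc (Suc n)))" using len[of "Suc (Suc n)"] by simp
    then show "A $ y n $ y (Suc n) = 1"
      using W(1)[of "Suc (Suc n)"] y[OF l] y[of n "Suc (Suc n)"] by (simp add: adm_def)
  qed
  moreover have "aperiodic y"
  proof (rule ccontr)
    assume "\<not> aperiodic y"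
    then have "y \<in> range e" unfolding e by simp
    then obtain n where "y = e n" by blast
    then show False using pre[of "Suc n"] W(5)[of n] by simp
  qed
  ultimately show ?thesis using that pre[of 0] W(2) by simp
qed

end

section \<open>Faithfulness of the representation on aperiodic orbits\<close>

context ck_family
begin

lemma iso_conc_P: "u \<frown> x \<in> X \<Longrightarrow> star (iso u) * iso u * P x (Suc m) = P x (Suc m)"
proof -
  assume u: "u \<frown> x \<in> X"
  let ?w = "prefix (Suc m) x"
  have "adm (u @ ?w)" using adm_prefix[OF u, of "length u + Suc m"] by simp
  then have "star (iso u) * iso u * iso ?w = iso ?w"
    by (cases "u = []") (auto simp: star_iso_iso q_iso adm_append_iff)
  then show ?thesis by (simp add: P_def rng_def mult.assoc[symmetric])
qed

section \<open>The ideal of elements negligible along aperiodic points\<close>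

lemma conc_suffix: "prefix (length w) y = w \<Longrightarrow> w \<frown> suffix (length w) y = y"
  by (metis prefix_suffix)

text \<open>On the orbit space the \<open>P y n\<close> decrease to the projection onto the basis
  vector of \<open>y\<close>, so the condition is a norm version of annihilating that
  vector.\<close>

definition Z :: "'a set" where
  "Z = {a \<in> OA. \<forall>y\<in>X. aperiodic y \<longrightarrow> (\<lambda>n. norm (a * P y n)) \<longlonglongrightarrow> 0}"

lemma Z_OA: "a \<in> Z \<Longrightarrow> a \<in> OA" and
  Z_lim: "a \<in> Z \<Longrightarrow> y \<in> X \<Longrightarrow> aperiodic y \<Longrightarrow> (\<lambda>n. norm (a * P y n)) \<longlonglongrightarrow> 0"
  by (auto simp: Z_def)

lemma Z_zero: "0 \<in> Z"
  by (simp add: Z_def OA_intros)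

lemma Z_mult_left: "b \<in> OA \<Longrightarrow> a \<in> Z \<Longrightarrow> b * a \<in> Z"
proof -
  assume b: "b \<in> OA" and a: "a \<in> Z"
  have "(\<lambda>n. norm (b * a * P y n)) \<longlonglongrightarrow> 0" if y: "y \<in> X" "aperiodic y" for y
  proof (rule Lim_null_comparison)
    show "(\<lambda>n. norm b * norm (a * P y n)) \<longlonglongrightarrow> 0"
      using tendsto_mult_left[OF Z_lim[OF a y], of "norm b"] by simp
    show "\<forall>\<^sub>F n in sequentially. norm (norm (b * a * P y n)) \<le> norm b * norm (a * P y n)"
      by (rule always_eventually) (simp add: mult.assoc norm_mult_ineq)
  qed
  then show ?thesis using a b by (simp add: Z_def OA_intros)
qed

lemma Z_scaleC: "a \<in> Z \<Longrightarrow> c *\<^sub>C a \<in> Z"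
  using Z_mult_left[of "c *\<^sub>C 1" a] by (simp add: mult_scaleC_left OA_intros)

lemma Z_scaleR: "a \<in> Z \<Longrightarrow> r *\<^sub>R a \<in> Z"
  using Z_scaleC[of a "of_real r"] by (simp add: scaleC_of_real)

lemma Z_add: "a \<in> Z \<Longrightarrow> b \<in> Z \<Longrightarrow> a + b \<in> Z"
proof -
  assume a: "a \<in> Z" and b: "b \<in> Z"
  have "(\<lambda>n. norm ((a + b) * P y n)) \<longlonglongrightarrow> 0" if y: "y \<in> X" "aperiodic y" for y
  proof (rule Lim_null_comparison)
    show "(\<lambda>n. norm (a * P y n) + norm (b * P y n)) \<longlonglongrightarrow> 0"
      using tendsto_add[OF Z_lim[OF a y] Z_lim[OF b y]] by simp
    show "\<forall>\<^sub>F n in sequentially. norm (norm ((a + b) * P y n)) \<le> norm (a * P y n) + norm (b * P y n)"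
      by (rule always_eventually) (simp add: distrib_right norm_triangle_ineq)
  qed
  then show ?thesis using a b by (simp add: Z_def OA_intros)
qed

lemma Z_sum: "(\<And>i. i \<in> I \<Longrightarrow> g i \<in> Z) \<Longrightarrow> (\<Sum>i\<in>I. g i) \<in> Z"
  by (induction I rule: infinite_finite_induct) (auto intro: Z_zero Z_add)

lemma Z_closed:
  assumes a: "a \<in> OA" and approx: "\<And>e. e > 0 \<Longrightarrow> \<exists>z\<in>Z. norm (a - z) < e"
  shows "a \<in> Z"
proof -
  have "(\<lambda>n. norm (a * P y n)) \<longlonglongrightarrow> 0" if y: "y \<in> X" "aperiodic y" for y
  proof (rule LIMSEQ_I)
    fix e :: real assume e: "0 < e"
    then obtain z where z: "z \<in> Z" "norm (a - z) < e/2" using approx[of "e/2"] by auto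
    obtain N where N: "\<And>n. n \<ge> N \<Longrightarrow> norm (z * P y n) < e/2"
      using LIMSEQ_D[OF Z_lim[OF z(1) y], of "e/2"] e by auto
    have "norm (a * P y n) < e" if "n \<ge> N" for n
    proof -
      have "norm (a * P y n) \<le> norm ((a - z) * P y n) + norm (z * P y n)"
        using norm_triangle_ineq[of "(a - z) * P y n" "z * P y n"] by (simp add: algebra_simps)
      also have "norm ((a - z) * P y n) \<le> norm (a - z)"
        using norm_mult_ineq[of "a - z" "P y n"] mult_left_le[OF norm_P_le[of y n] norm_ge_zero[of "a - z"]]
        by (rule order.trans)
      finally show ?thesis using z(2) N[OF that] by simp
    qed
    then show "\<exists>N. \<forall>n\<ge>N. norm (norm (a * P y n) - 0) < e" by auto
  qed
  then show ?thesis using a by (simp add: Z_def)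
qed

text \<open>A monomial either kills the small cylinders around \<open>y\<close> or moves them to
  cylinders around \<open>u \<frown> x\<close>, where \<open>y = v \<frown> x\<close>. That point is
  aperiodic again, and this closes the ideal under right multiplication.\<close>

lemma Z_mult_mon: "a \<in> Z \<Longrightarrow> a * mon u v \<in> Z"
proof -
  assume a: "a \<in> Z"
  have "(\<lambda>n. norm (a * mon u v * P y n)) \<longlonglongrightarrow> 0" if y: "y \<in> X" "aperiodic y" for y
  proof (cases "prefix (length v) y = v")
    case False
    have "\<forall>\<^sub>F n in sequentially. norm (a * mon u v * P y n) = 0"
    proof (rule eventually_sequentiallyI)
      fix n assume "length v \<le> n"
      then have "star (P y n * iso v) = 0" using P_iso_other False by simp
      then have "star (iso v) * P y n = 0" by (simp only: star_mult P_star)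
      then show "norm (a * mon u v * P y n) = 0" by (simp add: mon_def mult.assoc)
    qed
    then show ?thesis by (rule tendsto_eventually)
  next
    case True
    define x where "x = suffix (length v) y"
    have x: "x \<in> X" "aperiodic x" using y by (simp_all add: x_def suffix_in aperiodic_suffix)
    have yx: "y = v \<frown> x" unfolding x_def using conc_suffix[OF True] by simp
    \<comment> \<open>The offset \<open>Suc (length v)\<close> leaves a nonempty prefix of
      \<open>x\<close> after \<open>v\<close> is removed.\<close>
    have P: "star (iso v) * P y (n + Suc (length v)) = P x (Suc n) * star (iso v)" for n
      unfolding yx using star_iso_P[of v x "n + Suc (length v)"] y by (simp add: yx)
    have "(\<lambda>n. norm (a * mon u v * P y (n + Suc (length v)))) \<longlonglongrightarrow> 0"
    proof (cases "u \<frown> x \<in> X")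
      case False
      have "a * mon u v * P y (n + Suc (length v)) = 0" for n
      proof -
        have "a * mon u v * P y (n + Suc (length v)) = a * (iso u * P x (Suc n)) * star (iso v)"
          by (simp only: mon_def mult.assoc P)
        then show ?thesis using iso_P_not_in[OF x(1) False] by simp
      qed
      then show ?thesis by simp
    next
      case True
      show ?thesis
      proof (rule Lim_null_comparison)
        show "(\<lambda>n. norm (a * P (u \<frown> x) (n + Suc (length u)))) \<longlonglongrightarrow> 0"
          using Z_lim[OF a True aperiodic_conc[OF x(2)]] by (rule LIMSEQ_ignore_initial_segment)
        have "norm (a * mon u v * P y (n + Suc (length v))) \<le> norm (a * P (u \<frown> x) (n + Suc (length u)))" for n
        proof -
          have "a * mon u v * P y (n + Suc (length v)) = a * (iso u * P x (Suc n)) * star (iso v)"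
            by (simp only: mon_def mult.assoc P)
          also have "\<dots> = a * P (u \<frown> x) (n + Suc (length u)) * (iso u * star (iso v))"
            unfolding iso_P[OF True] by (simp add: mult.assoc add.commute)
          also have "norm \<dots> \<le> norm (a * P (u \<frown> x) (n + Suc (length u))) * (1 * 1)"
            by (intro order.trans[OF norm_mult_ineq] mult_left_mono mult_mono order.trans[OF norm_mult_ineq])
              (simp_all add: norm_iso_le)
          finally show ?thesis by simp
        qed
        then show "\<forall>\<^sub>F n in sequentially. norm (norm (a * mon u v * P y (n + Suc (length v)))) \<le>
            norm (a * P (u \<frown> x) (n + Suc (length u)))" by simp
      qed
    qed
    then show ?thesis by (rule LIMSEQ_offset)
  qed
  then show ?thesis using a M_OA[OF mon_in_M] by (simp add: Z_def OA_intros)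
qed

lemma Z_mult_right: "a \<in> Z \<Longrightarrow> b \<in> OA \<Longrightarrow> a * b \<in> Z"
proof -
  assume a: "a \<in> Z" and b: "b \<in> OA"
  have M: "a * c \<in> Z" if "c \<in> M" for c
    using that
  proof (induction rule: cspan_induct)
    case (add c g y)
    then show ?case using Z_mult_mon[OF a]
      by (auto simp: distrib_left mult_scaleC_right intro: Z_add Z_scaleC)
  qed (simp add: Z_zero)
  show ?thesis
  proof (rule Z_closed)
    show "a * b \<in> OA" using a b by (simp add: Z_OA OA_intros)
    fix e :: real assume e: "e > 0"
    have pos: "norm a + 1 > 0" using norm_ge_zero[of a] by linarith
    obtain c where c: "c \<in> M" "norm (b - c) < e / (norm a + 1)"
      using approx_M[OF b, of "e / (norm a + 1)"] e pos by auto
    have "norm (a * b - a * c) \<le> norm a * norm (b - c)"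
      by (simp add: right_diff_distrib[symmetric] norm_mult_ineq)
    also have "\<dots> \<le> (norm a + 1) * norm (b - c)" by (intro mult_right_mono) auto
    also have "\<dots> < e" using c(2) pos by (simp add: field_simps)
    finally show "\<exists>z\<in>Z. norm (a * b - z) < e" using M[OF c(1)] by blast
  qed
qed

section \<open>Comparison with the quotient norm\<close>

lemma OA_power: "a \<in> OA \<Longrightarrow> a ^ m \<in> OA"
  by (induction m) (simp_all add: OA_intros)

text \<open>Modulo the ideal \<open>Z\<close> the elements \<open>a\<close> and \<open>a - z\<close>
  coincide, hence so do their powers.\<close>

lemma Z_diff_power: "a \<in> OA \<Longrightarrow> z \<in> Z \<Longrightarrow> a ^ m - (a - z) ^ m \<in> Z"
proof (induction m)
  case (Suc m)
  have e: "a ^ Suc m - (a - z) ^ Suc m = a * (a ^ m - (a - z) ^ m) + z * (a - z) ^ m"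
    by (simp add: algebra_simps)
  have pw: "(a - z) ^ m \<in> OA"
    using Suc(2,3) Z_OA by (intro OA_power cstar_subalgebra_diff[OF subalgebra_OA]) simp_all
  then show ?case unfolding e using Suc by (intro Z_add Z_mult_left Z_mult_right) auto
qed (simp add: Z_zero)

text \<open>The numbers \<open>norm (b - z)\<close> compute the quotient norm modulo \<open>Z\<close>.  By the estimate on powers it is
  enough to compare it with \<open>norm\<close> up to constants of subexponential growth.\<close>

lemma quotient_norm_eq:
  assumes b: "b \<in> OA" and z: "z \<in> Z"
    and bound: "\<And>m z. z \<in> Z \<Longrightarrow> norm ((star b * b) ^ m) \<le> (\<alpha> * real m + \<beta>) * norm ((star b * b) ^ m - z)"
    and \<alpha>: "0 \<le> \<alpha>" "0 \<le> \<beta>"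
  shows "norm b \<le> norm (b - z)"
proof -
  let ?h = "star b * b"
  let ?K = "norm b * norm (b - z)"
  have h: "?h \<in> OA" and z': "star b * z \<in> Z" using b z by (auto intro: OA_intros Z_mult_left)
  \<comment> \<open>The difference is \<open>star b * (b - z)\<close>; its powers represent the
    powers of \<open>?h\<close> modulo \<open>Z\<close>.\<close>
  have d: "norm (?h - star b * z) \<le> ?K"
    using norm_mult_ineq[of "star b" "b - z"] by (simp add: right_diff_distrib)
  have "norm ?h \<le> ?K"
  proof (rule norm_le_if_power_bound)
    fix m
    have "norm (?h ^ m) \<le> (\<alpha> * real m + \<beta>) * norm (?h ^ m - (?h ^ m - (?h - star b * z) ^ m))"
      by (rule bound[OF Z_diff_power[OF h z']])
    also have "?h ^ m - (?h ^ m - (?h - star b * z) ^ m) = (?h - star b * z) ^ m" by simp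
    also have "norm \<dots> \<le> ?K ^ m"
      by (rule order.trans[OF norm_power_ineq power_mono[OF d]]) simp
    finally show "norm (?h ^ m) \<le> (\<alpha> * real m + \<beta>) * ?K ^ m"
      using \<alpha> by (simp add: mult_left_mono)
  qed (simp_all add: star_mult star_star)
  then have "norm b * norm b \<le> norm b * norm (b - z)" by (simp add: cstar_identity power2_eq_square)
  then show ?thesis by (cases "norm b = 0") (auto simp: mult_le_cancel_left)
qed

text \<open>The spanning elements equal \<open>mon (u @ [j]) (v @ [j])\<close>. For fixed
  \<open>j\<close> the nonzero ones multiply like matrix units and for different \<open>j\<close>
  they are orthogonal, so the span is a finite-dimensional algebra.\<close>

definition core :: "nat \<Rightarrow> 'a set" where
  "core n = {iso u * p j * star (iso v) | u j v. length u = n \<and> length v = n}"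

lemma mon_core: "length u = n \<Longrightarrow> length v = n \<Longrightarrow> mon u v \<in> cspan (core n)"
proof -
  assume "length u = n" "length v = n"
  then have "(\<Sum>j\<in>UNIV. iso u * p j * star (iso v)) \<in> cspan (core n)"
    by (intro cspan_sum cspan_base) (auto simp: core_def)
  then show ?thesis by (simp add: mon_def sum_distrib_left[symmetric] sum_distrib_right[symmetric] sum_p)
qed

lemma core_mono: "n \<le> m \<Longrightarrow> cspan (core n) \<subseteq> cspan (core m)"
proof (induction m rule: dec_induct)
  case (step m)
  have "cspan (core m) \<subseteq> cspan (core (Suc m))"
  proof (rule subsetI, erule cspan_subset_cspan[rotated])
    fix g assume "g \<in> core m"
    then obtain u j v where g: "g = iso u * p j * star (iso v)" and l: "length u = m" "length v = m"
      by (auto simp: core_def)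
    have "g = mon (u @ [j]) (v @ [j])" by (simp add: g mon_def iso_append star_mult p_def mult.assoc)
    then show "g \<in> cspan (core (Suc m))" using mon_core[of "u @ [j]" "Suc m" "v @ [j]"] l by simp
  qed
  then show ?case using step by blast
qed simp

lemma gram_p: "star (iso u) * iso u * p j = 0 \<or> star (iso u) * iso u * p j = p j"
  "p j * (star (iso u) * iso u) = 0 \<or> p j * (star (iso u) * iso u) = p j"
proof -
  show 1: "star (iso u) * iso u * p j = 0 \<or> star (iso u) * iso u * p j = p j"
    by (simp add: star_iso_iso q_p)
  have "p j * (star (iso u) * iso u) = star (star (iso u) * iso u * p j)"
    by (simp only: star_mult star_star p_star mult.assoc)
  then show "p j * (star (iso u) * iso u) = 0 \<or> p j * (star (iso u) * iso u) = p j" using 1 by auto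
qed

lemma core_mult: "x \<in> cspan (core n) \<Longrightarrow> y \<in> cspan (core n) \<Longrightarrow> x * y \<in> cspan (core n)"
proof (erule cspan_mult[rotated])
  fix g h assume "g \<in> core n" "h \<in> core n"
  then obtain u j v a k b where g: "g = iso u * p j * star (iso v)" "length u = n" "length v = n"
    and h: "h = iso a * p k * star (iso b)" "length a = n" "length b = n" by (auto simp: core_def)
  have e: "g * h = iso u * (p j * (star (iso v) * iso a)) * p k * star (iso b)"
    by (simp add: g h mult.assoc)
  show "g * h \<in> cspan (core n)"
  proof (cases "v = a \<and> p j * (star (iso v) * iso v) = p j \<and> j = k")
    case True
    then have "v = a" and pj: "p j * (star (iso v) * iso v) = p j" and "j = k" by auto
    have "g * h = iso u * p j * p k * star (iso b)" unfolding e \<open>v = a\<close>[symmetric] pj ..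
    also have "\<dots> = iso u * (p j * p k) * star (iso b)" by (simp only: mult.assoc)
    finally have "g * h = iso u * p j * star (iso b)" by (simp add: \<open>j = k\<close>)
    then show ?thesis using g h by (intro cspan_base) (auto simp: core_def)
  next
    case False
    then consider "v \<noteq> a" | "v = a" "p j * (star (iso v) * iso v) = 0"
      | "v = a" "p j * (star (iso v) * iso v) = p j" "j \<noteq> k"
      using gram_p(2)[of j v] by blast
    then have "p j * (star (iso v) * iso a) * p k = 0"
    proof cases
      case 1
      then show ?thesis using star_iso_orth[of v a] g h by simp
    next
      case 2
      then show ?thesis by simp
    next
      case 3
      then show ?thesis using p_p[of j k] by simp
    qed
    moreover have "g * h = iso u * (p j * (star (iso v) * iso a) * p k) * star (iso b)"
      unfolding e by (simp only: mult.assoc)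
    ultimately have "g * h = 0" by simp
    then show ?thesis by simp
  qed
qed

lemma core_star: "x \<in> cspan (core n) \<Longrightarrow> star x \<in> cspan (core n)"
proof (erule cspan_star[rotated])
  fix g assume "g \<in> core n"
  then obtain u j v where "g = iso u * p j * star (iso v)" "length u = n" "length v = n"
    by (auto simp: core_def)
  then have "star g = iso v * p j * star (iso u)" "length u = n" "length v = n"
    by (simp_all add: star_mult star_star mult.assoc)
  then show "star g \<in> cspan (core n)" by (intro cspan_base) (auto simp: core_def)
qed

lemma core_one: "1 \<in> cspan (core n)"
proof -
  have "(\<Sum>w\<in>words n. mon w w) \<in> cspan (core n)" by (intro cspan_sum mon_core) auto
  then show ?thesis by (simp add: mon_def flip: rng_def add: sum_rng)
qed

lemma core_M: "cspan (core n) \<subseteq> OA"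
  by (rule cspan_subset_subalgebra[OF subalgebra_OA])
    (auto simp: core_def p_def intro!: OA_intros)

text \<open>In the matrix picture this is the entry at \<open>(u, v)\<close>: each spanning element
  contributes 0 or a multiple of a single \<open>p k\<close>.\<close>

lemma core_coefficients:
  assumes "b \<in> cspan (core n)" "length u = n" "length v = n"
  shows "\<exists>c. star (iso u) * b * iso v = (\<Sum>j\<in>UNIV. c j *\<^sub>C p j)"
  using assms(1)
proof (induction rule: cspan_induct)
  case zero
  show ?case by (rule exI[of _ "\<lambda>_. 0"]) simp
next
  case (add d g y)
  then obtain a k a' where g: "g = iso a * p k * star (iso a')" "length a = n" "length a' = n"
    by (auto simp: core_def)
  have "star (iso u) * g * iso v = (star (iso u) * iso a) * p k * (star (iso a') * iso v)"
    by (simp add: g mult.assoc)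
  moreover have "(star (iso u) * iso a) * p k = 0 \<or> (star (iso u) * iso a) * p k = p k"
    using star_iso_orth[of u a] gram_p(1)[of u k] assms g by (cases "u = a") auto
  moreover have "p k * (star (iso a') * iso v) = 0 \<or> p k * (star (iso a') * iso v) = p k"
    using star_iso_orth[of a' v] gram_p(2)[of k v] assms g by (cases "a' = v") auto
  ultimately have "\<exists>s::complex. star (iso u) * g * iso v = s *\<^sub>C p k"
    by (metis mult_zero_left scaleC_one scaleC_zero_left)
  then obtain s :: complex where s: "star (iso u) * g * iso v = s *\<^sub>C p k" ..
  obtain c where c: "star (iso u) * y * iso v = (\<Sum>j\<in>UNIV. c j *\<^sub>C p j)" using add by blast
  have "(\<Sum>j\<in>UNIV. (d * s * (if j = k then 1 else 0)) *\<^sub>C p j) = (\<Sum>j\<in>UNIV. if j = k then (d * s) *\<^sub>C p k else 0)"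
    by (rule sum.cong) auto
  then have "star (iso u) * (d *\<^sub>C g + y) * iso v = (\<Sum>j\<in>UNIV. (d * s * (if j = k then 1 else 0) + c j) *\<^sub>C p j)"
    by (simp add: distrib_left distrib_right mult_scaleC_left mult_scaleC_right s c scaleC_scaleC
        scaleC_add_left sum.distrib)
  then show ?case by (rule exI[of _ "\<lambda>j. d * s * (if j = k then 1 else 0) + c j"])
qed

context
  assumes nonpermutation: "\<not> permutation_matrix A"
begin

text \<open>The coefficient at \<open>p j\<close> is seen along an aperiodic point that starts with
  \<open>v @ [j]\<close>: there it is bounded by \<open>norm (b - z)\<close> plus a term with
  \<open>z\<close> that tends to 0. The factor \<open>CARD('n)\<close> comes from summing over
  \<open>j\<close>.\<close>

lemma core_entry_bound:
  assumes b: "b \<in> cspan (core n)" and z: "z \<in> Z" and u: "length u = n" and v: "length v = n"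
  shows "norm (star (iso u) * b * iso v) \<le> real (CARD('n)) * norm (b - z)"
proof -
  obtain c where c: "star (iso u) * b * iso v = (\<Sum>j\<in>UNIV. c j *\<^sub>C p j)"
    using core_coefficients[OF b u v] by blast
  let ?d = "star (iso u) * b * iso v"
  have dp: "?d * p j = c j *\<^sub>C p j" for j
  proof -
    have "?d * p j = (\<Sum>k\<in>UNIV. if k = j then c j *\<^sub>C p j else 0)"
      unfolding c sum_distrib_right by (rule sum.cong) (auto simp: mult_scaleC_left p_p)
    then show ?thesis by simp
  qed
  have bound: "norm (?d * p j) \<le> norm (b - z)" for j
  proof (cases "adm (v @ [j])")
    case False
    then have "iso (v @ [j]) = 0" by (simp add: iso_eq_0_iff)
    then have "iso v * S j = 0" by (simp add: iso_append)
    then have "?d * p j = 0" by (simp add: p_def mult.assoc) (simp flip: mult.assoc)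
    then show ?thesis by simp
  next
    case True
    obtain y where y: "y \<in> X" "aperiodic y" "prefix (length (v @ [j])) y = v @ [j]"
      using ex_aperiodic[OF nonpermutation True] .
    define x where "x = suffix (length v) y"
    have "prefix (length v) y = v" "y (length v) = j" using y(3) by auto
    then have x: "y = v \<frown> x" "x 0 = j" "x \<in> X"
      using conc_suffix[where w=v and y=y] y(1) by (simp_all add: x_def suffix_in)
    have le: "norm (c j) \<le> norm (b - z) + norm (z * P y (m + Suc n))" for m
    proof -
      have "p j * P x (Suc m) = P x (Suc m)"
        using P_rng(2)[of "[j]" "Suc m" x] x(2) by simp
      then have "?d * P x (Suc m) = (?d * p j) * P x (Suc m)" by (simp add: mult.assoc)
      then have "?d * P x (Suc m) = c j *\<^sub>C P x (Suc m)"
        unfolding dp using \<open>p j * P x (Suc m) = P x (Suc m)\<close> by (simp add: mult_scaleC_left)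
      then have "norm (c j) = norm (?d * P x (Suc m))" using x(3) by (simp add: norm_scaleC norm_P)
      also have "?d * P x (Suc m) = star (iso u) * (b * P y (m + Suc n)) * iso v"
        using iso_P[of v x "Suc m"] y(1) x(1) v by (simp add: mult.assoc add.commute)
      also have "norm \<dots> \<le> norm (star (iso u) * (b * P y (m + Suc n))) * 1"
        by (intro order.trans[OF norm_mult_ineq] mult_left_mono) (simp_all add: norm_iso_le)
      also have "\<dots> \<le> 1 * norm (b * P y (m + Suc n)) * 1"
        by (intro order.trans[OF norm_mult_ineq] mult_right_mono) (simp_all add: norm_iso_le)
      also have "1 * norm (b * P y (m + Suc n)) * 1 \<le> norm ((b - z) * P y (m + Suc n)) + norm (z * P y (m + Suc n))"
        using norm_triangle_ineq[of "(b - z) * P y (m + Suc n)" "z * P y (m + Suc n)"] by (simp add: algebra_simps)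
      also have "norm ((b - z) * P y (m + Suc n)) \<le> norm (b - z)"
        using norm_mult_ineq mult_left_le[OF norm_P_le norm_ge_zero] by (rule order.trans)
      finally show ?thesis by simp
    qed
    have "(\<lambda>m. norm (b - z) + norm (z * P y (m + Suc n))) \<longlonglongrightarrow> norm (b - z) + 0"
      by (intro tendsto_add tendsto_const LIMSEQ_ignore_initial_segment Z_lim z y)
    then have "norm (c j) \<le> norm (b - z) + 0" by (rule LIMSEQ_le_const) (use le in blast)
    moreover have "norm (p j) \<le> 1" by (rule norm_projection_le_1) auto
    ultimately show ?thesis unfolding dp norm_scaleC
      using mult_mono[of "norm (c j)" "norm (b - z)" "norm (p j)" 1] by simp
  qed
  have "?d = (\<Sum>j\<in>UNIV. ?d * p j)" by (simp add: sum_distrib_left[symmetric] sum_p)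
  then have "norm ?d = norm (\<Sum>j\<in>UNIV. ?d * p j)" by simp
  also have "\<dots> \<le> (\<Sum>j\<in>(UNIV::'n set). norm (b - z))" by (rule sum_norm_le) (rule bound)
  finally show ?thesis by simp
qed

text \<open>Summing over all entries is crude, but the constant depends on \<open>n\<close> alone,
  which suffices for \<open>quotient_norm_eq\<close>.\<close>

lemma core_weak_bound:
  assumes b: "b \<in> cspan (core n)" and z: "z \<in> Z"
  shows "norm b \<le> (real (card (words n)) * real (card (words n)) * real (CARD('n))) * norm (b - z)"
proof -
  have "b = (\<Sum>u\<in>words n. rng u) * b * (\<Sum>v\<in>words n. rng v)" by (simp add: sum_rng)
  also have "\<dots> = (\<Sum>u\<in>words n. \<Sum>v\<in>words n. rng u * b * rng v)"
    by (simp add: sum_distrib_left sum_distrib_right) (rule sum.swap)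
  finally have "norm b = norm (\<Sum>u\<in>words n. \<Sum>v\<in>words n. rng u * b * rng v)" by simp
  also have "\<dots> \<le> (\<Sum>u\<in>words n. \<Sum>v\<in>words n. real (CARD('n)) * norm (b - z))"
  proof (intro sum_norm_le)
    fix u v assume uv: "u \<in> words n" "v \<in> words n"
    have "rng u * b * rng v = iso u * (star (iso u) * b * iso v) * star (iso v)"
      by (simp add: rng_def mult.assoc)
    also have "norm \<dots> \<le> norm (iso u * (star (iso u) * b * iso v)) * 1"
      by (intro order.trans[OF norm_mult_ineq] mult_left_mono) (simp_all add: norm_iso_le)
    also have "\<dots> \<le> 1 * norm (star (iso u) * b * iso v) * 1"
      by (intro order.trans[OF norm_mult_ineq] mult_right_mono) (simp_all add: norm_iso_le)
    also have "\<dots> \<le> real (CARD('n)) * norm (b - z)"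
      using core_entry_bound[OF b z, of u v] uv by simp
    finally show "norm (rng u * b * rng v) \<le> real (CARD('n)) * norm (b - z)" .
  qed
  finally show ?thesis by (simp add: mult.assoc)
qed

lemma core_bound:
  assumes b: "b \<in> cspan (core n)" and z: "z \<in> Z"
  shows "norm b \<le> norm (b - z)"
proof (rule quotient_norm_eq[OF _ z, where \<alpha>=0])
  let ?C = "real (card (words n)) * real (card (words n)) * real (CARD('n))"
  show "b \<in> OA" using b core_M by blast
  fix m z assume z: "z \<in> Z"
  \<comment> \<open>All powers stay in the same finite-dimensional algebra, so one constant serves
    for all \<open>m\<close>.\<close>
  have "(star b * b) ^ m \<in> cspan (core n)"
    by (induction m) (simp_all add: core_one core_mult core_star b)
  from core_weak_bound[OF this z]
  show "norm ((star b * b) ^ m) \<le> (0 * real m + ?C) * norm ((star b * b) ^ m - z)" by simp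
qed simp_all

end

end

section \<open>Fourier analysis for the standard gauge action\<close>

context universal_ck
begin

context
  assumes nonpermutation: "\<not> permutation_matrix A"
begin

interpretation one: gauge A S "\<lambda>_. 1" 0
  by unfold_locales simp

text \<open>The action is isometric and fixes every \<open>P y n\<close>, so it leaves
  \<open>Z\<close> invariant.\<close>

lemma Z_fourier: "z \<in> Z \<Longrightarrow> one.fourier N k z \<in> Z"
proof -
  assume z: "z \<in> Z"
  have "one.\<rho> t z \<in> Z" for t
  proof -
    have "norm (one.\<rho> t z * P y n) = norm (z * P y n)" for y n
    proof -
      have "one.\<rho> t z * P y n = one.\<rho> t (z * P y n)"
        using star_hom_mult[OF one.hom_\<rho> Z_OA[OF z] P_OA] by (simp add: one.\<rho>_P)
      then show ?thesis by (simp add: one.norm_\<rho> OA_intros Z_OA z P_OA)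
    qed
    then show ?thesis using z by (simp add: Z_def one.\<rho>_OA)
  qed
  then show ?thesis unfolding one.fourier_def by (intro Z_scaleR Z_sum Z_scaleC)
qed

text \<open>For the constant function 1 the Birkhoff sum is the length, so degree 0 means words of
  equal length.\<close>

lemma one_gens_core: "b \<in> cspan (one.gens 0) \<Longrightarrow> \<exists>n. b \<in> cspan (core n)"
proof (induction rule: cspan_induct)
  case (add c g y)
  then obtain u v x m where g: "g = iso u * P x m * star (iso v)" "length u = length v"
    by (auto simp: one.gens_def birkhoff_sum_def)
  let ?w = "prefix m x"
  have "g = mon (u @ ?w) (v @ ?w)"
    by (simp add: g mon_def P_def rng_def iso_append star_mult mult.assoc)
  then have gc: "g \<in> cspan (core (length u + m))" using g mon_core[of "u @ ?w" _ "v @ ?w"] by simp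
  obtain n where n: "y \<in> cspan (core n)" using add by blast
  let ?k = "max n (length u + m)"
  have "g \<in> cspan (core ?k)" "y \<in> cspan (core ?k)"
    using core_mono[of n ?k] core_mono[of "length u + m" ?k] gc n by auto
  then show ?case by (blast intro: cspan_add cspan_scaleC)
qed auto

text \<open>In degree 0 the bound passes from the finite-dimensional algebras to limits. Degree
  \<open>k\<close> reduces to degree 0 through \<open>star b * b\<close>, with
  \<open>star b * z\<close> in place of \<open>z\<close>.\<close>

lemma V_bound:
  assumes b: "b \<in> one.V k" and z: "z \<in> Z"
  shows "norm b \<le> norm (b - z)"
proof -
  have V0: "norm b \<le> norm (b - z)" if b: "b \<in> one.V 0" and z: "z \<in> Z" for b z
  proof (rule field_le_epsilon)
    fix e :: real assume "e > 0"
    then obtain b' where b': "b' \<in> cspan (one.gens 0)" "norm (b - b') < e/2"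
      using one.approx_gens[OF b, of "e/2"] by auto
    obtain n where "b' \<in> cspan (core n)" using one_gens_core[OF b'(1)] by blast
    then have "norm b' \<le> norm (b' - z)" by (rule core_bound[OF nonpermutation _ z])
    moreover have "norm b \<le> norm b' + norm (b - b')" using norm_triangle_ineq[of b' "b - b'"] by simp
    moreover have "norm (b' - z) \<le> norm (b - z) + norm (b - b')"
      using norm_triangle_ineq4[of "b - z" "b - b'"] by (simp add: algebra_simps)
    ultimately show "norm b \<le> norm (b - z) + e" using b'(2) by linarith
  qed
  have "star b * b \<in> one.V 0" using one.V_mult[OF one.V_star[OF b] b] by simp
  moreover have "star b * z \<in> Z" using one.V_OA[OF b] z by (intro Z_mult_left OA_intros)
  ultimately have "norm (star b * b) \<le> norm (star b * b - star b * z)" by (rule V0)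
  also have "\<dots> \<le> norm b * norm (b - z)"
    using norm_mult_ineq[of "star b" "b - z"] by (simp add: right_diff_distrib)
  finally have "norm b * norm b \<le> norm b * norm (b - z)" by (simp add: cstar_identity power2_eq_square)
  then show ?thesis by (cases "norm b = 0") (auto simp: mult_le_cancel_left)
qed

definition T :: "nat \<Rightarrow> 'a set" where "T L = cspan (\<Union>d\<in>{- int L..int L}. one.V d)"

lemma T_OA: "T L \<subseteq> OA"
  unfolding T_def by (rule cspan_subset_subalgebra[OF subalgebra_OA]) (auto dest: one.V_OA)

lemma T_mult: "x \<in> T L \<Longrightarrow> y \<in> T L' \<Longrightarrow> x * y \<in> T (L + L')"
  unfolding T_def
proof (erule cspan_mult[rotated])
  fix g h assume "g \<in> (\<Union>d\<in>{- int L..int L}. one.V d)" "h \<in> (\<Union>d\<in>{- int L'..int L'}. one.V d)"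
  then obtain d d' where d: "- int L \<le> d" "d \<le> int L" "- int L' \<le> d'" "d' \<le> int L'"
    "g \<in> one.V d" "h \<in> one.V d'" by auto
  then have "g * h \<in> one.V (d + d')" "d + d' \<in> {- int (L + L')..int (L + L')}"
    by (auto intro: one.V_mult)
  then show "g * h \<in> cspan (\<Union>d\<in>{- int (L + L')..int (L + L')}. one.V d)" by (blast intro: cspan_base)
qed

lemma T_star: "x \<in> T L \<Longrightarrow> star x \<in> T L"
  unfolding T_def
proof (erule cspan_star[rotated])
  fix g assume "g \<in> (\<Union>d\<in>{- int L..int L}. one.V d)"
  then obtain d where "- int L \<le> d" "d \<le> int L" "g \<in> one.V d" by auto
  then have "star g \<in> one.V (- d)" "- d \<in> {- int L..int L}" by (auto intro: one.V_star)
  then show "star g \<in> cspan (\<Union>d\<in>{- int L..int L}. one.V d)" by (blast intro: cspan_base)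
qed

lemma T_weak_bound:
  assumes b: "b \<in> T L" and z: "z \<in> Z"
  shows "norm b \<le> (2 * real L + 1) * norm (b - z)"
proof -
  \<comment> \<open>Two degrees between \<open>-L\<close> and \<open>L\<close> differ by at most
    \<open>2 * L\<close>, so averages over \<open>N\<close> roots of unity separate them.\<close>
  define N where "N = Suc (2 * L)"
  let ?I = "{- int L..int L}"
  have "x \<in> OA \<and> (\<forall>k\<in>?I. one.fourier N k x \<in> one.V k) \<and> x = (\<Sum>k\<in>?I. one.fourier N k x)"
    if "x \<in> T L" for x
    using that unfolding T_def
  proof (induction rule: cspan_induct)
    case zero
    show ?case by (simp add: one.fourier_zero one.V_zero OA_intros)
  next
    case (add c g y)
    then obtain d where d: "d \<in> ?I" "g \<in> one.V d" by blast
    have g: "g \<in> OA" "one.fourier N k g = (if d = k then g else 0)" if "k \<in> ?I" for k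
      using one.V_OA[OF d(2)] one.fourier_V[OF d(2), of k N] d(1) that by (auto simp: N_def)
    have y: "y \<in> OA" "\<And>k. k \<in> ?I \<Longrightarrow> one.fourier N k y \<in> one.V k" "(\<Sum>k\<in>?I. one.fourier N k y) = y"
      using add by auto
    have F: "one.fourier N k (c *\<^sub>C g + y) = (if d = k then c *\<^sub>C g else 0) + one.fourier N k y" if "k \<in> ?I" for k
      using g y that by (simp add: one.fourier_add one.fourier_scaleC OA_intros)
    have "(\<Sum>k\<in>?I. one.fourier N k (c *\<^sub>C g + y)) = (\<Sum>k\<in>?I. (if d = k then c *\<^sub>C g else 0)) + y"
      using F y(3) by (simp add: sum.distrib)
    also have "\<dots> = c *\<^sub>C g + y" using d by simp
    finally show ?case using F g y d
      by (auto intro!: OA_intros one.V_add one.V_scaleC simp: one.V_zero)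
  qed
  from this[OF b] have bV: "\<And>k. k \<in> ?I \<Longrightarrow> one.fourier N k b \<in> one.V k"
    and bs: "b = (\<Sum>k\<in>?I. one.fourier N k b)" and bO: "b \<in> OA" by auto
  have "norm (\<Sum>k\<in>?I. one.fourier N k b) \<le> (\<Sum>k\<in>?I. norm (b - z))"
  proof (rule sum_norm_le)
    fix k assume k: "k \<in> ?I"
    have "norm (one.fourier N k b) \<le> norm (one.fourier N k b - one.fourier N k z)"
      by (rule V_bound[OF bV[OF k] Z_fourier[OF z]])
    also have "\<dots> = norm (one.fourier N k (b - z))" by (simp add: one.fourier_diff bO Z_OA z)
    also have "\<dots> \<le> norm (b - z)" by (intro one.norm_fourier_le OA_intros bO Z_OA z)
    finally show "norm (one.fourier N k b) \<le> norm (b - z)" .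
  qed
  then show ?thesis using bs by (simp add: add.commute)
qed

text \<open>The \<open>m\<close>-th power of \<open>star b * b\<close> has degree at most
  \<open>2 * L * m\<close>, so the loss is \<open>4 * L * m + 1\<close>. It grows linearly in
  \<open>m\<close>, which explains the linear factor in
  \<open>norm_le_if_power_bound\<close>.\<close>

lemma T_bound:
  assumes b: "b \<in> T L" and z: "z \<in> Z"
  shows "norm b \<le> norm (b - z)"
proof (rule quotient_norm_eq[OF _ z, where \<alpha>="4 * real L" and \<beta>=1])
  show "b \<in> OA" using b T_OA by blast
  fix m z assume z: "z \<in> Z"
  have "(star b * b) ^ m \<in> T (m * (L + L))"
  proof (induction m)
    case 0
    have "1 \<in> T 0" unfolding T_def using one.one_V0 by (intro cspan_base) auto
    then show ?case by simp
  next
    case (Suc m)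
    then show ?case using T_mult[OF T_mult[OF T_star[OF b] b] Suc] by simp
  qed
  from T_weak_bound[OF this z]
  show "norm ((star b * b) ^ m) \<le> (4 * real L * real m + 1) * norm ((star b * b) ^ m - z)"
    by (simp add: algebra_simps)
qed simp_all

text \<open>The element itself serves as \<open>z\<close>: for \<open>b\<close> near
  \<open>a\<close> the bound says that \<open>norm b\<close> is at most the small
  \<open>norm (b - a)\<close>.\<close>

theorem Z_trivial:
  assumes a: "a \<in> Z"
  shows "a = 0"
proof -
  have "norm a \<le> 0 + e" if "e > 0" for e
  proof -
    have "e/2 > 0" using that by simp
    then obtain b where b: "b \<in> M" "norm (a - b) < e/2" by (rule approx_M[OF Z_OA[OF a]])
    obtain L :: nat where "b \<in> cspan (\<Union>d\<in>{- int L..int L}. one.gens d)" using one.M_gens[OF b(1)] by blast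
    moreover have "cspan (\<Union>d\<in>{- int L..int L}. one.gens d) \<subseteq> T L"
      unfolding T_def by (intro cspan_mono UN_mono one.gens_V) auto
    ultimately have "norm b \<le> norm (b - a)" using T_bound[OF _ a] by blast
    then show ?thesis using b(2) norm_triangle_ineq[of b "a - b"] norm_minus_commute[of b a] by simp
  qed
  then have "norm a \<le> 0" by (rule field_le_epsilon)
  then show ?thesis by simp
qed

end

end

section \<open>Minimality and simplicity\<close>

context ck_family
begin

text \<open>Compressing to small cylinders around an aperiodic point kills all off-diagonal monomials.\<close>

lemma corner_scalar:
  assumes y: "y \<in> X" "aperiodic y" and c: "c \<in> M"
  shows "\<exists>\<kappa> N. \<forall>n\<ge>N. P y n * c * P y n = \<kappa> *\<^sub>C P y n"
  using c
proof (induction rule: cspan_induct)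
  case zero
  show ?case by (rule exI[of _ 0]) simp
next
  case (add d g c)
  then obtain u v where g: "g = mon u v" by auto
  have "\<exists>\<kappa> N. \<forall>n\<ge>N. P y n * g * P y n = \<kappa> *\<^sub>C P y n"
  proof (cases "prefix (length u) y = u \<and> prefix (length v) y = v")
    case False
    have "P y n * g * P y n = 0" if "n \<ge> max (length u) (length v)" for n
    proof (cases "prefix (length u) y = u")
      case True
      then have "star (P y n * iso v) = 0" using P_iso_other[of v n y] False that by simp
      then have "star (iso v) * P y n = 0" by (simp only: star_mult P_star)
      then show ?thesis by (simp add: g mon_def mult.assoc)
    next
      case False
      then have "P y n * iso u = 0" using P_iso_other[of u n y] that by simp
      then show ?thesis by (simp add: g mon_def mult.assoc[symmetric])
    qed
    then show ?thesis by (intro exI[of _ 0] exI[of _ "max (length u) (length v)"]) simp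
  next
    case True
    define x x' where "x = suffix (length u) y" and "x' = suffix (length v) y"
    have yu: "y = u \<frown> x" and yv: "y = v \<frown> x'"
      using conc_suffix[where w=u and y=y] conc_suffix[where w=v and y=y] True by (simp_all add: x_def x'_def)
    have e: "P y n * g * P y n = iso u * (P x (n - length u) * P x' (n - length v)) * star (iso v)"
      if "n \<ge> max (length u) (length v)" for n
    proof -
      have "P y n * g * P y n = (P y n * iso u) * (star (iso v) * P y n)"
        by (simp add: g mon_def mult.assoc)
      also have "P y n * iso u = iso u * P x (n - length u)"
        using P_iso[of u x n] yu y(1) that by simp
      also have "star (iso v) * P y n = P x' (n - length v) * star (iso v)"
        using star_iso_P[of v x' n] yv y(1) that by simp
      finally show ?thesis by (simp add: mult.assoc)
    qed
    show ?thesis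
    proof (cases "length u = length v")
      case same: True
      then have "u = v" using True by metis
      have "P y n * g * P y n = 1 *\<^sub>C P y n" if "n \<ge> length u" for n
        using that True \<open>u = v\<close> by (simp add: g mon_def P_rng(1) flip: rng_def)
      then show ?thesis by blast
    next
      case False
      \<comment> \<open>Tails of an aperiodic point at different positions differ at some index
        \<open>i\<close>; once both prefixes reach beyond \<open>i\<close>, their cylinders are
        disjoint.\<close>
      then have "x \<noteq> x'" using y(2) unfolding x_def x'_def aperiodic_def by blast
      then obtain i where i: "x i \<noteq> x' i" by blast
      have "P y n * g * P y n = 0" if n: "n \<ge> length u + length v + Suc i" for n
      proof -
        let ?m = "min (n - length u) (n - length v)"
        have "i < ?m" using n by (simp add: less_diff_conv)
        then have "prefix ?m x \<noteq> prefix ?m x'" using i by (auto simp: prefix_eq_iff)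
        then have "P x (n - length u) * P x' (n - length v) = 0" by (simp add: P_P)
        then show ?thesis using e[of n] n by simp
      qed
      then show ?thesis
        by (intro exI[of _ 0] exI[of _ "length u + length v + Suc i"]) simp
    qed
  qed
  then obtain \<kappa> N where N: "\<And>n. n \<ge> N \<Longrightarrow> P y n * g * P y n = \<kappa> *\<^sub>C P y n" by blast
  obtain \<kappa>' N' where N': "\<And>n. n \<ge> N' \<Longrightarrow> P y n * c * P y n = \<kappa>' *\<^sub>C P y n" using add by blast
  have "P y n * (d *\<^sub>C g + c) * P y n = (d * \<kappa> + \<kappa>') *\<^sub>C P y n" if "n \<ge> max N N'" for n
    using N[of n] N'[of n] that
    by (simp add: distrib_left distrib_right mult_scaleC_left mult_scaleC_right scaleC_scaleC scaleC_add_left)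
  then show ?case by blast
qed

end

lemma closed_idealD:
  assumes "closed_ideal J B"
  shows "J \<subseteq> B" "0 \<in> J" "closed J" "x \<in> J \<Longrightarrow> y \<in> J \<Longrightarrow> x + y \<in> J"
    "x \<in> J \<Longrightarrow> c *\<^sub>C x \<in> J" "b \<in> B \<Longrightarrow> x \<in> J \<Longrightarrow> b * x \<in> J" "b \<in> B \<Longrightarrow> x \<in> J \<Longrightarrow> x * b \<in> J"
  using assms by (auto simp: closed_ideal_def)

text \<open>The Neumann series argument: all \<open>e - d\<^sup>n\<close> lie in the ideal for \<open>d = e - x\<close>.\<close>

lemma projection_in_ideal:
  assumes J: "closed_ideal J B" and B: "cstar_subalgebra B"
    and e: "e \<in> B" and x: "x \<in> J" "e * x = x" "x * e = x" "e * e = e" and n: "norm (e - x) < 1"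
  shows "e \<in> J"
proof -
  note D = closed_idealD[OF J]
  define d where "d = e - x"
  have d: "d \<in> B" "e * d = d" "d * e = d"
    using e x D(1) by (auto simp: d_def algebra_simps intro: cstar_subalgebra_diff[OF B])
  have "e - d ^ Suc n \<in> J" for n
  proof (induction n)
    case 0
    then show ?case using x(1) by (simp add: d_def)
  next
    case (Suc n)
    have "e - d ^ Suc (Suc n) = (e - d) + (e - d ^ Suc n) * d"
      using d(2) by (simp add: algebra_simps power_commutes)
    also have "e - d = x" by (simp add: d_def)
    also have "x + (e - d ^ Suc n) * d \<in> J" using Suc x(1) d(1) by (intro D(4,7))
    finally show ?case .
  qed
  moreover have "(\<lambda>n. e - d ^ Suc n) \<longlonglongrightarrow> e - 0"
    using n unfolding d_def[symmetric]
    by (intro tendsto_diff tendsto_const LIMSEQ_Suc LIMSEQ_power_zero)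
  ultimately show ?thesis using closed_sequentially[OF D(3), of "\<lambda>n. e - d ^ Suc n" e] by simp
qed

context gauge
begin

abbreviation "birk \<equiv> birkhoff_sum f"

lemma gensI:
  "n0 \<le> m \<Longrightarrow> u \<frown> x \<in> X \<Longrightarrow> v \<frown> x \<in> X \<Longrightarrow>
    birk (length u) (u \<frown> x) - birk (length v) (v \<frown> x) = d \<Longrightarrow> iso u * P x m * star (iso v) \<in> gens d"
  unfolding gens_def by blast

lemma birkhoff_cong:
  assumes "x \<in> X" "y \<in> X" "prefix (k + m) x = prefix (k + m) y" "n0 \<le> m"
  shows "birk k x = birk k y"
  unfolding birkhoff_sum_def shift_funpow
proof (rule sum.cong)
  fix i assume "i \<in> {..<k}"
  then have "prefix n0 (suffix i x) = prefix n0 (suffix i y)"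
    unfolding prefix_eq_iff using assms(3)[unfolded prefix_eq_iff] assms(4) by simp
  then show "f (suffix i x) = f (suffix i y)" using assms(1,2) by (intro level suffix_in)
qed simp

text \<open>A nonzero \<open>a\<close> lies outside \<open>Z\<close>, so it stays visible along some
  aperiodic point. There the compression of \<open>star a * a\<close> is close to a multiple of a
  cylinder projection, relative to the size of the multiple.\<close>

lemma ideal_contains_cylinder:
  assumes np: "\<not> permutation_matrix A" and J: "closed_ideal J (V 0)" and nz: "J \<noteq> {0}"
  shows "\<exists>w. adm w \<and> rng w \<in> J"
proof -
  note D = closed_idealD[OF J]
  obtain a where a: "a \<in> J" "a \<noteq> 0" using nz D(2) by blast
  have aV: "a \<in> V 0" and aO: "a \<in> OA" using a D(1) V_OA by blast+
  have "a \<notin> Z" using Z_trivial[OF np] a by blast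
  then obtain y where y: "y \<in> X" "aperiodic y" and nlim: "\<not> (\<lambda>n. norm (a * P y n)) \<longlonglongrightarrow> 0"
    using aO by (auto simp: Z_def)
  \<comment> \<open>\<open>norm (a * P y n)\<close> decreases in \<open>n\<close>, so failing to
    tend to 0 means being bounded away from 0.\<close>
  have "\<exists>\<delta>>0. \<forall>n. \<delta> \<le> norm (a * P y n)"
  proof (rule ccontr)
    assume no: "\<not> (\<exists>\<delta>>0. \<forall>n. \<delta> \<le> norm (a * P y n))"
    have "(\<lambda>n. norm (a * P y n)) \<longlonglongrightarrow> 0"
    proof (rule LIMSEQ_I)
      fix e :: real assume "0 < e"
      then obtain n where n: "norm (a * P y n) < e" using no by (meson not_le)
      have "norm (a * P y m) < e" if "n \<le> m" for m
      proof -
        have "a * P y m = a * P y n * P y m" using P_mono(1)[OF that] by (simp add: mult.assoc)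
        also have "norm \<dots> \<le> norm (a * P y n)"
          by (rule order.trans[OF norm_mult_ineq mult_left_le[OF norm_P_le norm_ge_zero]])
        finally show ?thesis using n by simp
      qed
      then show "\<exists>N. \<forall>n\<ge>N. norm (norm (a * P y n) - 0) < e" by auto
    qed
    then show False using nlim by blast
  qed
  then obtain \<delta> where \<delta>: "\<delta> > 0" "\<And>n. \<delta> \<le> norm (a * P y n)" by blast
  define h where "h = star a * a"
  have hJ: "h \<in> J" unfolding h_def by (intro D(6) cstar_subalgebra_star[OF subalgebra_V0] aV a)
  have hO: "h \<in> OA" using hJ D(1) V_OA by blast
  have "\<delta>\<^sup>2 / 3 > 0" using \<delta> by simp
  \<comment> \<open>A third is small enough: the compression has norm at least the square of
    \<open>\<delta>\<close>, so \<open>\<kappa>\<close> keeps a modulus larger than the error, and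
    the quotient of the two is below 1.\<close>
  then obtain c where c: "c \<in> M" "norm (h - c) < \<delta>\<^sup>2 / 3" by (rule approx_M[OF hO])
  obtain \<kappa> n where \<kappa>: "P y n * c * P y n = \<kappa> *\<^sub>C P y n" using corner_scalar[OF y c(1)] by blast
  let ?e = "P y n"
  define b where "b = ?e * h * ?e"
  have bJ: "b \<in> J" unfolding b_def by (intro D(6,7) P_V0 hJ)
  have "norm b = (norm (a * ?e))\<^sup>2"
    unfolding cstar_identity[symmetric] by (simp add: b_def h_def star_mult mult.assoc)
  then have nb: "\<delta>\<^sup>2 \<le> norm b" using \<delta> by (simp add: power_mono)
  have "b - \<kappa> *\<^sub>C ?e = ?e * (h - c) * ?e"
    unfolding \<kappa>[symmetric] b_def by (simp add: left_diff_distrib right_diff_distrib)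
  also have "norm \<dots> \<le> norm (?e * (h - c))"
    by (rule order.trans[OF norm_mult_ineq mult_left_le[OF norm_P_le norm_ge_zero]])
  also have "\<dots> \<le> norm (h - c)"
    by (rule order.trans[OF norm_mult_ineq mult_left_le_one_le[OF norm_ge_zero norm_ge_zero norm_P_le]])
  finally have close: "norm (b - \<kappa> *\<^sub>C ?e) < \<delta>\<^sup>2 / 3" using c(2) by simp
  have l: "cmod \<kappa> > \<delta>\<^sup>2 / 3"
  proof -
    have "norm b \<le> norm (b - \<kappa> *\<^sub>C ?e) + norm (\<kappa> *\<^sub>C ?e)"
      using norm_triangle_ineq[of "b - \<kappa> *\<^sub>C ?e" "\<kappa> *\<^sub>C ?e"] by simp
    then have "\<delta>\<^sup>2 < \<delta>\<^sup>2 / 3 + cmod \<kappa>" using nb close y(1) by (simp add: norm_scaleC norm_P)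
    moreover have "\<delta>\<^sup>2 > 0" using \<delta>(1) by simp
    ultimately show ?thesis by linarith
  qed
  then have l0: "\<kappa> \<noteq> 0" using \<open>\<delta>\<^sup>2 / 3 > 0\<close> by auto
  define x where "x = (1 / \<kappa>) *\<^sub>C b"
  have "?e \<in> J"
  proof (rule projection_in_ideal[OF J subalgebra_V0 P_V0])
    show "x \<in> J" unfolding x_def by (intro D(5) bJ)
    have "?e * b = b" "b * ?e = b" unfolding b_def by (simp_all add: mult.assoc) (simp flip: mult.assoc)
    then show "?e * x = x" "x * ?e = x" by (simp_all add: x_def mult_scaleC_left mult_scaleC_right)
    show "?e * ?e = ?e" by simp
    have "?e - x = (1 / \<kappa>) *\<^sub>C (\<kappa> *\<^sub>C ?e - b)"
      using l0 by (simp add: x_def scaleC_diff_right scaleC_scaleC)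
    then have "norm (?e - x) = norm (b - \<kappa> *\<^sub>C ?e) / cmod \<kappa>"
      by (simp add: norm_scaleC norm_divide norm_minus_commute)
    also have "\<dots> < 1" using close l by (simp add: divide_less_eq)
    finally show "norm (?e - x) < 1" .
  qed
  then show ?thesis using adm_prefix[OF y(1)] unfolding P_def by blast
qed

lemma simple_if_minimal:
  assumes np: "\<not> permutation_matrix A" and minimal: "minimal_function A f"
  shows "simple_cstar (V 0)"
  unfolding simple_cstar_def
proof (intro conjI allI impI subalgebra_V0)
  show "V 0 \<noteq> {0}" using one_V0 zero_neq_one by (metis singletonD)
  fix J assume J: "closed_ideal J (V 0)"
  note D = closed_idealD[OF J]
  have "1 \<in> J" if nz: "J \<noteq> {0}"
  proof -
    obtain \<mu> where \<mu>: "adm \<mu>" "rng \<mu> \<in> J" using ideal_contains_cylinder[OF np J nz] by blast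
    have "\<exists>n. \<forall>z\<in>X. rng (prefix n z) \<in> J"
    proof (rule uniform_prefix)
      fix z assume z: "z \<in> X"
      obtain x k l where "x \<in> cylinder A \<mu>"
        and kl: "suffix k x = suffix l z" "birk k x = birk l z"
        using minimal z \<mu>(1) unfolding minimal_function_def admissible_words_eq shift_funpow by blast
      then have x: "x \<in> X" "prefix (length \<mu>) x = \<mu>" by (simp_all add: cylinder_iff)
      \<comment> \<open>\<open>s\<close> is the common tail of \<open>x\<close> and
        \<open>z\<close>. The length \<open>m\<close> covers \<open>n0\<close>, which makes
        \<open>g\<close> below homogeneous, and the length of \<open>\<mu>\<close>, which puts the
        source cylinder of \<open>g\<close> inside that of \<open>\<mu>\<close>; the extra 1 keeps
        the prefix nonempty for \<open>iso_conc_P\<close>.\<close>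
      define s m where "s = suffix k x" and "m = Suc (n0 + length \<mu>)"
      define u v where "u = prefix k x" and "v = prefix l z"
      have xu: "u \<frown> s = x" unfolding u_def s_def by (rule prefix_suffix[symmetric])
      have zv: "v \<frown> s = z" unfolding v_def s_def kl(1) by (rule prefix_suffix[symmetric])
      define g where "g = iso v * P s m * star (iso u)"
      have "g \<in> gens 0"
        unfolding g_def by (rule gensI) (use x(1) z xu zv kl(2) in \<open>simp_all add: u_def v_def m_def\<close>)
      then have gV: "g \<in> V 0" using gens_V by blast
      have "P s m * star (iso u) * rng \<mu> = P s m * star (iso u)"
      proof -
        have "P s m * star (iso u) = star (iso u) * P x (length u + m)"
          using star_iso_P[of u s "length u + m"] xu x(1) by simp
        moreover have "P x (length u + m) * rng \<mu> = P x (length u + m)"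
          using P_rng(1)[of \<mu> "length u + m" x] x(2) by (simp add: m_def)
        ultimately show ?thesis by (simp add: mult.assoc)
      qed
      then have "g * rng \<mu> = g" by (simp add: g_def mult.assoc)
      then have "g \<in> J" using D(6)[OF gV \<mu>(2)] by simp
      then have "g * star g \<in> J" by (intro D(7) cstar_subalgebra_star[OF subalgebra_V0] gV)
      also have "g * star g = iso v * P s m * (star (iso u) * iso u * P s m) * star (iso v)"
        by (simp only: g_def star_mult star_star P_star mult.assoc)
      also have "\<dots> = iso v * (P s m * P s m) * star (iso v)"
        using iso_conc_P[of u s "n0 + length \<mu>"] xu x(1) by (simp add: m_def mult.assoc)
      also have "\<dots> = rng (v @ prefix m s)"
        by (simp add: P_def) (simp add: rng_def iso_append star_mult mult.assoc)
      also have "v @ prefix m s = prefix (l + m) z"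
        using zv by (metis add_diff_cancel_left' prefix_conc_snd le_add1 subsequence_length minus_nat.diff_0 v_def)
      finally show "\<exists>n. rng (prefix n z) \<in> J" by blast
    next
      fix x n m assume "x \<in> X" "n \<le> m" "rng (prefix n x) \<in> J"
      then have "P x m * P x n \<in> J" by (intro D(6) P_V0) (simp add: P_def)
      then show "rng (prefix m x) \<in> J" using P_mono(2)[OF \<open>n \<le> m\<close>, of x] by (simp add: P_def)
    qed
    then obtain n where n: "\<And>z. z \<in> X \<Longrightarrow> rng (prefix n z) \<in> J" by blast
    have rJ: "rng w \<in> J" if "w \<in> words n" for w
    proof (cases "adm w")
      case True
      then show ?thesis using n[of "pt w"] pt[of w] that by simp
    next
      case False
      then have "rng w = 0" by (simp add: rng_eq_0_iff)
      then show ?thesis using D(2) by simp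
    qed
    have "(\<Sum>w\<in>W. rng w) \<in> J" if "W \<subseteq> words n" for W
      using finite_subset[OF that finite_words] that
      by (induction W rule: finite_induct) (simp_all add: D(2,4) rJ)
    from this[of "words n"] show "1 \<in> J" by (simp add: sum_rng)
  qed
  then show "J = {0} \<or> J = V 0" using D(1) D(6)[of _ 1] by (metis mult_1_right subsetI subset_antisym)
qed

lemma minimal_if_simple:
  assumes simple: "simple_cstar (V 0)"
  shows "minimal_function A f"
proof (rule ccontr)
  assume "\<not> minimal_function A f"
  then obtain z \<mu> where z: "z \<in> X" and \<mu>: "adm \<mu>"
    and "\<not> (\<exists>x\<in>cylinder A \<mu>. \<exists>k l. suffix k x = suffix l z \<and> birk k x = birk l z)"
    unfolding minimal_function_def admissible_words_eq shift_funpow by blast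
  then have no: "birk k x \<noteq> birk l z"
    if "x \<in> X" "prefix (length \<mu>) x = \<mu>" "suffix k x = suffix l z" for x k l
    using that cylinder_iff by blast
  \<comment> \<open>The quantifier over \<open>a\<close> builds in closure under left
    multiplication, and right multiplication only costs a constant factor. The unit stays outside
    because each \<open>P z n\<close> has norm 1.\<close>
  define J where "J = {b \<in> V 0. \<forall>a\<in>V 0. (\<lambda>n. norm (P z n * a * b)) \<longlonglongrightarrow> 0}"
  have null: "(\<lambda>n. norm (P z n * a)) \<longlonglongrightarrow> 0"
    if approx: "\<And>e. e > 0 \<Longrightarrow> \<exists>b. norm (a - b) < e \<and> (\<lambda>n. norm (P z n * b)) \<longlonglongrightarrow> 0" for a
  proof (rule LIMSEQ_I)
    fix e :: real assume e: "0 < e"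
    then obtain b where b: "norm (a - b) < e/2" "(\<lambda>n. norm (P z n * b)) \<longlonglongrightarrow> 0"
      using approx[of "e/2"] by auto
    obtain N where N: "\<And>n. n \<ge> N \<Longrightarrow> norm (P z n * b) < e/2" using LIMSEQ_D[OF b(2), of "e/2"] e by auto
    have "norm (P z n * a) < e" if "n \<ge> N" for n
    proof -
      have "norm (P z n * a) \<le> norm (P z n * (a - b)) + norm (P z n * b)"
        using norm_triangle_ineq[of "P z n * (a - b)" "P z n * b"] by (simp add: algebra_simps)
      also have "norm (P z n * (a - b)) \<le> norm (a - b)"
        by (rule order.trans[OF norm_mult_ineq mult_left_le_one_le[OF norm_ge_zero norm_ge_zero norm_P_le]])
      finally show ?thesis using b(1) N[OF that] by simp
    qed
    then show "\<exists>N. \<forall>n\<ge>N. norm (norm (P z n * a) - 0) < e" by auto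
  qed
  note sub = cstar_subalgebra_intros[OF subalgebra_V0]
  have ideal: "closed_ideal J (V 0)"
    unfolding closed_ideal_def
  proof (intro conjI ballI allI)
    show "J \<subseteq> V 0" "0 \<in> J" by (auto simp: J_def V_zero)
    show "closed J"
      unfolding closed_sequential_limits
    proof (intro allI impI, elim conjE)
      fix g x assume g: "\<forall>n. g n \<in> J" and gx: "g \<longlonglongrightarrow> x"
      have x: "x \<in> V 0"
        by (rule closed_sequentially[OF cstar_subalgebra_closed[OF subalgebra_V0] _ gx]) (use g in \<open>simp add: J_def\<close>)
      have "(\<lambda>n. norm (P z n * (a * x))) \<longlonglongrightarrow> 0" if a: "a \<in> V 0" for a
      proof (rule null)
        fix e :: real assume "e > 0"
        have "(\<lambda>n. a * g n) \<longlonglongrightarrow> a * x" by (intro tendsto_intros gx)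
        then obtain k where "norm (a * g k - a * x) < e" using LIMSEQ_D[OF _ \<open>e > 0\<close>] by blast
        moreover have "(\<lambda>n. norm (P z n * (a * g k))) \<longlonglongrightarrow> 0"
          using g a by (simp add: J_def mult.assoc)
        ultimately show "\<exists>b. norm (a * x - b) < e \<and> (\<lambda>n. norm (P z n * b)) \<longlonglongrightarrow> 0"
          by (metis norm_minus_commute)
      qed
      then show "x \<in> J" using x by (simp add: J_def mult.assoc)
    qed
    fix x assume x: "x \<in> J"
    show "c *\<^sub>C x \<in> J" for c
    proof -
      have "(\<lambda>n. norm (P z n * a * (c *\<^sub>C x))) \<longlonglongrightarrow> 0" if "a \<in> V 0" for a
        using tendsto_mult_right_zero[of "\<lambda>n. norm (P z n * a * x)" sequentially "cmod c"] x that
        by (simp add: J_def mult_scaleC_right norm_scaleC)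
      then show ?thesis using x by (simp add: J_def sub)
    qed
    show "x + y \<in> J" if y: "y \<in> J" for y
    proof -
      have "(\<lambda>n. norm (P z n * a * (x + y))) \<longlonglongrightarrow> 0" if a: "a \<in> V 0" for a
      proof (rule Lim_null_comparison)
        show "(\<lambda>n. norm (P z n * a * x) + norm (P z n * a * y)) \<longlonglongrightarrow> 0"
          using tendsto_add[of "\<lambda>n. norm (P z n * a * x)" 0 sequentially "\<lambda>n. norm (P z n * a * y)" 0] x y a
          by (simp add: J_def)
        show "\<forall>\<^sub>F n in sequentially. norm (norm (P z n * a * (x + y))) \<le> norm (P z n * a * x) + norm (P z n * a * y)"
          by (rule always_eventually) (simp add: distrib_left norm_triangle_ineq)
      qed
      then show ?thesis using x y by (simp add: J_def sub)
    qed
    show "b * x \<in> J" if b: "b \<in> V 0" for b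
    proof -
      have "(\<lambda>n. norm (P z n * a * (b * x))) \<longlonglongrightarrow> 0" if a: "a \<in> V 0" for a
      proof -
        have "a * b \<in> V 0" using a b by (rule sub)
        then have "(\<lambda>n. norm (P z n * (a * b) * x)) \<longlonglongrightarrow> 0" using x unfolding J_def by blast
        then show ?thesis by (simp add: mult.assoc)
      qed
      then show ?thesis using x b by (simp add: J_def sub)
    qed
    show "x * b \<in> J" if b: "b \<in> V 0" for b
    proof -
      have "(\<lambda>n. norm (P z n * a * (x * b))) \<longlonglongrightarrow> 0" if a: "a \<in> V 0" for a
      proof (rule Lim_null_comparison)
        show "(\<lambda>n. norm (P z n * a * x) * norm b) \<longlonglongrightarrow> 0"
          using tendsto_mult_left_zero[of "\<lambda>n. norm (P z n * a * x)" sequentially "norm b"] x a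
          by (simp add: J_def)
        show "\<forall>\<^sub>F n in sequentially. norm (norm (P z n * a * (x * b))) \<le> norm (P z n * a * x) * norm b"
          using norm_mult_ineq[of "P z n * a * x" b for n] by (intro always_eventually) (simp add: mult.assoc)
      qed
      then show ?thesis using x b by (simp add: J_def sub)
    qed
  qed
  \<comment> \<open>A generator of degree 0 links \<open>z\<close> only to points with a common tail
    and equal Birkhoff sums. By assumption none of them lies in the cylinder of
    \<open>\<mu>\<close>, so the product vanishes exactly from some \<open>n\<close> on.\<close>
  have gen: "\<exists>N. \<forall>n\<ge>N. P z n * g * rng \<mu> = 0" if g: "g \<in> gens 0" for g
  proof -
    obtain u v x m where gx: "g = iso u * P x m * star (iso v)" and m: "n0 \<le> m"
      and X: "u \<frown> x \<in> X" "v \<frown> x \<in> X" and eq: "birk (length u) (u \<frown> x) = birk (length v) (v \<frown> x)"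
      using g by (auto simp: gens_def)
    show ?thesis
    proof (cases "prefix (length u) z = u")
      case False
      have "P z n * g * rng \<mu> = 0" if "n \<ge> length u" for n
        using P_iso_other[OF that, of z] False by (simp add: gx mult.assoc[symmetric])
      then show ?thesis by blast
    next
      case True
      define s where "s = suffix (length u) z"
      have zu: "z = u \<frown> s" using conc_suffix[OF True] by (simp add: s_def)
      have s: "s \<in> X" using z by (simp add: s_def suffix_in)
      \<comment> \<open>After removing \<open>u\<close>, enough letters of \<open>s\<close> must
        remain to decide agreement with \<open>x\<close> on \<open>m\<close> letters and to contain
        \<open>\<mu>\<close> in the prefix of \<open>v \<frown> s\<close>.\<close>
      have "P z n * g * rng \<mu> = 0" if n: "n \<ge> length u + m + Suc (length \<mu>)" for n
      proof -
        define k where "k = n - length u"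
        have k: "m \<le> k" "0 < k" "length \<mu> \<le> length v + k" using n by (auto simp: k_def)
        have "P z n * iso u = iso u * P s k" using P_iso[of u s n] z n by (simp add: zu k_def)
        then have e: "P z n * g * rng \<mu> = iso u * (P s k * P x m) * star (iso v) * rng \<mu>"
          by (simp add: gx mult.assoc[symmetric])
        show ?thesis
        proof (cases "prefix m s = prefix m x")
          case False
          then have "P s k * P x m = 0" using k by (simp add: P_P min_def)
          then show ?thesis unfolding e by simp
        next
          \<comment> \<open>Agreement on \<open>m\<close> letters, at least \<open>n0\<close>,
            transfers the equality of Birkhoff sums from the tail \<open>x\<close> to the tail
            \<open>s\<close> of \<open>z\<close>.\<close>
          case agree: True
          then have "P x m = P s m" by (simp add: P_def)
          then have "P s k * P x m = P s k" using P_mono(2)[OF k(1)] by simp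
          then have e': "P z n * g * rng \<mu> = iso u * (P s k * star (iso v)) * rng \<mu>"
            unfolding e by (simp add: mult.assoc)
          show ?thesis
          proof (cases "v \<frown> s \<in> X")
            case False
            then have "star (iso v * P s k) = 0" using iso_P_not_in[OF s False k(2)] by simp
            then have "P s k * star (iso v) = 0" by (simp only: star_mult P_star)
            then show ?thesis unfolding e' by simp
          next
            case vs: True
            have "P s k * star (iso v) = star (iso v) * P (v \<frown> s) (length v + k)"
              using star_iso_P[OF vs, of "length v + k"] by simp
            moreover have "P (v \<frown> s) (length v + k) * rng \<mu> = 0"
            proof -
              have "birk (length u) z = birk (length u) (u \<frown> x)"
                using agree m X(1) z by (intro birkhoff_cong[of _ _ _ m]) (auto simp: zu)
              moreover have "birk (length v) (v \<frown> s) = birk (length v) (v \<frown> x)"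
                using agree m X(2) vs by (intro birkhoff_cong[of _ _ _ m]) auto
              ultimately have "birk (length v) (v \<frown> s) = birk (length u) z" using eq by simp
              moreover have "suffix (length v) (v \<frown> s) = suffix (length u) z" by (simp add: zu)
              ultimately have "prefix (length \<mu>) (v \<frown> s) \<noteq> \<mu>" using no[OF vs] by blast
              then show ?thesis using P_rng(1)[OF k(3), of "v \<frown> s"] by simp
            qed
            ultimately show ?thesis unfolding e' by (simp add: mult.assoc)
          qed
        qed
      qed
      then show ?thesis by blast
    qed
  qed
  have span: "\<exists>N. \<forall>n\<ge>N. P z n * b * rng \<mu> = 0" if "b \<in> cspan (gens 0)" for b
    using that
  proof (induction rule: cspan_induct)
    case (add c g b)
    obtain N where N: "\<And>n. n \<ge> N \<Longrightarrow> P z n * g * rng \<mu> = 0" using gen[OF add(1)] by blast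
    obtain N' where N': "\<And>n. n \<ge> N' \<Longrightarrow> P z n * b * rng \<mu> = 0" using add by blast
    have "P z n * (c *\<^sub>C g + b) * rng \<mu> = 0" if "n \<ge> max N N'" for n
      using N[of n] N'[of n] that by (simp add: distrib_left distrib_right mult_scaleC_left mult_scaleC_right)
    then show ?case by blast
  qed simp
  have "rng \<mu> \<in> J"
  proof -
    have "(\<lambda>n. norm (P z n * (a * rng \<mu>))) \<longlonglongrightarrow> 0" if a: "a \<in> V 0" for a
    proof (rule null)
      fix e :: real assume "e > 0"
      with a obtain b where b: "b \<in> cspan (gens 0)" "norm (a - b) < e" by (rule approx_gens)
      have "norm (a * rng \<mu> - b * rng \<mu>) \<le> norm (a - b)"
        unfolding left_diff_distrib[symmetric]
        by (rule order.trans[OF norm_mult_ineq mult_left_le[OF norm_rng_le norm_ge_zero]])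
      moreover have "(\<lambda>n. norm (P z n * (b * rng \<mu>))) \<longlonglongrightarrow> 0"
        using span[OF b(1)] by (intro tendsto_eventually) (auto simp: eventually_sequentially mult.assoc)
      ultimately show "\<exists>b. norm (a * rng \<mu> - b) < e \<and> (\<lambda>n. norm (P z n * b)) \<longlonglongrightarrow> 0"
        using b(2) by (intro exI[of _ "b * rng \<mu>"]) auto
    qed
    then show ?thesis by (simp add: J_def rng_V0 mult.assoc)
  qed
  moreover have "rng \<mu> \<noteq> 0" using \<mu> by (simp add: rng_eq_0_iff)
  ultimately have "J = V 0" using simple ideal unfolding simple_cstar_def by blast
  then have "1 \<in> J" using one_V0 by simp
  then have "(\<lambda>n. norm (P z n * 1 * 1)) \<longlonglongrightarrow> 0" using one_V0 unfolding J_def by blast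
  then have "(\<lambda>n. 1 :: real) \<longlonglongrightarrow> 0" using norm_P[OF z] by simp
  then show False by (simp add: LIMSEQ_const_iff)
qed

end

theorem proposition2p17:
  fixes A :: "nat^'n::finite^'n"
    and S :: "'n \<Rightarrow> 'a::unital_cstar_algebra"
    and f :: "(nat \<Rightarrow> 'n) \<Rightarrow> int"
  assumes "zero_one_matrix A"
    and "irreducible_matrix A"
    and "\<not> permutation_matrix A"
    and "universal_cuntz_krieger_family A S"
    and "f \<in> continuous_int A"
  shows "minimal_function A f \<longleftrightarrow> simple_cstar (fixed_point_algebra A S f)"
proof -
  interpret universal_ck A S using assms by unfold_locales
  obtain n0 where "\<And>x y. x \<in> shift_space A \<Longrightarrow> y \<in> shift_space A \<Longrightarrow> prefix n0 x = prefix n0 y \<Longrightarrow> f x = f y"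
    by (rule continuous_int_locally_constant[OF assms(5)]) (rule that, blast)
  then interpret gauge A S f n0 by unfold_locales
  show ?thesis
    unfolding fixed_point_algebra_eq using simple_if_minimal[OF assms(3)] minimal_if_simple by blast
qed

end
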